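(* Let $f$ be a transcendental meromorphic function in $\mathbb{C}$ with a direct tract $D$. Then there is a constant $r_0>0$ such that if $U$ is a component of $F(f)$ which contains a Jordan curve surrounding the circle $\{z\in\mathbb{C}:|z|=r_0\}$, then $U$ is a Baker wandering domain.
   Context: $F(f)$ is the Fatou set. For a Fatou component $U$, $U_n$ is the Fatou component containing $f^n(U)$. A Baker wandering domain is a Fatou component $U$ with $U_m\ne U_n$ for $m\ne n$ such that for all large $n$, $U_n$ is a bounded multiply connected Fatou component surrounding $0$ and $U_n\to\infty$. A direct tract of $f$: an unbounded domain $D$ with piecewise smooth boundary curves and unbounded complement, $f$ holomorphic in $D$ and continuous on $\overline D$, and $R>0$ with $|f|=R$ on $\partial D$, $|f|>R$ in $D$. *)

theory Defs
  imports "HOL-Complex_Analysis.Complex_Analysis"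
begin

text \<open>Meromorphic functions in the plane are represented by nicely meromorphic
  functions on UNIV (only singularities are poles; the value at a pole is a dummy 0).\<close>

definition poles :: "(complex \<Rightarrow> complex) \<Rightarrow> complex set" where
  "poles f = {z. is_pole f z}"

definition transcendental_meromorphic :: "(complex \<Rightarrow> complex) \<Rightarrow> bool" where
  "transcendental_meromorphic f \<longleftrightarrow>
     f nicely_meromorphic_on UNIV \<and>
     \<not> (\<exists>p q :: complex poly. q \<noteq> 0 \<and> (\<forall>z. poly q z \<noteq> 0 \<longrightarrow> f z = poly p z / poly q z))"

definition normal_seq_on :: "(nat \<Rightarrow> complex \<Rightarrow> complex) \<Rightarrow> complex set \<Rightarrow> bool" where
  "normal_seq_on F V \<longleftrightarrow>
     (\<forall>m :: nat \<Rightarrow> nat. \<exists>r. strict_mono r \<and>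
        ((\<exists>g. \<forall>K. compact K \<and> K \<subseteq> V \<longrightarrow> uniform_limit K (\<lambda>k. F (m (r k))) g sequentially)
         \<or> (\<forall>K. compact K \<and> K \<subseteq> V \<longrightarrow>
              (\<forall>B. eventually (\<lambda>k. \<forall>z\<in>K. B \<le> norm (F (m (r k)) z)) sequentially))))"

definition fatou :: "(complex \<Rightarrow> complex) \<Rightarrow> complex set" where
  "fatou f = {z. \<exists>V. open V \<and> z \<in> V \<and>
                  (\<forall>n. \<forall>w\<in>V. (f ^^ n) w \<notin> poles f) \<and>
                  normal_seq_on (\<lambda>n. f ^^ n) V}"

definition fatou_component :: "(complex \<Rightarrow> complex) \<Rightarrow> complex set \<Rightarrow> bool" where
  "fatou_component f U \<longleftrightarrow> (\<exists>z\<in>fatou f. U = connected_component_set (fatou f) z)"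

text \<open>U_n: the Fatou component containing f^n(U) (well defined by invariance of F(f)).\<close>

definition iter_component :: "(complex \<Rightarrow> complex) \<Rightarrow> complex set \<Rightarrow> nat \<Rightarrow> complex set" where
  "iter_component f U n = connected_component_set (fatou f) ((f ^^ n) (SOME z. z \<in> U))"

definition surrounds_point :: "complex set \<Rightarrow> complex \<Rightarrow> bool" where
  "surrounds_point S a \<longleftrightarrow> (\<exists>C\<in>components (- S). bounded C \<and> a \<in> C)"

definition baker_wandering_domain :: "(complex \<Rightarrow> complex) \<Rightarrow> complex set \<Rightarrow> bool" where
  "baker_wandering_domain f U \<longleftrightarrow>
     fatou_component f U \<and>
     (\<forall>m n. m \<noteq> n \<longrightarrow> iter_component f U m \<noteq> iter_component f U n) \<and>
     (\<exists>N. \<forall>n\<ge>N. bounded (iter_component f U n) \<and>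
                 \<not> simply_connected (iter_component f U n) \<and>
                 surrounds_point (iter_component f U n) 0) \<and>
     (\<forall>R. eventually (\<lambda>n. \<forall>z\<in>iter_component f U n. R < norm z) sequentially)"

text \<open>Piecewise smooth boundary curves: the frontier is the union of countably many
  curves g : real => complex, piecewise C1 on every compact interval, each either a
  (two-sided infinite) Jordan arc or a periodically parametrised Jordan curve.\<close>

definition piecewise_smooth_boundary :: "complex set \<Rightarrow> bool" where
  "piecewise_smooth_boundary D \<longleftrightarrow>
     (\<exists>C :: (real \<Rightarrow> complex) set. countable C \<and>
        frontier D = (\<Union>g\<in>C. range g) \<and>
        (\<forall>g\<in>C. continuous_on UNIV g \<and>
                (\<forall>a b. g piecewise_C1_differentiable_on {a..b}) \<and>
                (inj g \<or> (\<exists>p>0. (\<forall>t. g (t + p) = g t) \<and> inj_on g {0..<p}))))"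

definition direct_tract :: "(complex \<Rightarrow> complex) \<Rightarrow> complex set \<Rightarrow> bool" where
  "direct_tract f D \<longleftrightarrow>
     open D \<and> connected D \<and> \<not> bounded D \<and> \<not> bounded (- D) \<and>
     piecewise_smooth_boundary D \<and>
     f holomorphic_on D \<and> continuous_on (closure D) f \<and>
     (\<exists>R>0. (\<forall>z\<in>frontier D. norm (f z) = R) \<and> (\<forall>z\<in>D. norm (f z) > R))"

end

theory Submission
  imports Defs
begin

text \<open>Let \<open>v = ln (|f| / R)\<close> on the tract \<open>D\<close> and \<open>v = 0\<close> outside, and let \<open>M(r)\<close> be the maximum of \<open>|f|\<close>
  over the part of \<open>D\<close> in the disc of radius \<open>r\<close>. Then \<open>ln M(r) / ln r \<rightarrow> \<infinity>\<close>: if all large circles leave \<open>D\<close>,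
  this is a harmonic measure estimate; otherwise the winding number of \<open>f\<close> along circles in \<open>D\<close> is
  unbounded. Consequently \<open>f\<close> maps the part of \<open>D\<close> in an annulus \<open>t < |z| < e\<^sup>8 t\<close> onto a superset of
  an annulus of the same shape whose inner radius exceeds \<open>M(t)\<close>, and chaining such annuli yields orbits
  of any length that stay in \<open>D\<close> and grow faster than iterates of \<open>M\<close>, all starting in a fixed disc.

  Let a curve \<open>\<gamma>\<close> in a Fatou component surround that disc. By the maximum principle \<open>|f\<^sup>n|\<close> is large
  somewhere on \<open>\<gamma>\<close>, hence everywhere on \<open>\<gamma>\<close> by normality and Harnack's inequality. The set of
  points inside \<open>\<gamma>\<close> with fast orbits in \<open>D\<close> is mapped by \<open>f\<^sup>n\<close> to an open set whose frontier lies
  in \<open>f\<^sup>n(\<gamma>)\<close> and a small disc; therefore \<open>f\<^sup>n(\<gamma>)\<close> surrounds \<open>0\<close>. Harnack's inequality and the growth of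
  \<open>M\<close> show that the components containing these curves are pairwise distinct, so each of them is enclosed
  between two curves of the sequence.\<close>

section \<open>Harmonic measure and winding numbers\<close>

text \<open>Poles of \<open>f\<close> may lie inside \<gamma>, so an iterate need not even be
  continuous there. Maximum and open mapping arguments for iterates are therefore confined to points
  whose orbit has stayed in \<open>D\<close> so far. It is enough to have, for each single
  \<open>n\<close>, one such orbit of length \<open>n\<close> that starts in a disc independent of
  \<open>n\<close> and of \<open>U\<close>.

  The radius is fixed before \<open>U\<close> and \<gamma> are known, whereas the Harnack constant
  depends on them. It can be absorbed only because \<open>M\<close> grows faster than every power;
  this is why so much effort goes into that growth.

  The ratio \<open>exp 8\<close> comes from logarithmic coordinates: a disc of radius 8 contains the
  rectangle of width 8 and height 2 pi about its centre, so \<open>exp\<close> maps it onto a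
  superset of a full annulus of ratio \<open>exp 8\<close>. Winding numbers appear as exponents
  \<open>N\<close> in f = z^N exp(L) with \<open>L\<close> continuous on the circle.\<close>

text \<open>With real exponents, \<open>u\<close> is the log-modulus of a multivalued product of
  powers of \<open>g\<close> and \<open>h\<close>. Logarithms exist on balls, so the maximum modulus
  principle works locally and makes the set \<open>X\<close> of maximum points open; it is also
  closed, and a bounded nonempty clopen set is impossible in the plane.\<close>

lemma log_modulus_max_principle:
  fixes u :: "complex \<Rightarrow> real" and g h :: "complex \<Rightarrow> complex"
  assumes W: "open W" "bounded W"
    and hol: "g holomorphic_on W" "h holomorphic_on W"
    and nz: "\<And>z. z \<in> W \<Longrightarrow> g z \<noteq> 0" "\<And>z. z \<in> W \<Longrightarrow> h z \<noteq> 0"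
    and cont: "continuous_on (closure W) u"
    and u: "\<And>z. z \<in> W \<Longrightarrow> u z = \<alpha> * ln (norm (g z)) + \<beta> * ln (norm (h z))"
    and fr: "\<And>z. z \<in> frontier W \<Longrightarrow> u z \<le> c"
    and z: "z \<in> W"
  shows "u z \<le> c"
proof (rule ccontr)
  assume neg: "\<not> u z \<le> c"
  have comp: "compact (closure W)"
    using W(2) by (simp add: compact_closure)
  obtain p where p: "p \<in> closure W" "\<And>x. x \<in> closure W \<Longrightarrow> u x \<le> u p"
    using continuous_attains_sup[OF comp _ cont] z closure_subset by blast
  have pc: "u p > c"
    using p(2)[of z] subsetD[OF closure_subset z] neg by simp
  define X where "X = {x \<in> closure W. u x = u p}"
  have XW: "X \<subseteq> W"
    using fr pc W(1) unfolding X_def frontier_def by (force simp: interior_open)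
  have "closed X"
    unfolding X_def using continuous_closed_preimage_constant[OF cont closed_closure] by simp
  moreover have "open X"
  unfolding open_contains_ball
  proof
    fix x assume x: "x \<in> X"
    obtain e where e: "e > 0" "ball x e \<subseteq> W"
      using W(1) XW x open_contains_ball by (metis subsetD)
    obtain lg where lg: "lg holomorphic_on ball x e" "\<And>y. y \<in> ball x e \<Longrightarrow> exp (lg y) = g y"
      using holomorphic_logarithm_exists[of "ball x e" g x] e hol nz holomorphic_on_subset
      by (metis centre_in_ball convex_ball open_ball subset_iff)
    obtain lh where lh: "lh holomorphic_on ball x e" "\<And>y. y \<in> ball x e \<Longrightarrow> exp (lh y) = h y"
      using holomorphic_logarithm_exists[of "ball x e" h x] e hol nz holomorphic_on_subset
      by (metis centre_in_ball convex_ball open_ball subset_iff)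
    define F where "F = (\<lambda>y. exp (of_real \<alpha> * lg y + of_real \<beta> * lh y))"
    have holF: "F holomorphic_on ball x e"
      unfolding F_def by (intro holomorphic_intros lg lh)
    have nF: "norm (F y) = exp (u y)" if "y \<in> ball x e" for y
    proof -
      have "ln (norm (g y)) = Re (lg y)" "ln (norm (h y)) = Re (lh y)"
        using lg(2)[OF that] lh(2)[OF that] by (metis ln_exp norm_exp_eq_Re)+
      then show ?thesis
        using u[of y] that e by (auto simp: F_def norm_exp_eq_Re)
    qed
    have "F constant_on ball x e"
    proof (rule maximum_modulus_principle[OF holF open_ball connected_ball open_ball subset_refl])
      show "x \<in> ball x e" using e by simp
      fix y assume y: "y \<in> ball x e"
      then have "y \<in> closure W"
        using e(2) closure_subset by (meson subsetD)
      then have "u y \<le> u x"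
        using p(2) x by (simp add: X_def)
      then show "norm (F y) \<le> norm (F x)"
        using nF y e by simp
    qed
    then have "u y = u x" if "y \<in> ball x e" for y
      using nF[OF that] nF[of x] e(1) that unfolding constant_on_def
      by (metis centre_in_ball exp_inj_iff)
    moreover have "ball x e \<subseteq> closure W"
      using e(2) closure_subset by (meson subset_trans)
    ultimately have "ball x e \<subseteq> X"
      using x by (auto simp: X_def subset_iff)
    then show "\<exists>e>0. ball x e \<subseteq> X" using e(1) by blast
  qed
  moreover have "X \<noteq> {}" using p by (auto simp: X_def)
  ultimately have "X = UNIV" using clopen by blast
  then show False
    using XW W(2) bounded_subset not_bounded_UNIV by blast
qed

text \<open>Schwarz's lemma for a logarithm \<open>h\<close> of \<open>g\<close>, which maps into
  the right half-plane, followed by the Moebius map sending \<open>h z\<close> to 0. At half the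
  radius its modulus is at most 1/2, whence the factor (1 + 1/2) / (1 - 1/2) = 3.\<close>

lemma harnack_log_modulus:
  assumes hol: "g holomorphic_on ball z r" and gt: "\<And>w. w \<in> ball z r \<Longrightarrow> norm (g w) > 1"
    and w: "dist z w \<le> r / 2" and r: "r > 0"
  shows "ln (norm (g w)) \<le> 3 * ln (norm (g z))" "ln (norm (g z)) \<le> 3 * ln (norm (g w))"
proof -
  have nz: "g y \<noteq> 0" if "y \<in> ball z r" for y using gt[OF that] by auto
  obtain h where h: "h holomorphic_on ball z r" "\<And>y. y \<in> ball z r \<Longrightarrow> exp (h y) = g y"
    using holomorphic_logarithm_exists[OF convex_ball open_ball hol nz, of z] r by auto
  have Reh: "ln (norm (g y)) = Re (h y)" "Re (h y) > 0" if "y \<in> ball z r" for y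
  proof -
    show "ln (norm (g y)) = Re (h y)" using h(2)[OF that] by (metis ln_exp norm_exp_eq_Re)
    then show "Re (h y) > 0" using gt[OF that] by (metis ln_gt_zero)
  qed
  have zin: "z \<in> ball z r" and win: "w \<in> ball z r" using r w by auto
  have mem: "z + of_real r * c \<in> ball z r" if "norm c < 1" for c
    using that r by (simp add: dist_norm norm_mult)
  define \<phi> where "\<phi> = (\<lambda>c. (h (z + of_real r * c) - h z) / (h (z + of_real r * c) + cnj (h z)))"
  have den: "h (z + of_real r * c) + cnj (h z) \<noteq> 0" if "norm c < 1" for c
    using Reh(2)[OF mem[OF that]] Reh(2)[OF zin] by (auto simp: complex_eq_iff)
  have less: "norm (a - b) < norm (a + cnj b)" if "Re a > 0" "Re b > 0" for a b
  proof -
    have "(norm (a - b))\<^sup>2 < (norm (a + cnj b))\<^sup>2"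
      using mult_pos_pos[OF that] by (simp only: cmod_power2) (simp add: power2_eq_square algebra_simps)
    then show ?thesis by (rule power2_less_imp_less) simp
  qed
  have holh: "(\<lambda>c. h (z + of_real r * c)) holomorphic_on ball 0 1"
    using holomorphic_on_compose_gen[of "\<lambda>c. z + of_real r * c" "ball 0 1" h "ball z r"] h(1) mem
    unfolding o_def by (force intro!: holomorphic_intros)
  have hol\<phi>: "\<phi> holomorphic_on ball 0 1"
    unfolding \<phi>_def using den by (intro holomorphic_intros holh) auto
  define c where "c = (w - z) / of_real r"
  have c: "norm c \<le> 1/2" "z + of_real r * c = w"
    using w r by (auto simp: c_def norm_divide dist_norm norm_minus_commute field_simps)
  have "norm (\<phi> c) \<le> norm c"
  proof (rule Schwarz_Lemma(1)[OF hol\<phi>])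
    show "\<phi> 0 = 0" by (simp add: \<phi>_def)
    show "norm c < 1" using c by linarith
    fix x :: complex assume x: "norm x < 1"
    show "norm (\<phi> x) < 1"
      using less[OF Reh(2)[OF mem[OF x]] Reh(2)[OF zin]] den[OF x] by (simp add: \<phi>_def norm_divide divide_simps)
  qed
  then have "norm (\<phi> c) \<le> 1/2"
    using c(1) by linarith
  then have "norm (h w - h z) / norm (h w + cnj (h z)) \<le> 1/2"
    by (simp only: \<phi>_def c(2) norm_divide)
  moreover have "norm (h w + cnj (h z)) > 0"
    using den[of c] c by auto
  ultimately have "2 * norm (h w - h z) \<le> norm (h w + cnj (h z))"
    by (simp add: field_simps)
  then have "(2 * norm (h w - h z))\<^sup>2 \<le> (norm (h w + cnj (h z)))\<^sup>2"
    by (intro power_mono) auto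
  \<comment> \<open>Conjugating \<open>h z\<close> makes the imaginary part on the right the same
    difference as on the left; one of its four copies cancels.\<close>
  then have "(2 * (Re (h w) - Re (h z)))\<^sup>2 + 3 * (Im (h w) - Im (h z))\<^sup>2 \<le> (Re (h w) + Re (h z))\<^sup>2"
    by (simp add: cmod_power2 power_mult_distrib) (simp add: power2_eq_square algebra_simps)
  then have "(2 * (Re (h w) - Re (h z)))\<^sup>2 \<le> (Re (h w) + Re (h z))\<^sup>2"
    by (smt (verit) zero_le_power2)
  then have "\<bar>2 * (Re (h w) - Re (h z))\<bar> \<le> \<bar>Re (h w) + Re (h z)\<bar>"
    by (simp only: abs_le_square_iff)
  moreover have "\<bar>Re (h w) + Re (h z)\<bar> = Re (h w) + Re (h z)"
    using Reh(2)[OF zin] Reh(2)[OF win] by simp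
  ultimately have "\<bar>2 * (Re (h w) - Re (h z))\<bar> \<le> Re (h w) + Re (h z)"
    by simp
  then have *: "Re (h w) \<le> 3 * Re (h z) \<and> Re (h z) \<le> 3 * Re (h w)"
    by (auto simp: abs_le_iff)
  show "ln (norm (g w)) \<le> 3 * ln (norm (g z))" "ln (norm (g z)) \<le> 3 * ln (norm (g w))"
    using * by (simp_all only: Reh(1)[OF zin] Reh(1)[OF win])
qed

section \<open>Lower bounds for products of distances\<close>

lemma prod_max_dist_nat:
  assumes "1 \<le> m" "m \<le> n"
  shows "(\<Prod>j\<in>{1..n}. max 1 \<bar>real m - real j\<bar>) = fact (m - 1) * fact (n - m)"
  using assms(2)
proof (induction n rule: dec_induct)
  case base
  have "(\<Prod>j\<in>{1..m}. max 1 \<bar>real m - real j\<bar>) = (\<Prod>i\<in>{0..<m}. max 1 (real i))"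
    by (rule prod.reindex_bij_witness[of _ "\<lambda>i. m - i" "\<lambda>j. m - j"]) (use assms in \<open>auto simp: of_nat_diff\<close>)
  also have "\<dots> = (\<Prod>i\<in>{1..m-1}. real i)"
  proof -
    have "{0..<m} = insert 0 {1..m-1}" using assms by auto
    then have "(\<Prod>i\<in>{0..<m}. max 1 (real i)) = (\<Prod>i\<in>{1..m-1}. max 1 (real i))" by simp
    also have "\<dots> = (\<Prod>i\<in>{1..m-1}. real i)" by (rule prod.cong) auto
    finally show ?thesis .
  qed
  also have "\<dots> = fact (m - 1)" by (simp add: fact_prod)
  finally show ?case by simp
next
  case (step n)
  have "{1..Suc n} = insert (Suc n) {1..n}" by auto
  moreover have "max 1 \<bar>real m - real (Suc n)\<bar> = real (Suc n - m)" using step by auto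
  moreover have "Suc n - m = Suc (n - m)" using step by auto
  ultimately show ?case using step by (simp add: algebra_simps)
qed

text \<open>A binomial coefficient is at most \<open>2 ^ (n - 1)\<close>, so even the worst position
  \<open>m\<close> loses only an exponential factor against (n-1)!; a single term of the exponential
  series gives n! >= (n/e)^n. The 4 absorbs \<open>n 2 ^ (n - 1)\<close>.\<close>

lemma prod_max_dist_lower:
  assumes "1 \<le> m" "m \<le> n"
  shows "(\<Prod>j\<in>{1..n}. max 1 \<bar>real m - real j\<bar>) \<ge> (real n / (4 * exp 1)) ^ n"
proof -
  have n: "n \<ge> 1" using assms by simp
  have e: "exp (real n) \<ge> real n ^ n / fact n"
  proof -
    have "(\<Sum>i\<in>{n}. real n ^ i / fact i) \<le> (\<Sum>i. real n ^ i / fact i)"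
      using summable_exp[of "real n"]
      by (intro sum_le_suminf) (auto simp: divide_inverse mult.commute)
    also have "\<dots> = exp (real n)" by (simp add: exp_def divide_inverse mult.commute)
    finally show ?thesis by simp
  qed
  have "real ((n - 1) choose (m - 1)) \<le> 2 ^ (n - 1)"
    using binomial_le_pow2[of "n-1" "m-1"] by (metis of_nat_le_iff of_nat_numeral of_nat_power)
  moreover have "fact (m - 1) * fact (n - 1 - (m - 1)) * real ((n - 1) choose (m - 1)) = (fact (n - 1) :: real)"
    using binomial_fact_lemma[of "m-1" "n-1"] assms
    by (metis diff_le_mono of_nat_fact of_nat_mult)
  moreover have "n - 1 - (m - 1) = n - m" using assms by simp
  ultimately have f: "(fact (n - 1) :: real) \<le> fact (m - 1) * fact (n - m) * 2 ^ (n - 1)"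
    by (metis fact_ge_zero mult_left_mono mult_nonneg_nonneg)
  have nn: "real n * 2 ^ (n - 1) \<le> 4 ^ n"
  proof -
    have "real n \<le> 2 ^ n" by (metis less_exp of_nat_less_iff of_nat_numeral of_nat_power order_less_imp_le)
    then have "real n * 2 ^ (n - 1) \<le> 2 ^ n * 2 ^ n" by (intro mult_mono power_increasing) auto
    also have "\<dots> = (4::real) ^ n" by (simp add: power_mult_distrib[symmetric])
    finally show ?thesis .
  qed
  have "(real n / (4 * exp 1)) ^ n = (real n ^ n / exp (real n)) / 4 ^ n"
    by (simp add: power_divide power_mult_distrib exp_of_nat_mult[symmetric])
  also have "\<dots> \<le> fact n / 4 ^ n"
    using e by (intro divide_right_mono) (simp_all add: field_simps)
  also have "\<dots> \<le> fact n / (real n * 2 ^ (n - 1))"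
    using nn n by (intro divide_left_mono) auto
  also have "\<dots> = fact (n - 1) / 2 ^ (n - 1)"
    using n fact_reduce[of n, where 'a=real] by (simp add: field_simps)
  also have "\<dots> \<le> fact (m - 1) * fact (n - m)"
    using f by (simp add: field_simps)
  finally show ?thesis using prod_max_dist_nat[OF assms] by simp
qed

text \<open>Only radii are compared: in units of r/n the point \<open>z\<close> sits at
  \<open>x\<close> and the j-th circle at j. Replacing \<open>x\<close> by the nearest admissible
  integer \<open>m\<close> costs a factor 2; for j next to \<open>m\<close>, where the radii say
  nothing, \<open>far\<close> takes over. The constant is r/(2n) times n/(4e).\<close>

lemma prod_dist_lower:
  fixes a z :: complex and b :: "nat \<Rightarrow> complex"
  assumes n: "n \<ge> 1" and r: "r > 0"
    and b: "\<And>j. j \<in> {1..n} \<Longrightarrow> norm (b j - a) = r + real j * r / real n"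
    and far: "\<And>j. j \<in> {1..n} \<Longrightarrow> norm (z - b j) \<ge> r / (2 * real n)"
  shows "(\<Prod>j\<in>{1..n}. norm (z - b j)) \<ge> (r / (8 * exp 1)) ^ n"
proof -
  define x where "x = real n * (norm (z - a) - r) / r"
  define k where "k = round x"
  define m where "m = nat (max 1 (min (int n) k))"
  have m: "1 \<le> m" "m \<le> n" using n by (auto simp: m_def)
  have key: "norm (z - b j) \<ge> r / (2 * real n) * max 1 \<bar>real m - real j\<bar>" if j: "j \<in> {1..n}" for j
  proof (cases "\<bar>real m - real j\<bar> \<le> 1")
    case True then show ?thesis using far[OF j] by (simp add: max_def)
  next
    case False
    have "\<bar>int m - int j\<bar> \<le> \<bar>k - int j\<bar>" using j n by (auto simp: m_def)
    then have 1: "\<bar>real m - real j\<bar> \<le> \<bar>real_of_int k - real j\<bar>" by linarith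
    have 2: "\<bar>real_of_int k - x\<bar> \<le> 1/2" unfolding k_def by (rule of_int_round_abs_le)
    have "\<bar>int m - int j\<bar> > 1" using False by linarith
    then have "\<bar>real m - real j\<bar> \<ge> 2" by linarith
    moreover have "\<bar>real_of_int k - real j\<bar> \<le> \<bar>real_of_int k - x\<bar> + \<bar>x - real j\<bar>" by linarith
    moreover have "A / 2 \<le> D" if "2 \<le> A" "B \<le> C + D" "A \<le> B" "C \<le> 1/2" for A B C D :: real
      using that by linarith
    ultimately have 3: "\<bar>x - real j\<bar> \<ge> \<bar>real m - real j\<bar> / 2" using 1 2 by blast
    have "norm (z - b j) \<ge> \<bar>norm (z - a) - norm (b j - a)\<bar>"
      using norm_triangle_ineq3[of "z - a" "b j - a"] by simp
    also have "norm (z - a) - norm (b j - a) = (r / real n) * (x - real j)"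
      using n r b[OF j] by (simp add: x_def field_simps)
    finally have "norm (z - b j) \<ge> (r / real n) * \<bar>x - real j\<bar>"
      using n r by (simp add: abs_mult)
    moreover have "(r / real n) * \<bar>x - real j\<bar> \<ge> (r / real n) * (\<bar>real m - real j\<bar> / 2)"
      using 3 n r by (intro mult_left_mono) auto
    ultimately show ?thesis using False by (simp add: max_def)
  qed
  have "(r / (8 * exp 1)) ^ n = (r / (2 * real n)) ^ n * (real n / (4 * exp 1)) ^ n"
  proof -
    have "r / (8 * exp 1) = r / (2 * real n) * (real n / (4 * exp 1))" using n by simp
    then show ?thesis by (simp only: power_mult_distrib[symmetric])
  qed
  also have "\<dots> \<le> (r / (2 * real n)) ^ n * (\<Prod>j\<in>{1..n}. max 1 \<bar>real m - real j\<bar>)"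
    using prod_max_dist_lower[OF m] r by (intro mult_left_mono) auto
  also have "\<dots> = (\<Prod>j\<in>{1..n}. r / (2 * real n) * max 1 \<bar>real m - real j\<bar>)"
    unfolding prod.distrib by simp
  also have "\<dots> \<le> (\<Prod>j\<in>{1..n}. norm (z - b j))"
    using key r by (intro prod_mono) auto
  finally show ?thesis .
qed

section \<open>Winding numbers via continuous logarithms on circles\<close>

lemma one_minus_divide_notin_nonpos_Reals:
  fixes w z :: complex
  assumes "norm w < norm z"
  shows "1 - w / z \<notin> \<real>\<^sub>\<le>\<^sub>0"
proof -
  have "norm (w / z) < 1" using assms by (cases "z = 0") (auto simp: norm_divide)
  then have "Re (1 - w / z) > 0" using complex_Re_le_cmod[of "w / z"] by simp
  then show ?thesis by (metis complex_nonpos_Reals_iff not_less)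
qed

text \<open>A form of the argument principle: \<open>N\<close> is the winding number. A zero \<zeta>
  contributes (z - \<zeta>)^n = z^n (1 - \<zeta>/z)^n, and 1 - \<zeta>/z has a principal logarithm
  on the circle; once all zeros are removed, the disc carries a logarithm. Holomorphy is asked near
  the zeros only, so that functions altered by a cutoff elsewhere qualify.\<close>

lemma circle_log_factor:
  fixes t :: real
  assumes "finite Z" "t > 0" "Z \<subseteq> ball 0 t" "continuous_on (cball 0 t) F"
    and "\<And>z. z \<in> cball 0 t \<Longrightarrow> F z = 0 \<longleftrightarrow> z \<in> Z"
    and "\<And>\<zeta>. \<zeta> \<in> Z \<Longrightarrow> \<exists>r>0. F holomorphic_on ball \<zeta> r"
  shows "\<exists>N L. N \<ge> card Z \<and> continuous_on (sphere 0 t) L \<and>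
            (\<forall>z\<in>sphere 0 t. F z = z ^ N * exp (L z :: complex))"
  using assms
proof (induction Z arbitrary: F rule: finite_induct)
  case empty
  obtain h where h: "continuous_on (cball 0 t) h" "\<And>z. z \<in> cball 0 t \<Longrightarrow> F z = exp (h z)"
    using continuous_logarithm_on_cball[OF empty(3)] empty(4) by blast
  have "continuous_on (sphere 0 t) h" using h(1) continuous_on_subset sphere_cball by blast
  then show ?case using h(2) by (intro exI[of _ 0] exI[of _ h]) auto
next
  case (insert \<zeta> Z)
  obtain r0 where r0: "r0 > 0" "F holomorphic_on ball \<zeta> r0" using insert.prems(5)[of \<zeta>] by blast
  obtain r1 where r1: "r1 > 0" "ball \<zeta> r1 \<subseteq> ball 0 t"
    using insert.prems(2) openE[of "ball 0 t" \<zeta>] by blast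
  define d where "d = min r0 r1"
  have d: "d > 0" "ball \<zeta> d \<subseteq> cball 0 t" "F holomorphic_on ball \<zeta> d"
    using r0 r1 by (auto simp: d_def subset_iff intro: holomorphic_on_subset)
  have "\<zeta> \<in> cball 0 t" using d(1,2) centre_in_ball by blast
  then have F\<zeta>: "F \<zeta> = 0" using insert.prems(4)[of \<zeta>] by simp
  have "\<not> F constant_on ball \<zeta> d"
  proof
    assume "F constant_on ball \<zeta> d"
    then have "\<And>x. x \<in> ball \<zeta> d \<Longrightarrow> F x = 0"
      using F\<zeta> d(1) by (metis centre_in_ball constant_on_def)
    then have "ball \<zeta> d \<subseteq> insert \<zeta> Z" using d(2) insert.prems(4) by blast
    then have "finite (ball \<zeta> d)" using insert.hyps(1) finite_subset by blast
    then show False using d(1) by (metis ball_eq_empty finite_imp_not_open not_less open_ball)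
  qed
  then obtain g r n where rg: "0 < n" "0 < r" "g holomorphic_on ball \<zeta> r"
     "\<And>w. w \<in> ball \<zeta> r \<Longrightarrow> F w = (w - \<zeta>)^n * g w" "\<And>w. w \<in> ball \<zeta> r \<Longrightarrow> g w \<noteq> 0"
    using holomorphic_factor_zero_nonconstant[OF d(3) open_ball connected_ball _ F\<zeta>] d(1)
    by (metis centre_in_ball)
  define H where "H = (\<lambda>z. if z = \<zeta> then g \<zeta> else F z / (z - \<zeta>) ^ n)"
  have FH: "F z = (z - \<zeta>) ^ n * H z" for z
    using F\<zeta> rg(1) by (auto simp: H_def)
  have Hg: "H w = g w" if "w \<in> ball \<zeta> r" for w
    using rg(4)[OF that] by (auto simp: H_def)
  have contH: "continuous_on (cball 0 t) H"
  proof -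
    let ?U = "cball 0 t \<inter> ball \<zeta> r" and ?V = "cball 0 t \<inter> - {\<zeta>}"
    have "continuous_on ?U g"
      using holomorphic_on_imp_continuous_on[OF rg(3)] by (rule continuous_on_subset) auto
    then have "continuous_on ?U H" by (rule continuous_on_eq) (simp add: Hg)
    moreover have "continuous_on ?V (\<lambda>z. F z / (z - \<zeta>) ^ n)"
      using insert.prems(3) by (intro continuous_intros) (auto intro: continuous_on_subset)
    then have "continuous_on ?V H" by (rule continuous_on_eq) (auto simp: H_def)
    moreover have UV: "?U \<union> ?V = cball 0 t" using rg(2) by auto
    moreover have "openin (top_of_set (?U \<union> ?V)) ?U" "openin (top_of_set (?U \<union> ?V)) ?V"
      unfolding UV by (auto simp: openin_open_Int)
    ultimately show ?thesis using continuous_on_Un_local_open by metis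
  qed
  have zero: "H z = 0 \<longleftrightarrow> z \<in> Z" if "z \<in> cball 0 t" for z
    using insert.prems(4)[OF that] insert.hyps rg(2) rg(5)[of \<zeta>] by (auto simp: H_def)
  have loc: "\<exists>r>0. H holomorphic_on ball \<xi> r" if \<xi>: "\<xi> \<in> Z" for \<xi>
  proof -
    obtain r' where r': "r' > 0" "F holomorphic_on ball \<xi> r'"
      using insert.prems(5)[of \<xi>] \<xi> by blast
    define s where "s = min r' (dist \<xi> \<zeta>)"
    have s: "s > 0" "ball \<xi> s \<subseteq> ball \<xi> r'" "\<zeta> \<notin> ball \<xi> s"
      using r'(1) \<xi> insert.hyps by (auto simp: s_def)
    have "(\<lambda>z. F z / (z - \<zeta>) ^ n) holomorphic_on ball \<xi> s"
      using s r'(2) by (intro holomorphic_intros holomorphic_on_subset[OF r'(2)]) auto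
    then have "H holomorphic_on ball \<xi> s"
      by (rule holomorphic_transform) (use s(3) in \<open>auto simp: H_def\<close>)
    then show ?thesis using s(1) by blast
  qed
  obtain N L where NL: "N \<ge> card Z" "continuous_on (sphere 0 t) L"
    "\<And>z. z \<in> sphere 0 t \<Longrightarrow> H z = z ^ N * exp (L z)"
    using insert.IH[OF insert.prems(1) _ contH zero loc] insert.prems(2) by blast
  define L' where "L' = (\<lambda>z. of_nat n * Ln (1 - \<zeta> / z) + L z)"
  have nonpos: "1 - \<zeta> / z \<notin> \<real>\<^sub>\<le>\<^sub>0" if "z \<in> sphere 0 t" for z
    using that insert.prems(2) by (intro one_minus_divide_notin_nonpos_Reals) auto
  have "continuous_on (sphere 0 t) L'"
    unfolding L'_def using nonpos insert.prems(1) NL(2)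
    by (intro continuous_intros) auto
  moreover have "F z = z ^ (N + n) * exp (L' z)" if z: "z \<in> sphere 0 t" for z
  proof -
    have z0: "z \<noteq> 0" using z insert.prems(1) by auto
    have "exp (L' z) = (1 - \<zeta> / z) ^ n * exp (L z)"
    proof -
      have "1 - \<zeta> / z \<noteq> 0" using nonpos[OF z] by auto
      then show ?thesis by (simp add: L'_def exp_add exp_of_nat_mult)
    qed
    then have "z ^ (N + n) * exp (L' z) = (z * (1 - \<zeta> / z)) ^ n * (z ^ N * exp (L z))"
      by (simp add: power_add power_mult_distrib)
    also have "z * (1 - \<zeta> / z) = z - \<zeta>" using z0 by (simp add: field_simps)
    finally show ?thesis using FH[of z] NL(3)[OF z] by simp
  qed
  moreover have "N + n \<ge> card (insert \<zeta> Z)" using NL(1) rg(1) insert.hyps by simp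
  ultimately show ?case by blast
qed

text \<open>Along the circle, \<open>L\<close> minus the obvious logarithm \<i>kt has constant
  exponential, hence discrete values, hence is constant; but \<open>L\<close> returns to its value
  after a full turn and \<i>kt does not.\<close>

lemma no_continuous_log_power:
  fixes L :: "complex \<Rightarrow> complex"
  assumes "r > 0" "k > 0" "continuous_on (sphere 0 r) L"
    and eq: "\<And>z. z \<in> sphere 0 r \<Longrightarrow> z ^ k = exp (L z)"
  shows False
proof -
  define \<phi> where "\<phi> = (\<lambda>t::real. L (of_real r * exp (\<i> * of_real t)) - \<i> * of_real (real k * t))"
  have mem: "of_real r * exp (\<i> * of_real t) \<in> sphere 0 r" for t
    using assms(1) by (simp add: norm_mult)
  have cont: "continuous_on UNIV \<phi>"
    unfolding \<phi>_def using mem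
    by (intro continuous_intros continuous_on_compose2[OF assms(3)]) auto
  have exp\<phi>: "exp (\<phi> t) = of_real r ^ k" for t
  proof -
    have "exp (\<phi> t) = (of_real r * exp (\<i> * of_real t)) ^ k / exp (of_nat k * (\<i> * of_real t))"
      unfolding \<phi>_def exp_diff eq[OF mem, symmetric] by (simp add: algebra_simps)
    then show ?thesis by (simp add: exp_of_nat_mult power_mult_distrib)
  qed
  have "\<phi> constant_on UNIV"
  proof (rule continuous_discrete_range_constant[OF connected_UNIV cont])
    fix x :: real
    have "2 * pi \<le> norm (\<phi> y - \<phi> x)" if "\<phi> y \<noteq> \<phi> x" for y
    proof -
      have "exp (\<phi> y) = exp (\<phi> x)" using exp\<phi> by simp
      then obtain j :: int where j: "\<phi> y = \<phi> x + (of_int (2 * j) * pi) * \<i>" using exp_eq by auto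
      have "j \<noteq> 0" using that j by auto
      then have "1 \<le> \<bar>real_of_int j\<bar>" by linarith
      then show ?thesis using j by (simp add: norm_mult)
    qed
    then show "\<exists>e>0. \<forall>y. y \<in> UNIV \<and> \<phi> y \<noteq> \<phi> x \<longrightarrow> e \<le> norm (\<phi> y - \<phi> x)"
      by (intro exI[of _ "2 * pi"]) auto
  qed
  then have "\<phi> (2 * pi) = \<phi> 0" by (auto simp: constant_on_def)
  moreover have "exp (\<i> * of_real (2 * pi)) = 1" using exp_two_pi_i by (simp add: mult.commute)
  ultimately show False using assms(2) by (simp add: \<phi>_def)
qed

text \<open>The hypotheses allow \<open>g\<close>, multiplied by a cutoff function of \<open>u\<close>, to be extended continuously by
  \<open>0\<close> to the whole disc without creating new solutions of \<open>g = w\<close>.\<close>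

lemma circle_power_exp:
  fixes g :: "complex \<Rightarrow> complex" and u :: "complex \<Rightarrow> real"
  assumes d: "d > 0" and R: "R > 0" and contu: "continuous_on (cball 0 d) u"
    and O: "\<And>z. norm z \<le> d \<Longrightarrow> u z > 0 \<Longrightarrow> z \<in> O'" and hol: "g holomorphic_on O'"
    and ng: "\<And>z. norm z \<le> d \<Longrightarrow> u z > 0 \<Longrightarrow> norm (g z) = R * exp (u z)"
    and \<sigma>: "\<And>z. norm z = d \<Longrightarrow> u z > \<sigma>"
    and w: "R < norm w" "norm w < R * exp \<sigma>"
    and fin: "finite {z. norm z \<le> d \<and> u z > 0 \<and> g z = w}"
  shows "\<exists>N L. N \<ge> card {z. norm z \<le> d \<and> u z > 0 \<and> g z = w} \<and> continuous_on (sphere 0 d) L \<and>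
            (\<forall>z\<in>sphere 0 d. g z = z ^ N * exp (L z))"
proof -
  define s where "s = ln (norm w / R)"
  have wR: "norm w / R > 1" using w R by simp
  have "exp s = norm w / R" unfolding s_def by (rule exp_ln) (use wR in linarith)
  then have s: "s > 0" "norm w = R * exp s"
    using ln_gt_zero[OF wR] R by (auto simp: s_def)
  have s\<sigma>: "s < \<sigma>" using w s R by simp
  \<comment> \<open>The cutoff vanishes for u <= s/4 and equals 1 for u >= s/2; solutions of g = w
    lie on u = s, where nothing has changed.\<close>
  define \<theta> where "\<theta> = (\<lambda>z. max 0 (min 1 (4 * u z / s - 1)))"
  define E where "E = (\<lambda>z. if s / 4 \<le> u z then of_real (\<theta> z) * g z else 0)"
  let ?S = "cball (0::complex) d \<inter> u -` {s/4..}" and ?T = "cball (0::complex) d \<inter> u -` {..s/4}"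
  have cont: "continuous_on (cball 0 d) E"
  proof -
    have clS: "closed ?S" "closed ?T" using contu by (auto intro!: continuous_closed_preimage)
    have "continuous_on ?S g"
      using O s by (intro continuous_on_subset[OF holomorphic_on_imp_continuous_on[OF hol]]) auto
    then have "continuous_on ?S (\<lambda>z. of_real (\<theta> z) * g z)"
      unfolding \<theta>_def using contu s
      by (intro continuous_intros) (auto intro: continuous_on_subset)
    then have "continuous_on ?S E" by (rule continuous_on_eq) (auto simp: E_def)
    moreover have "continuous_on ?T E"
      by (rule continuous_on_eq[of _ "\<lambda>_. 0"]) (use s in \<open>auto simp: E_def \<theta>_def\<close>)
    ultimately have "continuous_on (?S \<union> ?T) E" using clS by (intro continuous_on_closed_Un)
    moreover have "?S \<union> ?T = cball 0 d" by auto
    ultimately show ?thesis by simp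
  qed
  have eq: "E z = g z" if "u z \<ge> s / 2" for z
    using that s by (auto simp: E_def \<theta>_def field_simps)
  \<comment> \<open>Since \<theta> <= 1, a solution of \<open>E z = w\<close> has |g z| >= |w|, so u
    z >= s, where the cutoff is inactive.\<close>
  have zeros: "u z = s \<and> g z = w" if z: "norm z \<le> d" "E z = w" for z
  proof -
    have w0: "norm w > 0" using w R by linarith
    then have uz: "u z \<ge> s / 4" using z(2) by (auto simp: E_def split: if_splits)
    then have u0: "u z > 0" using s by linarith
    have "norm w = \<theta> z * norm (g z)" using z(2) uz by (auto simp: E_def \<theta>_def norm_mult)
    also have "\<dots> \<le> 1 * norm (g z)" by (intro mult_right_mono) (auto simp: \<theta>_def)
    finally have "s \<le> u z" using ng[OF z(1) u0] s R by simp
    then have "g z = w" using eq[of z] z(2) s by simp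
    then have "R * exp (u z) = R * exp s" using ng[OF z(1) u0] s by (simp only:)
    then show ?thesis using R \<open>g z = w\<close> by simp
  qed
  let ?Z = "{z \<in> cball 0 d. E z - w = 0}"
  have Z: "?Z = {z. norm z \<le> d \<and> u z > 0 \<and> g z = w}"
  proof (intro equalityI subsetI)
    fix z assume z: "z \<in> {z. norm z \<le> d \<and> u z > 0 \<and> g z = w}"
    have "R * exp (u z) = norm (g z)" using ng[of z] z by simp
    also have "\<dots> = norm w" using z by simp
    also have "\<dots> = R * exp s" by (rule s(2))
    finally show "z \<in> ?Z" using R z eq[of z] s by simp
  qed (use zeros s in auto)
  have big: "norm w < norm (g z)" if "z \<in> sphere 0 d" for z
  proof -
    have "u z > s" using \<sigma>[of z] that s\<sigma> by simp
    then show ?thesis using ng[of z] that s R by simp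
  qed
  have "\<exists>N L. N \<ge> card ?Z \<and> continuous_on (sphere 0 d) L \<and>
            (\<forall>z\<in>sphere 0 d. E z - w = z ^ N * exp (L z))"
  proof (rule circle_log_factor[OF _ d])
    show "finite ?Z" using Z fin by simp
    show "continuous_on (cball 0 d) (\<lambda>z. E z - w)" by (intro continuous_intros cont)
    show "?Z \<subseteq> ball 0 d"
    proof
      fix z assume z: "z \<in> ?Z"
      then have "u z = s" "norm z \<le> d" using zeros[of z] by auto
      then have "norm z \<noteq> d" using \<sigma>[of z] s\<sigma> by auto
      then show "z \<in> ball 0 d" using \<open>norm z \<le> d\<close> by simp
    qed
    fix y assume y: "y \<in> ?Z"
    then have "y \<in> ball 0 d \<inter> u -` {s/2<..}" using \<open>?Z \<subseteq> ball 0 d\<close> zeros[of y] s by auto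
    moreover have "open (ball 0 d \<inter> u -` {s/2<..})"
      using continuous_on_subset[OF contu ball_subset_cball] by (intro continuous_open_preimage) auto
    ultimately obtain r where r: "r > 0" "ball y r \<subseteq> ball 0 d \<inter> u -` {s/2<..}"
      using open_contains_ball by blast
    have "x \<in> O'" if "x \<in> ball y r" for x
      using O[of x] r(2) that s by force
    then have "(\<lambda>z. g z - w) holomorphic_on ball y r"
      by (intro holomorphic_intros holomorphic_on_subset[OF hol]) blast
    then have "(\<lambda>z. E z - w) holomorphic_on ball y r"
      by (rule holomorphic_transform) (use r(2) eq in force)
    then show "\<exists>r>0. (\<lambda>z. E z - w) holomorphic_on ball y r" using r by blast
  qed auto
  then obtain N L where N: "N \<ge> card ?Z" and L: "continuous_on (sphere 0 d) L"
    "\<And>z. z \<in> sphere 0 d \<Longrightarrow> E z - w = z ^ N * exp (L z)" by blast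
  \<comment> \<open>On the circle |w| < |g|, so g = (g - w) / (1 - w/g), and the denominator has a
    principal logarithm.\<close>
  define L' where "L' = (\<lambda>z. L z - Ln (1 - w / g z))"
  have "continuous_on (sphere 0 d) g"
  proof (rule continuous_on_subset[OF holomorphic_on_imp_continuous_on[OF hol]])
    show "sphere 0 d \<subseteq> O'"
    proof
      fix z :: complex assume "z \<in> sphere 0 d"
      then show "z \<in> O'" using O[of z] \<sigma>[of z] s s\<sigma> by simp
    qed
  qed
  moreover have gnz: "g z \<noteq> 0" if "z \<in> sphere 0 d" for z
    using le_less_trans[OF norm_ge_zero big[OF that]] by simp
  ultimately have "continuous_on (sphere 0 d) L'"
    unfolding L'_def using L(1) big
    by (intro continuous_intros one_minus_divide_notin_nonpos_Reals) blast+
  moreover have "g z = z ^ N * exp (L' z)" if z: "z \<in> sphere 0 d" for z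
  proof -
    have "u z > s" using \<sigma>[of z] z s\<sigma> by simp
    then have "E z = g z" using eq[of z] s by simp
    moreover have nz: "g z \<noteq> 0" "1 - w / g z \<noteq> 0"
      using gnz[OF z] one_minus_divide_notin_nonpos_Reals[OF big[OF z]] nonpos_Reals_zero_I by metis+
    ultimately have "g z * (1 - w / g z) = z ^ N * exp (L z)"
      using L(2)[OF z] by (simp add: right_diff_distrib)
    then show ?thesis using nz(2) by (simp add: L'_def exp_diff nonzero_eq_divide_eq)
  qed
  ultimately show ?thesis using N Z by auto
qed

section \<open>Growth in a direct tract\<close>

locale tract =
  fixes f :: "complex \<Rightarrow> complex" and D :: "complex set" and R :: real
  assumes open_D: "open D" and connected_D: "connected D"
    and unbounded_D: "\<not> bounded D" and unbounded_compl: "\<not> bounded (- D)"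
    and hol_f: "f holomorphic_on D" and cont_f: "continuous_on (closure D) f"
    and R_pos: "R > 0" and norm_frontier: "z \<in> frontier D \<Longrightarrow> norm (f z) = R"
    and norm_gt: "z \<in> D \<Longrightarrow> norm (f z) > R"
begin

definition v :: "complex \<Rightarrow> real" where
  "v z = (if z \<in> D then ln (norm (f z) / R) else 0)"

lemma v_outside [simp]: "z \<notin> D \<Longrightarrow> v z = 0"
  by (simp add: v_def)

lemma v_pos: "z \<in> D \<Longrightarrow> v z > 0"
proof -
  assume z: "z \<in> D"
  then have "norm (f z) / R > 1" using norm_gt[of z] R_pos by simp
  then show ?thesis using z ln_gt_zero by (simp add: v_def)
qed

lemma v_nonneg [simp]: "v z \<ge> 0"
  using v_pos[of z] by (cases "z \<in> D") auto

lemma v_pos_iff: "v z > 0 \<longleftrightarrow> z \<in> D"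
  using v_pos[of z] by (cases "z \<in> D") auto

lemma frontier_not_in: "z \<in> frontier D \<Longrightarrow> z \<notin> D"
  using open_D by (simp add: frontier_def interior_open)

lemma closure_cases: "z \<in> closure D \<Longrightarrow> z \<in> D \<or> z \<in> frontier D"
  using open_D by (auto simp: frontier_def interior_open)

lemma norm_f: "z \<in> closure D \<Longrightarrow> norm (f z) = R * exp (v z)"
proof (cases "z \<in> D")
  case True
  then have "norm (f z) / R > 0" using norm_gt[of z] R_pos by (intro divide_pos_pos) auto
  then show ?thesis using True R_pos by (simp add: v_def)
qed (use closure_cases[of z] norm_frontier[of z] in auto)

lemma f_nz: "z \<in> D \<Longrightarrow> f z \<noteq> 0"
  using norm_gt[of z] R_pos by auto

lemma continuous_v: "continuous_on A v"
proof -
  have 1: "continuous_on (closure D) v"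
  proof -
    have nz: "norm (f z) / R > 0" if "z \<in> closure D" for z
      using norm_f[OF that] R_pos by simp
    have "continuous_on (closure D) (\<lambda>z. ln (norm (f z) / R))"
      using R_pos nz by (intro continuous_intros cont_f) force+
    then show ?thesis
      by (rule continuous_on_eq) (use norm_f R_pos in auto)
  qed
  have 2: "continuous_on (- D) v"
    by (rule continuous_on_eq[of _ "\<lambda>_. 0"]) auto
  have "continuous_on (closure D \<union> - D) v"
    using 1 2 open_D by (intro continuous_on_closed_Un) auto
  moreover have "closure D \<union> - D = UNIV" using closure_subset by auto
  ultimately show ?thesis using continuous_on_subset by (metis subset_UNIV)
qed

lemma open_v_gt: "open {z. v z > c}"
  using continuous_v by (simp add: open_Collect_less)

lemma open_v_less: "open {z. v z < c}"
  using continuous_v by (simp add: open_Collect_less)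

lemma closed_v_le: "closed {z. v z \<le> c}"
  using continuous_v by (simp add: closed_Collect_le)

lemma closed_v_ge: "closed {z. c \<le> v z}"
  using continuous_v by (simp add: closed_Collect_le)

lemma D_nonempty: "D \<noteq> {}"
  using unbounded_D by auto

lemma frontier_nonempty: "frontier D \<noteq> {}"
  using unbounded_D unbounded_compl by (metis Compl_UNIV_eq bounded_empty frontier_not_empty)

lemma f_nonconst: "\<not> f constant_on D"
proof
  assume "f constant_on D"
  then obtain c where c: "\<And>z. z \<in> D \<Longrightarrow> f z = c" by (auto simp: constant_on_def)
  obtain p where p: "p \<in> frontier D" using frontier_nonempty by auto
  then have "f p = c"
    using continuous_constant_on_closure[OF cont_f c] by (simp add: frontier_def)
  then show False
    using c D_nonempty norm_frontier[OF p] norm_gt by force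
qed

lemma open_image: "open V \<Longrightarrow> V \<subseteq> D \<Longrightarrow> open (f ` V)"
  using open_mapping_thm[OF hol_f open_D connected_D _ _ f_nonconst] by blast

text \<open>The entire function \<open>h\<close> carries the comparison potential: a constant, the
  identity or a product of linear factors. With \<alpha> = -1 and h = 1 this is the minimum
  principle for \<open>v\<close>.\<close>

lemma v_max_principle:
  assumes W: "open W" "bounded W" "W \<subseteq> D"
    and h: "h holomorphic_on UNIV" "\<And>z. z \<in> closure W \<Longrightarrow> h z \<noteq> 0"
    and fr: "\<And>z. z \<in> frontier W \<Longrightarrow> \<alpha> * v z + \<beta> * ln (norm (h z)) \<le> c"
    and z: "z \<in> W"
  shows "\<alpha> * v z + \<beta> * ln (norm (h z)) \<le> c"
proof -
  have *: "\<alpha> * v z + \<beta> * ln (norm (h z)) + \<alpha> * ln R \<le> c + \<alpha> * ln R"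
  proof (rule log_modulus_max_principle[where g = f and h = h and \<alpha> = \<alpha> and \<beta> = \<beta>, OF W(1,2) _ _ _ _ _ _ _ z,
      of "\<lambda>z. \<alpha> * v z + \<beta> * ln (norm (h z)) + \<alpha> * ln R"])
    show "f holomorphic_on W" using hol_f W(3) holomorphic_on_subset by blast
    show "h holomorphic_on W" using h(1) holomorphic_on_subset by blast
    show "f x \<noteq> 0" if "x \<in> W" for x using f_nz W(3) that by blast
    show "h x \<noteq> 0" if "x \<in> W" for x using h(2) that closure_subset by blast
    show "continuous_on (closure W) (\<lambda>z. \<alpha> * v z + \<beta> * ln (norm (h z)) + \<alpha> * ln R)"
      using h holomorphic_on_imp_continuous_on[OF holomorphic_on_subset[OF h(1) subset_UNIV]]
      by (intro continuous_intros continuous_v) auto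
    show "\<alpha> * v x + \<beta> * ln (norm (h x)) + \<alpha> * ln R = \<alpha> * ln (norm (f x)) + \<beta> * ln (norm (h x))"
      if "x \<in> W" for x
    proof -
      have "x \<in> D" using W(3) that by blast
      then have "ln (norm (f x)) = v x + ln R"
        using f_nz R_pos by (simp add: v_def ln_div)
      then show ?thesis by (simp only: distrib_left)
    qed
    show "\<alpha> * v x + \<beta> * ln (norm (h x)) + \<alpha> * ln R \<le> c + \<alpha> * ln R" if "x \<in> frontier W" for x
      using fr[OF that] by simp
  qed
  then show ?thesis by simp
qed

definition B :: "real \<Rightarrow> real" where "B r = Sup (v ` cball 0 r)"

text \<open>If the disc misses \<open>D\<close>, then \<open>B r\<close> is 0 and \<open>M r\<close>
  is \<open>R\<close>, so \<open>M\<close> is positive for every radius and no case distinction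
  arises later.\<close>

definition M :: "real \<Rightarrow> real" where "M r = R * exp (B r)"

lemma B_attained:
  assumes "r \<ge> 0"
  obtains z where "norm z \<le> r" "v z = B r" "\<And>y. norm y \<le> r \<Longrightarrow> v y \<le> B r"
proof -
  obtain z where z: "z \<in> cball 0 r" "\<And>y. y \<in> cball 0 r \<Longrightarrow> v y \<le> v z"
    using continuous_attains_sup[of "cball 0 r" v] assms continuous_v by auto
  have "B r = v z" unfolding B_def using z by (intro cSup_eq_maximum) auto
  then show ?thesis using that z by force
qed

lemma v_le_B: "norm z \<le> r \<Longrightarrow> v z \<le> B r"
  using B_attained[of r] norm_ge_zero order_trans by metis

lemma B_mono: "0 \<le> r \<Longrightarrow> r \<le> s \<Longrightarrow> B r \<le> B s"
  using B_attained[of r] v_le_B[of _ s] by (metis order_trans)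

lemma norm_f_le_M: "z \<in> closure D \<Longrightarrow> norm z \<le> r \<Longrightarrow> norm (f z) \<le> M r"
  using norm_f[of z] v_le_B[of z r] R_pos by (simp add: M_def)

lemma exists_B_pos: "\<exists>r>0. B r > 0"
proof -
  obtain z where "z \<in> D" using D_nonempty by blast
  then have "B (norm z + 1) > 0" using v_pos[of z] v_le_B[of z "norm z + 1"] by simp
  then show ?thesis by (metis add_nonneg_pos norm_ge_zero zero_less_one)
qed

text \<open>The image of \<^term>\<open>V \<inter> D\<close> is open, and its frontier misses the annulus: frontier points of
  \<^term>\<open>D\<close> are mapped to the inner circle, frontier points of \<^term>\<open>V\<close> beyond the outer one.\<close>

lemma tract_covers:
  assumes V: "open V" "connected V" "bounded V" and p: "p \<in> V" "p \<notin> D"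
    and fr: "\<And>z. z \<in> frontier V \<Longrightarrow> v z \<ge> s" and s: "s > 0"
    and w: "R < norm w" "norm w < R * exp s"
  shows "\<exists>z\<in>V \<inter> D. f z = w"
proof -
  define A where "A = {w::complex. R < norm (w - 0) \<and> norm (w - 0) < R * exp s}"
  define Y where "Y = f ` (V \<inter> D)"
  have "open Y" unfolding Y_def using V open_D by (intro open_image) auto
  have "connected A" unfolding A_def by (rule connected_annulus) simp
  have comp: "compact (closure (V \<inter> D))" using V(3) by (meson bounded_Int compact_closure)
  have "closure Y \<subseteq> f ` closure (V \<inter> D)"
  proof (rule closure_minimal)
    show "Y \<subseteq> f ` closure (V \<inter> D)" unfolding Y_def using closure_subset by blast
    have "continuous_on (closure (V \<inter> D)) f"
      using cont_f by (rule continuous_on_subset) (simp add: closure_mono)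
    then show "closed (f ` closure (V \<inter> D))"
      using comp compact_continuous_image compact_imp_closed by blast
  qed
  then have "A \<inter> frontier Y = {}"
  proof -
    have False if x: "x \<in> A" "x \<in> frontier Y" for x
    proof -
      have xY: "x \<notin> Y" "x \<in> closure Y"
        using x \<open>open Y\<close> by (auto simp: frontier_def interior_open)
      then obtain z where z: "z \<in> closure (V \<inter> D)" "x = f z"
        using \<open>closure Y \<subseteq> _\<close> by blast
      have zc: "z \<in> closure V" "z \<in> closure D"
        using z(1) closure_mono[of "V \<inter> D"] by blast+
      have zn: "z \<notin> V \<inter> D" using xY z by (auto simp: Y_def)
      show False
      proof (cases "z \<in> V")
        case True
        then have "z \<in> frontier D" using zn zc closure_cases by blast
        then show False using norm_frontier x z by (simp add: A_def)
      next
        case False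
        then have "z \<in> frontier V" using zc V(1) by (simp add: frontier_def interior_open)
        then have "norm (f z) \<ge> R * exp s" using fr norm_f zc R_pos by simp
        then show False using x z by (simp add: A_def)
      qed
    qed
    then show ?thesis by blast
  qed
  moreover have "A \<inter> Y \<noteq> {}"
  proof -
    \<comment> \<open>The frontier of \<open>V\<close> lies in \<open>D\<close> and \<open>p\<close>
      does not, so \<open>V\<close> contains a frontier point of \<open>D\<close>. There
      \<open>v\<close> is 0, and a nearby point of \<open>D\<close> is mapped into the
      annulus.\<close>
    have "frontier V \<noteq> {}" using V p by (metis empty_iff frontier_not_empty not_bounded_UNIV)
    then obtain q where q: "q \<in> frontier V" by blast
    then have "q \<in> D" using fr[OF q] s v_pos_iff by (metis order_less_le_trans)
    moreover have "q \<in> closure V" using q by (simp add: frontier_def)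
    ultimately have "V \<inter> D \<noteq> {}" using open_D by (metis Int_commute disjoint_iff open_Int_closure_eq_empty)
    then have "V \<inter> frontier D \<noteq> {}"
      using p V(2) by (intro connected_Int_frontier) auto
    then obtain p0 where p0: "p0 \<in> V" "p0 \<in> frontier D" by blast
    have "p0 \<in> (V \<inter> {z. v z < s}) \<inter> closure D"
      using p0 frontier_not_in s by (auto simp: frontier_def)
    then have "(V \<inter> {z. v z < s}) \<inter> D \<noteq> {}"
      using V(1) open_v_less by (metis empty_iff open_Int open_Int_closure_eq_empty)
    then obtain z1 where z1: "z1 \<in> V" "z1 \<in> D" "v z1 < s" by blast
    then have "f z1 \<in> A"
      using norm_f[of z1] norm_gt[of z1] closure_subset R_pos by (force simp: A_def)
    then show ?thesis using z1 by (auto simp: Y_def)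
  qed
  ultimately have "A - Y = {}"
    using connected_Int_frontier[OF \<open>connected A\<close>] by blast
  then show ?thesis using w by (auto simp: A_def Y_def)
qed

section \<open>Decay of \<open>v\<close> near circles that meet a sublevel set\<close>

text \<open>The averaged potential of \<open>circles_decay\<close> is at least ln(\<rho>/(8e)) off
  the small discs, at least ln(6\<rho>) on the outer circle and at most ln(3\<rho>) on the inner
  disc. The numbers 48e and 2 are ratios of these radii, and \<open>1 - q\<close> is the share of
  \<open>S\<close> that is lost.\<close>

definition q :: real where "q = 1 - ln 2 / ln (48 * exp 1)"

lemma q_bounds: "0 < q" "q < 1"
proof -
  have "ln 2 < ln (48 * exp (1::real))"
    using exp_ge_add_one_self[of "1::real"] by (intro ln_less_cancel_iff[THEN iffD2]) (auto simp del: exp_ge_add_one_self)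
  moreover have "ln (2::real) > 0" by simp
  ultimately show "0 < q" "q < 1" unfolding q_def by (auto simp: field_simps)
qed

text \<open>A substitute for Beurling's projection theorem: if \<^term>\<open>{z. v z \<le> \<tau>}\<close> meets every circle
  \<open>|z - a| = s\<close>, \<open>\<rho> \<le> s \<le> 2\<rho>\<close>, pick points \<open>b\<^sub>1, \<dots>, b\<^sub>n\<close> in it on equally
  spaced circles and compare with the potential \<open>1/n \<Sum> ln |z - b\<^sub>j|\<close>, which is bounded below
  off tiny discs around the \<open>b\<^sub>j\<close>.\<close>

lemma circles_decay:
  assumes \<rho>: "\<rho> > 0" and S: "S \<ge> 0" and \<tau>: "\<tau> \<ge> 0"
    and circ: "\<And>s. \<rho> \<le> s \<Longrightarrow> s \<le> 2 * \<rho> \<Longrightarrow> \<exists>z. norm (z - a) = s \<and> v z \<le> \<tau>"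
    and bd: "\<And>z. norm (z - a) \<le> 8 * \<rho> \<Longrightarrow> v z \<le> \<tau> + S"
    and z: "norm (z - a) \<le> \<rho>"
  shows "v z \<le> \<tau> + q * S"
proof (rule field_le_epsilon)
  fix \<eta> :: real assume \<eta>: "\<eta> > 0"
  \<comment> \<open>The slack \<eta> keeps {v > \<tau> + \<eta>} away from the points b_j by a
    distance \<open>d\<close> that does not depend on their number, so \<open>n\<close> can be taken
    with \<rho>/(2n) < d.\<close>
  have "uniformly_continuous_on (cball a (8 * \<rho>)) v"
    using continuous_v by (simp add: compact_uniformly_continuous)
  then obtain d where d: "d > 0"
    "\<And>x y. x \<in> cball a (8*\<rho>) \<Longrightarrow> y \<in> cball a (8*\<rho>) \<Longrightarrow> dist y x < d \<Longrightarrow> dist (v y) (v x) < \<eta>"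
    using \<eta> unfolding uniformly_continuous_on_def by metis
  obtain n0 :: nat where n0: "\<rho> / d < real n0" using reals_Archimedean2 by blast
  define n where "n = Suc n0"
  have n: "n \<ge> 1" "\<rho> / (2 * real n) < d"
  proof -
    have "\<rho> < d * real n" using n0 d by (simp add: n_def field_simps)
    also have "\<dots> \<le> d * (2 * real n)" using d by simp
    finally show "\<rho> / (2 * real n) < d" using d by (simp add: n_def field_simps)
  qed (simp add: n_def)
  have "\<exists>b. norm (b - a) = \<rho> + real j * \<rho> / real n \<and> v b \<le> \<tau>" if "j \<in> {1..n}" for j
    using that n \<rho> by (intro circ) (auto simp: field_simps)
  then obtain b where b: "\<And>j. j \<in> {1..n} \<Longrightarrow> norm (b j - a) = \<rho> + real j * \<rho> / real n"
    "\<And>j. j \<in> {1..n} \<Longrightarrow> v (b j) \<le> \<tau>" by metis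
  have b2: "norm (b j - a) \<le> 2 * \<rho>" if "j \<in> {1..n}" for j
  proof -
    have "real j * \<rho> / real n \<le> \<rho>" using that n \<rho> by (simp add: divide_le_eq mult.commute)
    then show ?thesis using b(1)[OF that] by simp
  qed
  define W where "W = ball a (8 * \<rho>) \<inter> {z. v z > \<tau> + \<eta>}"
  define P where "P = (\<lambda>z. \<Prod>j\<in>{1..n}. z - b j)"
  have oW: "open W" unfolding W_def using open_v_gt by blast
  have clW: "closure W \<subseteq> cball a (8 * \<rho>) \<inter> {z. \<tau> + \<eta> \<le> v z}"
    by (rule closure_minimal) (use closed_v_ge in \<open>auto simp: W_def\<close>)
  have far: "norm (z - b j) \<ge> \<rho> / (2 * real n)" if "z \<in> closure W" "j \<in> {1..n}" for z j
  proof (rule ccontr)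
    assume "\<not> ?thesis"
    then have "dist z (b j) < d" using n by (simp add: dist_norm)
    moreover have "z \<in> cball a (8*\<rho>)" "b j \<in> cball a (8*\<rho>)"
      using that clW b2[OF that(2)] \<rho> by (auto simp: dist_norm norm_minus_commute)
    ultimately have "dist (v z) (v (b j)) < \<eta>" using d(2) by blast
    moreover have "v z \<ge> \<tau> + \<eta>" using clW that by auto
    ultimately show False using b(2)[OF that(2)] by (simp add: dist_real_def)
  qed
  have Plow: "norm (P z) \<ge> (\<rho> / (8 * exp 1)) ^ n" if "z \<in> closure W" for z
    unfolding P_def prod_norm[symmetric] by (rule prod_dist_lower[OF n(1) \<rho> b(1) far[OF that]])
  have pos: "(\<rho> / (8 * exp 1)) ^ n > 0" using \<rho> by simp
  have P0: "P z \<noteq> 0" if "z \<in> closure W" for z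
    using Plow[OF that] pos by (metis norm_zero not_less)
  define \<kappa> where "\<kappa> = ln (48 * exp (1::real))"
  have \<kappa>: "\<kappa> > 0" "ln (6 * \<rho>) - ln (\<rho> / (8 * exp 1)) = \<kappa>" "1 - ln 2 / \<kappa> = q"
  proof -
    have "48 * exp (1::real) > 1" using exp_ge_add_one_self[of "1::real"] by linarith
    then show "\<kappa> > 0" unfolding \<kappa>_def by (rule ln_gt_zero)
    show "ln (6 * \<rho>) - ln (\<rho> / (8 * exp 1)) = \<kappa>"
    proof -
      have "ln (6 * \<rho>) = ln (48 * exp 1 * (\<rho> / (8 * exp 1)))" by simp
      also have "\<dots> = \<kappa> + ln (\<rho> / (8 * exp 1))"
        unfolding \<kappa>_def using \<rho> by (intro ln_mult_pos) auto
      finally show ?thesis by simp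
    qed
  qed (simp add: \<kappa>_def q_def)
  define \<phi> where "\<phi> = (\<lambda>z. ln (norm (P z)) / real n)"
  have \<phi>low: "\<phi> z \<ge> ln (\<rho> / (8 * exp 1))" if "z \<in> closure W" for z
  proof -
    have "ln (norm (P z)) \<ge> ln ((\<rho> / (8 * exp 1)) ^ n)"
      using Plow[OF that] pos by (meson ln_mono order_less_le_trans)
    also have "ln ((\<rho> / (8 * exp 1)) ^ n) = real n * ln (\<rho> / (8 * exp 1))"
      using \<rho> by (simp add: ln_realpow)
    finally show ?thesis using n by (simp add: \<phi>_def field_simps)
  qed
  have \<phi>out: "\<phi> z \<ge> ln (6 * \<rho>)" if "z \<in> closure W" "norm (z - a) = 8 * \<rho>" for z
  proof -
    have "(6 * \<rho>) ^ n = (\<Prod>j\<in>{1..n}. 6 * \<rho>)" by simp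
    also have "\<dots> \<le> norm (P z)"
      unfolding P_def prod_norm[symmetric]
    proof (intro prod_mono conjI)
      fix j assume "j \<in> {1..n}"
      then show "6 * \<rho> \<le> norm (z - b j)"
        using b2[of j] that(2) norm_triangle_ineq2[of "z - a" "b j - a"] by simp
    qed (use \<rho> in auto)
    finally have "ln ((6 * \<rho>) ^ n) \<le> ln (norm (P z))" using \<rho> by (intro ln_mono zero_less_power mult_pos_pos) simp_all
    moreover have "ln ((6 * \<rho>) ^ n) = real n * ln (6 * \<rho>)" by (rule ln_realpow)
    ultimately have "real n * ln (6 * \<rho>) \<le> ln (norm (P z))" by (simp only:)
    then show ?thesis using n by (simp add: \<phi>_def field_simps)
  qed
  have \<phi>in: "\<phi> z \<le> ln (3 * \<rho>)" if "z \<in> closure W" "norm (z - a) \<le> \<rho>" for z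
  proof -
    have "norm (P z) \<le> (\<Prod>j\<in>{1..n}. 3 * \<rho>)"
      unfolding P_def prod_norm[symmetric]
    proof (intro prod_mono conjI)
      fix j assume "j \<in> {1..n}"
      then show "norm (z - b j) \<le> 3 * \<rho>"
        using b2[of j] that(2) norm_triangle_ineq4[of "z - a" "b j - a"] by simp
    qed auto
    then have "ln (norm (P z)) \<le> ln ((3 * \<rho>) ^ n)" using P0[OF that(1)] by (intro ln_mono) auto
    also have "\<dots> = real n * ln (3 * \<rho>)" by (rule ln_realpow)
    finally show ?thesis using n by (simp add: \<phi>_def field_simps)
  qed
  show "v z \<le> \<tau> + q * S + \<eta>"
  proof (cases "z \<in> W")
    case False
    then have "v z \<le> \<tau> + \<eta>" using z \<rho> by (auto simp: W_def dist_norm norm_minus_commute)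
    then show ?thesis using q_bounds S by (smt (verit) mult_nonneg_nonneg)
  next
    case True
    \<comment> \<open>The aim is v <= \<tau> + \<eta> + S (1 + (\<phi> - ln(6\<rho>)) / \<kappa>):
      the bracket is nonnegative on the closure of \<open>W\<close> and at least 1 on the outer
      circle. \<open>c\<close> collects the constant terms.\<close>
    define c where "c = \<tau> + \<eta> + S * (1 - ln (6 * \<rho>) / \<kappa>)"
    have "1 * v z + (- S / (\<kappa> * real n)) * ln (norm (P z)) \<le> c"
    proof (rule v_max_principle[OF oW _ _ _ P0])
      show "bounded W" by (simp add: W_def bounded_Int)
      show "W \<subseteq> D" using v_pos_iff \<tau> \<eta> by (force simp: W_def)
      show "P holomorphic_on UNIV" unfolding P_def by (intro holomorphic_intros)
      fix x assume x: "x \<in> frontier W"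
      then have xc: "x \<in> closure W" and xn: "x \<notin> W" using oW by (auto simp: frontier_def interior_open)
      have eq: "1 * v x + (- S / (\<kappa> * real n)) * ln (norm (P x)) = v x - S * (\<phi> x / \<kappa>)"
        by (simp add: \<phi>_def)
      have "v x - (\<tau> + \<eta>) \<le> S * (1 + (\<phi> x - ln (6 * \<rho>)) / \<kappa>)"
      proof (cases "norm (x - a) = 8 * \<rho>")
        case True
        have "(\<phi> x - ln (6 * \<rho>)) / \<kappa> \<ge> 0" using \<phi>out[OF xc True] \<kappa> by simp
        then have "S * 1 \<le> S * (1 + (\<phi> x - ln (6 * \<rho>)) / \<kappa>)" using S by (intro mult_left_mono) auto
        moreover have "v x \<le> \<tau> + S" using bd True by simp
        ultimately show ?thesis using \<eta> by simp
      next
        case False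
        have "norm (x - a) \<le> 8 * \<rho>" using xc clW by (auto simp: dist_norm norm_minus_commute)
        with False xn have "v x \<le> \<tau> + \<eta>" by (auto simp: W_def dist_norm norm_minus_commute)
        moreover have "(\<phi> x - ln (6 * \<rho>)) / \<kappa> \<ge> - 1"
          using \<phi>low[OF xc] \<kappa> by (simp add: field_simps)
        then have "0 \<le> S * (1 + (\<phi> x - ln (6 * \<rho>)) / \<kappa>)" using S by simp
        ultimately show ?thesis by linarith
      qed
      then show "1 * v x + (- S / (\<kappa> * real n)) * ln (norm (P x)) \<le> c"
        unfolding eq c_def by (simp add: algebra_simps diff_divide_distrib)
    qed (use True in auto)
    then have "v z \<le> \<tau> + \<eta> + S * (1 + (\<phi> z - ln (6 * \<rho>)) / \<kappa>)"
      unfolding c_def by (simp add: \<phi>_def algebra_simps diff_divide_distrib)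
    moreover have "S * (1 + (\<phi> z - ln (6 * \<rho>)) / \<kappa>) \<le> S * q"
    proof (intro mult_left_mono S)
      have "\<phi> z \<le> ln (3 * \<rho>)" using \<phi>in z True closure_subset by blast
      moreover have "ln (6 * \<rho>) = ln 2 + ln (3 * \<rho>)" using \<rho> ln_mult_pos[of 2 "3 * \<rho>"] by simp
      ultimately have "\<phi> z - ln (6 * \<rho>) \<le> - ln 2" by simp
      then have "(\<phi> z - ln (6 * \<rho>)) / \<kappa> \<le> - ln 2 / \<kappa>" using \<kappa> by (intro divide_right_mono) auto
      then show "1 + (\<phi> z - ln (6 * \<rho>)) / \<kappa> \<le> q" using \<kappa>(3) by simp
    qed
    ultimately show ?thesis by (simp add: mult.commute)
  qed
qed

lemma norm_f_in: "z \<in> D \<Longrightarrow> norm (f z) = R * exp (v z)"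
  using norm_f closure_subset by blast

lemma B_nonneg [simp]: "r \<ge> 0 \<Longrightarrow> B r \<ge> 0"
  using v_le_B[of 0 r] order_trans[OF v_nonneg[of 0]] by simp

section \<open>Growth of the maximum in the tract\<close>

text \<open>As for Hadamard's theorem, subtract \<mu> ln|z| with \<mu> = \<kappa> / ln 8 on the
  annulus r < |z| < 8t. By \<open>less\<close>, the values on the outer circle stay below the value
  at a maximum point \<open>z\<close> of the disc of radius \<open>t\<close>, so the inner circle
  gives the bound. Frontier points of \<open>D\<close> do no harm because \<open>B r\<close> is
  nonnegative.\<close>

lemma three_circles:
  assumes r: "0 < r" "r < t" and \<kappa>: "\<kappa> \<ge> 0" and less: "B (8 * t) < B t + \<kappa>"
  shows "B t \<le> B r + \<kappa> / ln 8 * ln (t / r)"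
proof -
  define \<mu> where "\<mu> = \<kappa> / ln 8"
  have \<mu>: "\<mu> \<ge> 0" "\<mu> * ln 8 = \<kappa>" using \<kappa> by (auto simp: \<mu>_def)
  have lnq: "ln (t / r) = ln t - ln r" "ln (t / r) \<ge> 0" using r by (auto simp: ln_div)
  obtain z where z: "norm z \<le> t" "v z = B t" using B_attained[of t] r by auto
  have triv: "B t \<le> B r + \<mu> * ln (t / r)" if "B t \<le> B r"
    using that \<mu> lnq by (simp add: add_increasing2)
  show ?thesis
  proof (cases "norm z \<le> r \<or> z \<notin> D")
    case True
    then have "B t \<le> B r" using z v_le_B[of z r] r by auto
    then show ?thesis using triv by (simp add: \<mu>_def)
  next
    case False
    define W where "W = D \<inter> {z. r < norm z \<and> norm z < 8 * t}"
    define c where "c = max (B r - \<mu> * ln r) (B (8 * t) - \<mu> * ln (8 * t))"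
    have oW: "open W"
      unfolding W_def by (intro open_Int open_D open_Collect_conj open_Collect_less continuous_intros)
    have clW: "closure W \<subseteq> {z. r \<le> norm z \<and> norm z \<le> 8 * t}"
      by (rule closure_minimal) (auto simp: W_def intro!: closed_Collect_conj closed_Collect_le continuous_intros)
    have "1 * v z + (- \<mu>) * ln (norm (id z)) \<le> c"
    proof (rule v_max_principle[OF oW])
      show "bounded W" by (rule bounded_subset[of "ball 0 (8 * t)"]) (auto simp: W_def)
      show "id holomorphic_on UNIV" by (simp add: id_def)
      show "id x \<noteq> 0" if "x \<in> closure W" for x using clW that r by auto
      show "z \<in> W" using False z r by (auto simp: W_def)
      fix x assume "x \<in> frontier W"
      then have x: "x \<in> closure W" "x \<notin> W" using oW by (auto simp: frontier_def interior_open)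
      have nx: "r \<le> norm x" "norm x \<le> 8 * t" using clW x by auto
      consider "norm x = r" | "norm x = 8 * t" | "x \<notin> D" using x nx by (force simp: W_def)
      then show "1 * v x + (- \<mu>) * ln (norm (id x)) \<le> c"
      proof cases
        case 1 then show ?thesis using v_le_B[of x r] by (simp add: c_def)
      next
        case 2 then show ?thesis using v_le_B[of x "8 * t"] by (simp add: c_def)
      next
        case 3
        have "\<mu> * ln r \<le> \<mu> * ln (norm x)" using nx r \<mu> by (intro mult_left_mono ln_mono) linarith+
        moreover have "B r \<ge> 0" using r by simp
        ultimately show ?thesis using 3 by (simp add: c_def)
      qed
    qed (auto simp: W_def)
    moreover have "\<mu> * ln (norm z) \<le> \<mu> * ln t"
      using z(1) False \<mu>(1) r by (intro mult_left_mono ln_mono) linarith+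
    ultimately have "B t - \<mu> * ln t \<le> c" using z by simp
    moreover have "B (8 * t) - \<mu> * ln (8 * t) < B t - \<mu> * ln t"
    proof -
      have "ln (8 * t) = ln 8 + ln t" using r by (intro ln_mult_pos) auto
      then show ?thesis using less \<mu> by (simp add: distrib_left)
    qed
    ultimately have "B t - \<mu> * ln t \<le> B r - \<mu> * ln r" by (simp add: c_def)
    then show ?thesis unfolding lnq(1) right_diff_distrib by (simp add: \<mu>_def)
  qed
qed

lemma sphere_min:
  assumes "r > 0" "sphere 0 r \<subseteq> D"
  obtains \<sigma> where "\<sigma> > 0" "\<And>z. z \<in> sphere 0 r \<Longrightarrow> v z > \<sigma>"
proof -
  obtain x where x: "x \<in> sphere 0 r" "\<And>z. z \<in> sphere 0 r \<Longrightarrow> v x \<le> v z"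
    using continuous_attains_inf[of "sphere (0::complex) r" v] continuous_v assms(1) by auto
  have vx: "v x > 0" using x(1) assms v_pos by blast
  show ?thesis
  proof (rule that[of "v x / 2"])
    show "v z > v x / 2" if "z \<in> sphere 0 r" for z using x(2)[OF that] vx by simp
  qed (use vx in simp)
qed

text \<open>A further circle in \<open>D\<close> can be taken beyond a point \<open>p\<close>
  outside \<open>D\<close>. The annulus between the old and the new circle contains \<open>p\<close>
  while \<open>v\<close> is bounded below on its boundary, so \<open>tract_covers\<close> yields one
  more solution; shrinking \<open>c\<close> keeps the old ones.\<close>

lemma many_preimages:
  assumes circ: "\<And>r0. \<exists>s\<ge>r0. sphere 0 s \<subseteq> D"
  shows "\<exists>r>0. \<exists>c>0. (\<forall>z\<in>sphere 0 r. v z > c) \<and>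
     (\<forall>w. R < norm w \<and> norm w < R * exp c \<longrightarrow>
        (\<exists>Z. finite Z \<and> card Z = m \<and> Z \<subseteq> D \<inter> ball 0 r \<and> (\<forall>z\<in>Z. f z = w)))"
proof (induction m)
  case 0
  obtain s where s: "s \<ge> 1" "sphere 0 s \<subseteq> D" using circ by blast
  then obtain c where "c > 0" "\<And>z. z \<in> sphere 0 s \<Longrightarrow> v z > c" using sphere_min[of s] by auto
  then show ?case using s by (intro exI[of _ s] conjI exI[of _ c]) (auto intro!: exI[of _ "{}"])
next
  case (Suc m)
  obtain r c where r: "r > 0" and c: "c > 0" "\<And>z. z \<in> sphere 0 r \<Longrightarrow> v z > c"
    and pre: "\<And>w. R < norm w \<Longrightarrow> norm w < R * exp c \<Longrightarrow>
        \<exists>Z. finite Z \<and> card Z = m \<and> Z \<subseteq> D \<inter> ball 0 r \<and> (\<forall>z\<in>Z. f z = w)"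
    using Suc.IH by blast
  obtain p where p: "p \<notin> D" "norm p > r"
    using unbounded_compl unfolding bounded_iff by (metis ComplD not_le)
  obtain s where s: "s \<ge> norm p + 1" "sphere 0 s \<subseteq> D" using circ by blast
  then have s0: "s > r" "s > 0" using p r by auto
  obtain c1 where c1: "c1 > 0" "\<And>z. z \<in> sphere 0 s \<Longrightarrow> v z > c1" using sphere_min[OF s0(2) s(2)] by blast
  define c2 where "c2 = min c c1"
  have "\<exists>Z. finite Z \<and> card Z = Suc m \<and> Z \<subseteq> D \<inter> ball 0 s \<and> (\<forall>z\<in>Z. f z = w)"
    if w: "R < norm w" "norm w < R * exp c2" for w
  proof -
    have "exp c2 \<le> exp c" by (simp add: c2_def)
    then have "norm w < R * exp c" using w R_pos by (smt (verit) mult_left_mono)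
    then obtain Z where Z: "finite Z" "card Z = m" "Z \<subseteq> D \<inter> ball 0 r" "\<forall>z\<in>Z. f z = w"
      using pre w(1) by blast
    define V where "V = {z::complex. r < norm (z - 0) \<and> norm (z - 0) < s}"
    have oV: "open V" unfolding V_def by (intro open_Collect_conj open_Collect_less continuous_intros)
    have "\<exists>z\<in>V \<inter> D. f z = w"
    proof (rule tract_covers[OF oV, of p c2])
      show "connected V" unfolding V_def by (rule connected_annulus) simp
      show "bounded V" by (rule bounded_subset[of "ball 0 s"]) (auto simp: V_def)
      show "p \<in> V" using p s by (simp add: V_def)
      fix z assume "z \<in> frontier V"
      then have z: "z \<in> closure V" "z \<notin> V" using oV by (auto simp: frontier_def interior_open)
      have "closure V \<subseteq> {z. r \<le> norm z \<and> norm z \<le> s}"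
        by (rule closure_minimal) (auto simp: V_def intro!: closed_Collect_conj closed_Collect_le continuous_intros)
      then have "norm z = r \<or> norm z = s" using z by (force simp: V_def)
      then show "v z \<ge> c2" using c(2)[of z] c1(2)[of z] by (auto simp: c2_def)
    qed (use p w c c1 in \<open>auto simp: c2_def\<close>)
    then obtain z where z: "z \<in> V" "z \<in> D" "f z = w" by blast
    have "z \<notin> Z" using z Z(3) by (force simp: V_def)
    then show ?thesis
      using Z z s0 by (intro exI[of _ "insert z Z"]) (auto simp: V_def)
  qed
  moreover have "v z > c2" if "z \<in> sphere 0 s" for z using c1(2)[OF that] by (simp add: c2_def)
  moreover have "c2 > 0" using c c1 by (simp add: c2_def)
  ultimately show ?case using s0 by blast
qed

text \<open>Turns the count of \<open>many_preimages\<close> into the winding number needed by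
  \<open>winding_growth\<close>. The solutions are finite in number because they satisfy v z =
  ln(|w|/R) > s and so lie in a compact subset of \<open>D\<close>.\<close>

lemma tract_circle_power_exp:
  assumes r: "r > 0" and c: "\<And>z. z \<in> sphere 0 r \<Longrightarrow> v z > c"
    and w: "R < norm w" "norm w < R * exp c"
    and Z: "Z \<subseteq> D \<inter> ball 0 r" "\<And>z. z \<in> Z \<Longrightarrow> f z = w"
  shows "\<exists>N L. N \<ge> card Z \<and> continuous_on (sphere 0 r) L \<and>
            (\<forall>z\<in>sphere 0 r. f z = z ^ N * exp (L z))"
proof -
  let ?Z = "{z. norm z \<le> r \<and> v z > 0 \<and> f z = w}"
  obtain s where s: "s > 0" "norm w > R * exp s"
  proof (rule that[of "ln (norm w / R) / 2"])
    have 1: "norm w / R > 1" using w R_pos by simp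
    then show "ln (norm w / R) / 2 > 0" using ln_gt_zero by simp
    then have "exp (ln (norm w / R) / 2) < exp (ln (norm w / R))" by simp
    also have "\<dots> = norm w / R" by (rule exp_ln) (use 1 in linarith)
    finally show "norm w > R * exp (ln (norm w / R) / 2)" using R_pos by (simp add: field_simps)
  qed
  have "finite {z \<in> cball 0 r \<inter> {z. s \<le> v z}. f z - w = 0}"
  proof (rule holomorphic_compact_finite_zeros[where f = "\<lambda>z. f z - w", OF _ open_D connected_D])
    show "(\<lambda>z. f z - w) holomorphic_on D" by (intro holomorphic_intros hol_f)
    show "compact (cball 0 r \<inter> {z. s \<le> v z})" using closed_v_ge by (intro compact_Int_closed) auto
    show "cball 0 r \<inter> {z. s \<le> v z} \<subseteq> D" using s(1) v_pos_iff by force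
    show "\<not> (\<lambda>z. f z - w) constant_on D"
      using f_nonconst unfolding constant_on_def by (metis diff_add_cancel)
  qed
  moreover have "?Z \<subseteq> {z \<in> cball 0 r \<inter> {z. s \<le> v z}. f z - w = 0}"
  proof
    fix z assume z: "z \<in> ?Z"
    then have "norm w = R * exp (v z)" using norm_f_in v_pos_iff by blast
    then have "s < v z" using s(2) R_pos by simp
    then show "z \<in> {z \<in> cball 0 r \<inter> {z. s \<le> v z}. f z - w = 0}" using z by simp
  qed
  ultimately have fin: "finite ?Z" by (rule rev_finite_subset)
  have "\<exists>N L. N \<ge> card ?Z \<and> continuous_on (sphere 0 r) L \<and> (\<forall>z\<in>sphere 0 r. f z = z ^ N * exp (L z))"
    by (rule circle_power_exp[OF r R_pos continuous_v _ hol_f _ _ w fin])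
       (use v_pos_iff norm_f_in c in auto)
  moreover have "Z \<subseteq> ?Z" using Z v_pos_iff by force
  then have "card Z \<le> card ?Z" by (rule card_mono[OF fin])
  ultimately show ?thesis by (meson order_trans)
qed

text \<open>If \<^term>\<open>v\<close> stayed below \<open>k ln(|z|/d)\<close> on the circle of radius \<open>r\<close>, then \<open>circle_power_exp\<close>
  would apply to \<open>f(z)/z\<^sup>k\<close> on the outside of the circle of radius \<open>d\<close>, infinity included, and
  force its winding number along that circle to be nonpositive; but it is \<open>1\<close>.\<close>

lemma winding_growth:
  assumes d: "d > 0" and s: "s > 0" "\<And>z. z \<in> sphere 0 d \<Longrightarrow> v z > s"
    and L: "continuous_on (sphere 0 d) L"
      "\<And>z. z \<in> sphere 0 d \<Longrightarrow> f z = z ^ Suc k * exp (L z)"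
    and r: "r > d"
  shows "\<exists>z. norm z = r \<and> v z > real k * ln (r / d)"
proof (rule ccontr)
  assume "\<not> ?thesis"
  then have neg: "v z \<le> real k * ln (r / d)" if "norm z = r" for z using that by force
  \<comment> \<open>On the part of \<open>T\<close> in \<open>D\<close> this is ln(|F|/R), and
    \<open>neg\<close> says that u <= 0 on the outer circle. Along the inner circle \<open>F\<close>
    has winding number (k + 1) - k = 1.\<close>
  define u where "u = (\<lambda>z. v z - real k * ln (norm z / d))"
  define F where "F = (\<lambda>z. f z * (of_real d / z) ^ k)"
  define T where "T = {z::complex. d \<le> norm z \<and> norm z \<le> r}"
  have "bounded T" by (rule bounded_subset[of "cball 0 r"]) (auto simp: T_def)
  then have T: "closed T" "\<And>z. z \<in> T \<Longrightarrow> z \<noteq> 0" "bounded T"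
    unfolding T_def using d by (auto intro!: closed_Collect_conj closed_Collect_le continuous_intros)
  have contu: "continuous_on T u"
    unfolding u_def using T d by (intro continuous_intros continuous_v) auto
  have lnT: "ln (norm z / d) \<ge> 0" if "z \<in> T" for z using that d by (simp add: T_def)
  have uv: "u z \<le> v z" if "z \<in> T" for z using lnT[OF that] by (simp add: u_def)
  have uD: "z \<in> D" if "z \<in> T" "u z > 0" for z using uv[OF that(1)] that v_pos_iff by (metis order_less_le_trans)
  have normF: "norm (F z) = R * exp (u z)" if "z \<in> T" "z \<in> D" for z
  proof -
    have "norm z > 0" using T that by auto
    have "exp (u z) = exp (v z) / exp (ln (norm z / d)) ^ k"
      by (simp add: u_def exp_diff exp_of_nat_mult)
    also have "exp (ln (norm z / d)) = norm z / d" using \<open>norm z > 0\<close> d by simp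
    finally show ?thesis
      using norm_f_in[OF that(2)] d by (simp add: F_def norm_mult norm_power norm_divide power_divide)
  qed
  have onT: "z \<in> T" "u z > s" if "z \<in> sphere 0 d" for z
    using that r d s(2)[of z] by (auto simp: T_def u_def)
  define d1 where "d1 = d * d / r"
  have d1: "0 < d1" "d1 < d" using d r by (auto simp: d1_def field_simps)
  \<comment> \<open>This inversion preserves the circle of radius \<open>d\<close> and reverses its
    orientation. The region beyond |z| = r becomes the disc of radius \<open>d1\<close>, on which
    \<open>U\<close> can be set to 0 continuously.\<close>
  define J where "J = (\<lambda>y::complex. of_real (d * d) / y)"
  have normJ: "norm (J y) = d * d / norm y" for y by (simp add: J_def norm_divide norm_mult)
  have JJ: "J (J y) = y" if "y \<noteq> 0" for y using that d by (simp add: J_def)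
  have JT: "J y \<in> T" if "d1 \<le> norm y" "norm y \<le> d" for y
  proof -
    have "norm y > 0" using that d1 by linarith
    then show ?thesis using that d r by (simp add: T_def normJ d1_def field_simps)
  qed
  define A where "A = {y::complex. d1 \<le> norm y \<and> norm y \<le> d}"
  define U where "U = (\<lambda>y. if norm y \<le> d1 then 0 else max 0 (u (J y)))"
  have UA: "U y = max 0 (u (J y))" if "y \<in> A" for y
  proof (cases "norm y \<le> d1")
    case True
    then have "norm y = d1" using that by (simp add: A_def)
    then have "norm (J y) = r" using d r by (simp add: normJ d1_def)
    then have "u (J y) \<le> 0" using neg by (simp add: u_def)
    then show ?thesis using True by (simp add: U_def)
  qed (simp add: U_def)
  have contJ: "continuous_on A J" unfolding J_def using d1 by (intro continuous_intros) (auto simp: A_def)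
  have contU: "continuous_on (cball 0 d) U"
  proof -
    have "continuous_on A (\<lambda>y. max 0 (u (J y)))"
      by (intro continuous_intros continuous_on_compose2[OF contu contJ]) (use JT in \<open>auto simp: A_def\<close>)
    then have "continuous_on A U" by (rule continuous_on_eq) (simp add: UA)
    moreover have "continuous_on (cball 0 d1) U"
      by (rule continuous_on_eq[of _ "\<lambda>_. 0"]) (auto simp: U_def)
    moreover have "closed A" unfolding A_def by (intro closed_Collect_conj closed_Collect_le continuous_intros)
    ultimately have "continuous_on (cball 0 d1 \<union> A) U" by (intro continuous_on_closed_Un) auto
    moreover have "cball 0 d1 \<union> A = cball 0 d" using d1 by (auto simp: A_def)
    ultimately show ?thesis by simp
  qed
  have Upos: "y \<noteq> 0" "J y \<in> T" "U y = u (J y)" "J y \<in> D" if "norm y \<le> d" "U y > 0" for y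
  proof -
    have "y \<in> A" using that by (auto simp: U_def A_def split: if_splits)
    then show "y \<noteq> 0" "J y \<in> T" "U y = u (J y)" using that UA[of y] d1 JT by (auto simp: A_def)
    then show "J y \<in> D" using uD that by simp
  qed
  have Jsph: "J y \<in> sphere 0 d" if "y \<in> sphere 0 d" for y using that d by (simp add: normJ)
  have holF: "F holomorphic_on D - {0}"
    unfolding F_def by (intro holomorphic_intros holomorphic_on_subset[OF hol_f]) auto
  define w where "w = (of_real (R * exp (s / 2)) :: complex)"
  have w: "norm w = R * exp (s / 2)" using R_pos by (simp add: w_def norm_mult)
  have wF: "norm w < norm (F z)" if "z \<in> sphere 0 d" for z
    using normF[of z] onT[OF that] uD[of z] w R_pos s(1) by simp
  let ?Z = "{y. norm y \<le> d \<and> U y > 0 \<and> F (J y) = w}"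
  have "finite {z \<in> {z \<in> T. u z = s / 2}. F z - w = 0}"
  proof (cases "(\<lambda>z. F z - w) constant_on D - {0}")
    case True
    then obtain c where c: "\<And>z. z \<in> D - {0} \<Longrightarrow> F z - w = c" by (auto simp: constant_on_def)
    have 1: "of_real d \<in> sphere (0::complex) d" using d by simp
    have "of_real d \<in> D - {0::complex}" using uD[of "of_real d"] onT[OF 1] s(1) d by simp
    then have "c \<noteq> 0" using c wF[OF 1] by force
    then have "{z \<in> {z \<in> T. u z = s / 2}. F z - w = 0} = {}"
      using c T uD s(1) by force
    then show ?thesis by (simp only: finite.emptyI)
  next
    case False
    have "closed {z \<in> T. u z = s / 2}" by (rule continuous_closed_preimage_constant[OF contu T(1)])
    moreover have "bounded {z \<in> T. u z = s / 2}" by (rule bounded_subset[OF T(3)]) auto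
    ultimately have "compact {z \<in> T. u z = s / 2}" by (simp only: compact_eq_bounded_closed)
    moreover have "{z \<in> T. u z = s / 2} \<subseteq> D - {0}" using uD s(1) T by auto
    ultimately show ?thesis
      using False holF open_D connected_D
      by (intro holomorphic_compact_finite_zeros[where S = "D - {0}"])
         (auto intro!: holomorphic_intros connected_open_delete)
  qed
  moreover have "?Z \<subseteq> J ` {z \<in> {z \<in> T. u z = s / 2}. F z - w = 0}"
  proof
    fix y assume y: "y \<in> ?Z"
    then have z: "y \<noteq> 0" "J y \<in> T" "J y \<in> D" "F (J y) = w" using Upos[of y] by auto
    then have "R * exp (u (J y)) = R * exp (s / 2)" using normF[of "J y"] w by (simp only:)
    then have "u (J y) = s / 2" using R_pos by simp
    then show "y \<in> J ` {z \<in> {z \<in> T. u z = s / 2}. F z - w = 0}"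
      using z by (intro image_eqI[where x = "J y"]) (simp_all add: JJ)
  qed
  ultimately have fin: "finite ?Z" by (rule finite_surj)
  define O' where "O' = - {0} \<inter> J -` (D - {0})"
  have holJ: "J holomorphic_on O'" unfolding J_def O'_def by (intro holomorphic_intros) auto
  have "\<exists>N L. N \<ge> card ?Z \<and> continuous_on (sphere 0 d) L \<and>
      (\<forall>y\<in>sphere 0 d. F (J y) = y ^ N * exp (L y))"
  proof (rule circle_power_exp[OF d R_pos contU, of O' _ s])
    show "(\<lambda>y. F (J y)) holomorphic_on O'"
      using holomorphic_on_compose_gen[OF holJ holF] by (auto simp: o_def O'_def image_subset_iff)
    show "y \<in> O'" if "norm y \<le> d" "U y > 0" for y
      using Upos[OF that] T by (auto simp: O'_def)
    show "norm (F (J y)) = R * exp (U y)" if "norm y \<le> d" "U y > 0" for y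
      using Upos[OF that] normF by simp
    show "U y > s" if "norm y = d" for y
      using UA[of y] onT[OF Jsph[of y]] that d1 by (simp add: A_def)
  qed (use w R_pos s(1) fin in auto)
  then obtain N L' where L': "continuous_on (sphere 0 d) L'"
    "\<And>y. y \<in> sphere 0 d \<Longrightarrow> F (J y) = y ^ N * exp (L' y)" by blast
  \<comment> \<open>Put z = d^2/y. Comparing F(z) = z d^k exp(L z) with y^N exp(L' y) and
    multiplying by y gives a continuous logarithm of y^(N+1) on the circle.\<close>
  define G where "G = (\<lambda>y. of_real (ln (d ^ k * (d * d))) + L (J y) - L' y)"
  have "sphere 0 d \<subseteq> A" using d1 by (auto simp: A_def)
  then have "continuous_on (sphere 0 d) (\<lambda>y. L (J y))"
    using Jsph by (intro continuous_on_compose2[OF L(1) continuous_on_subset[OF contJ]]) auto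
  then have contG: "continuous_on (sphere 0 d) G"
    unfolding G_def using L'(1) by (intro continuous_intros)
  have "y ^ Suc N = exp (G y)" if y: "y \<in> sphere 0 d" for y
  proof -
    let ?z = "J y"
    have z: "?z \<in> sphere 0 d" "?z \<noteq> 0" "y \<noteq> 0" using Jsph[OF y] y d by auto
    have "F ?z = ?z * of_real d ^ k * exp (L ?z)"
      using L(2)[OF z(1)] z by (simp add: F_def power_divide)
    then have "y ^ N * exp (L' y) = ?z * of_real d ^ k * exp (L ?z)"
      using L'(2)[OF y] by (simp only:)
    then have "y * (y ^ N * exp (L' y)) = of_real (d ^ k * (d * d)) * exp (L ?z)"
      using z by (simp add: J_def)
    moreover have "exp (of_real (ln (d ^ k * (d * d)))) = (of_real (d ^ k * (d * d)) :: complex)"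
      using d by (simp only: exp_of_real exp_ln mult_pos_pos zero_less_power)
    then have "exp (G y) = of_real (d ^ k * (d * d)) * exp (L ?z) / exp (L' y)"
      unfolding G_def by (simp add: exp_add exp_diff)
    ultimately have "exp (G y) = y * (y ^ N * exp (L' y)) / exp (L' y)" by (simp only:)
    then show ?thesis by simp
  qed
  then show False using no_continuous_log_power[OF d _ contG, of "Suc N"] by blast
qed

text \<open>The ratio 8 is that of \<open>circles_decay\<close>, which in the first case, with
  \<tau> = 0, gives B t <= q B(8t) and so geometric growth. In the second case a winding number
  above k > \<mu> gives B t >= k ln(t/\<rho>), whereas an increment below \<kappa> would, by
  \<open>three_circles\<close>, bound B t by \<mu> ln(t/\<rho>) plus a constant.\<close>

lemma B_growth:
  "\<exists>t0>0. \<forall>t\<ge>t0. B (8 * t) \<ge> B t + \<kappa>"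
proof (cases "\<exists>\<rho>0. \<forall>s\<ge>\<rho>0. \<not> sphere 0 s \<subseteq> D")
  case True
  then obtain \<rho>0 where \<rho>0: "\<And>s. s \<ge> \<rho>0 \<Longrightarrow> \<not> sphere 0 s \<subseteq> D" by blast
  have step: "B t \<le> q * B (8 * t)" if t: "t \<ge> \<rho>0" "t > 0" for t
  proof -
    obtain z where z: "norm z \<le> t" "v z = B t" using B_attained[of t] t by auto
    have "v z \<le> 0 + q * B (8 * t)"
    proof (rule circles_decay[OF t(2), of "B (8*t)" 0 0])
      fix s assume "t \<le> s"
      then have "\<not> sphere 0 s \<subseteq> D" using \<rho>0[of s] t by linarith
      then obtain y where "y \<in> sphere 0 s" "y \<notin> D" by blast
      then show "\<exists>z. norm (z - 0) = s \<and> v z \<le> 0" by (intro exI[of _ y]) auto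
    qed (use z t v_le_B in auto)
    then show ?thesis using z by simp
  qed
  obtain r1 where r1: "r1 > 0" "B r1 > 0" using exists_B_pos by blast
  define r where "r = max r1 \<rho>0"
  have r: "r > 0" "r \<ge> \<rho>0" "B r > 0" using r1 B_mono[of r1 r] by (auto simp: r_def)
  have iter: "B (8 ^ n * r) \<ge> (1 / q) ^ n * B r" for n
  proof (induction n)
    case (Suc n)
    have "8 ^ n * r \<ge> 1 * r" using r(1) by (intro mult_right_mono) auto
    then have "B (8 ^ n * r) \<le> q * B (8 * (8 ^ n * r))" using r by (intro step) linarith+
    then have "B (8 * (8 ^ n * r)) \<ge> (1 / q) * B (8 ^ n * r)"
      using q_bounds by (simp add: field_simps)
    also have "(1 / q) * B (8 ^ n * r) \<ge> (1 / q) * ((1 / q) ^ n * B r)"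
      using Suc q_bounds by (intro mult_left_mono) auto
    finally show ?case by (simp add: mult.assoc)
  qed simp
  have q1: "1 / q > 1" using q_bounds by simp
  obtain n where n: "max \<kappa> 0 / (1 / q - 1) / B r < (1 / q) ^ n" using real_arch_pow[OF q1] by blast
  define t0 where "t0 = 8 ^ n * r"
  have "8 ^ n * r \<ge> 1 * r" using r(1) by (intro mult_right_mono) auto
  then have "t0 \<ge> r" by (simp add: t0_def)
  then have t0: "t0 > 0" "t0 \<ge> \<rho>0" using r by linarith+
  have "B (8 * t) \<ge> B t + \<kappa>" if t: "t \<ge> t0" for t
  proof -
    have "max \<kappa> 0 / (1 / q - 1) < (1 / q) ^ n * B r"
      using n r(3) by (simp only: pos_divide_less_eq)
    also have "\<dots> \<le> B t" using iter[of n] B_mono[of t0 t] t t0 by (simp add: t0_def)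
    finally have "max \<kappa> 0 < (1 / q - 1) * B t" using q1 by (simp add: field_simps)
    moreover have "(1 / q) * B t \<le> B (8 * t)"
      using step[of t] t t0 q_bounds by (simp add: field_simps)
    ultimately show ?thesis by (simp add: left_diff_distrib)
  qed
  then show ?thesis using t0 by blast
next
  case False
  define \<kappa>1 where "\<kappa>1 = max \<kappa> 0"
  define \<mu> where "\<mu> = \<kappa>1 / ln 8"
  obtain k :: nat where k: "\<mu> < real k" using reals_Archimedean2 by blast
  have "\<exists>s\<ge>\<rho>0. sphere 0 s \<subseteq> D" for \<rho>0 using False by blast
  then obtain \<rho> c where \<rho>: "\<rho> > 0" "c > 0" "\<And>z. z \<in> sphere 0 \<rho> \<Longrightarrow> v z > c" and
     pre: "\<And>w. R < norm w \<Longrightarrow> norm w < R * exp c \<Longrightarrow>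
        \<exists>Z. finite Z \<and> card Z = Suc k \<and> Z \<subseteq> D \<inter> ball 0 \<rho> \<and> (\<forall>z\<in>Z. f z = w)"
    using many_preimages[of "Suc k"] by blast
  define w where "w = (of_real (R * exp (c / 2)) :: complex)"
  have w: "R < norm w" "norm w < R * exp c" using R_pos \<rho>(2) by (auto simp: w_def norm_mult)
  obtain Z where Z: "finite Z" "card Z = Suc k" "Z \<subseteq> D \<inter> ball 0 \<rho>" "\<And>z. z \<in> Z \<Longrightarrow> f z = w"
    using pre[OF w] by blast
  obtain N L where N: "N \<ge> Suc k" and L: "continuous_on (sphere 0 \<rho>) L"
    "\<And>z. z \<in> sphere 0 \<rho> \<Longrightarrow> f z = z ^ N * exp (L z)"
    using tract_circle_power_exp[OF \<rho>(1,3) w Z(3,4)] Z(2) by auto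
  have growth: "B t \<ge> real k * ln (t / \<rho>)" if t: "t > \<rho>" for t
  proof -
    have "\<exists>z. norm z = t \<and> v z > real (N - 1) * ln (t / \<rho>)"
      using N L by (intro winding_growth[OF \<rho>(1-3) L(1) _ t]) auto
    then obtain z where z: "norm z = t" "v z > real (N - 1) * ln (t / \<rho>)" by blast
    have "real k * ln (t / \<rho>) \<le> real (N - 1) * ln (t / \<rho>)"
      using N t \<rho> by (intro mult_right_mono) auto
    then show ?thesis using z v_le_B[of z t] by linarith
  qed
  define t0 where "t0 = \<rho> * exp (B \<rho> / (real k - \<mu>) + 1)"
  have "B (8 * t) \<ge> B t + \<kappa>" if t: "t \<ge> t0" for t
  proof (rule ccontr)
    assume "\<not> ?thesis"
    then have less: "B (8 * t) < B t + \<kappa>1" by (simp add: \<kappa>1_def)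
    have "B \<rho> / (real k - \<mu>) \<ge> 0" using k \<rho> by (simp add: divide_nonneg_pos)
    then have "1 < exp (B \<rho> / (real k - \<mu>) + 1)" by simp
    then have "\<rho> < t0" using \<rho> by (simp add: t0_def)
    then have t\<rho>: "\<rho> < t" using t by simp
    have "B t \<le> B \<rho> + \<mu> * ln (t / \<rho>)"
      using three_circles[OF \<rho>(1) t\<rho> _ less] by (simp add: \<mu>_def \<kappa>1_def)
    with growth[OF t\<rho>] have "(real k - \<mu>) * ln (t / \<rho>) \<le> B \<rho>" by (simp add: left_diff_distrib)
    then have "ln (t / \<rho>) \<le> B \<rho> / (real k - \<mu>)" using k by (simp add: field_simps)
    moreover have "exp (B \<rho> / (real k - \<mu>) + 1) \<le> t / \<rho>" using t \<rho> by (simp add: t0_def field_simps)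
    then have "B \<rho> / (real k - \<mu>) + 1 \<le> ln (t / \<rho>)" using t\<rho> \<rho> by (simp add: ln_ge_iff)
    ultimately show False by simp
  qed
  moreover have "t0 > 0" using \<rho> by (simp add: t0_def)
  ultimately show ?thesis by blast
qed

lemma M_growth:
  "\<exists>t0>1. \<forall>t\<ge>t0. \<kappa> * ln t \<le> ln (M t)"
proof -
  \<comment> \<open>The factor 2 makes up for rounding \<open>n\<close> down and for the starting
    radius, since 2 n ln 8 >= ln t for large t; the added 1 absorbs \<open>ln R\<close>, which may
    be negative.\<close>
  define c where "c = 2 * (max \<kappa> 0 + 1) * ln 8"
  have lam_pos: "c > 0" by (simp add: c_def)
  obtain t1 where t1: "t1 > 0" "\<And>t. t \<ge> t1 \<Longrightarrow> B (8 * t) \<ge> B t + c"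
    using B_growth[of c] by blast
  define r where "r = max t1 1"
  have r: "r \<ge> 1" "r \<ge> t1" by (auto simp: r_def)
  have iter: "B (8 ^ n * r) \<ge> real n * c" for n
  proof (induction n)
    case (Suc n)
    have "8 ^ n * r \<ge> 1 * r" using r(1) by (intro mult_right_mono) auto
    then have "B (8 * (8 ^ n * r)) \<ge> B (8 ^ n * r) + c" using r by (intro t1) linarith
    then show ?case using Suc by (simp add: algebra_simps)
  qed (use r in simp)
  obtain A where A: "A \<ge> 0" "A \<ge> - ln R" using abs_ge_zero abs_ge_minus_self by metis
  define K where "K = ln r + 2 * ln 8 + A"
  define t0 where "t0 = exp (2 * K)"
  have "K > 0" using r A by (simp add: K_def add_nonneg_pos add_pos_nonneg)
  then have t0: "t0 > 1" by (simp add: t0_def)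
  have "\<kappa> * ln t \<le> ln (M t)" if t: "t \<ge> t0" for t
  proof -
    have tp: "t > 0" using t t0 by linarith
    then have lt: "ln t \<ge> 2 * K"
      using t unfolding t0_def by (simp add: ln_ge_iff)
    define n where "n = nat \<lfloor>(ln t - ln r) / ln 8\<rfloor>"
    have ln8: "ln (8::real) > 0" by simp
    have lnr: "ln r \<ge> 0" using r by simp
    have "ln t - ln r \<ge> 0" using lt \<open>K > 0\<close> ln8 lnr A unfolding K_def by argo
    then have n: "real n \<le> (ln t - ln r) / ln 8" "(ln t - ln r) / ln 8 < real n + 1"
      unfolding n_def by (auto simp: of_nat_nat)
    have "ln (8 ^ n * r) = real n * ln 8 + ln r"
      using r by (subst ln_mult_pos) (auto simp: ln_realpow)
    also have "\<dots> \<le> ln t" using n(1) by (simp add: field_simps)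
    finally have "8 ^ n * r \<le> t" using r tp by (subst (asm) ln_le_cancel_iff) auto
    then have "B t \<ge> real n * c" using iter[of n] B_mono[of "8 ^ n * r" t] r by simp
    also have "real n * c = (max \<kappa> 0 + 1) * (2 * (real n * ln 8))" by (simp add: c_def)
    finally have "B t \<ge> (max \<kappa> 0 + 1) * (2 * (real n * ln 8))" .
    moreover have "2 * (real n * ln 8) \<ge> ln t"
    proof -
      have "ln t - ln r \<le> (real n + 1) * ln 8" using n(2) by (simp add: field_simps)
      then have "ln t - ln r \<le> real n * ln 8 + ln 8" by (simp add: distrib_right)
      then show ?thesis using lt A ln8 lnr unfolding K_def by argo
    qed
    ultimately have "B t \<ge> (max \<kappa> 0 + 1) * ln t"
      using mult_left_mono[of "ln t" "2 * (real n * ln 8)" "max \<kappa> 0 + 1"] by linarith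
    moreover have "ln (M t) = ln R + B t" using R_pos by (simp add: M_def ln_mult_pos)
    moreover have "ln R \<ge> - ln t" using lt lnr ln8 A unfolding K_def by argo
    moreover have "\<kappa> * ln t \<le> max \<kappa> 0 * ln t" using lt \<open>K > 0\<close> by (intro mult_right_mono) auto
    ultimately show ?thesis by (simp add: distrib_right)
  qed
  then show ?thesis using t0 by blast
qed

section \<open>Covered annuli and fast orbits in the tract\<close>

lemma M_pos: "M r > 0"
  using R_pos by (simp add: M_def)

lemma R_le_M: "r \<ge> 0 \<Longrightarrow> R \<le> M r"
  using R_pos by (simp add: M_def)

text \<open>Suppose that no annulus as claimed is covered. By \<open>tract_covers\<close> the set
  \<^term>\<open>{z. v z \<le> \<tau>}\<close> meets every circle around each of its points (and the circle of radius \<open>s\<close>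
  around \<open>0\<close>), so \<open>circles_decay\<close> applies at its points; by Bloch's theorem \<^term>\<open>v\<close> is Lipschitz for the
  quasihyperbolic metric of the complement \<^term>\<open>{z. v z > \<tau>}\<close>. Hence near a point
  where \<^term>\<open>v\<close> is large there is one, four times as close to \<^term>\<open>{z. v z \<le> \<tau>}\<close>, where
  \<^term>\<open>v - \<tau>\<close> has doubled; iterating contradicts boundedness.\<close>

lemma covering_annuli:
  "\<exists>T0>0. \<forall>t\<ge>T0. \<exists>t'>M t. \<forall>w. t' < norm w \<and> norm w < exp 8 * t' \<longrightarrow>
      (\<exists>z\<in>D. t < norm z \<and> norm z < exp 8 * t \<and> f z = w)"
proof -
  \<comment> \<open>\<open>k\<close> decays reduce 2x below x/2, and kk = 3k + 2 halvings reach the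
    matching distance, as 2^kk = 4 8^k. Each application of \<open>E2\<close> below costs 96:
    \<open>B2\<close> makes kk of them cost at most x/2, and the surplus of \<open>B1\<close> pays
    for 102 steps along a circle.\<close>
  obtain k where k: "q ^ k < 1 / 4" using real_arch_pow_inv[of "1/4" q] q_bounds by auto
  define kk where "kk = 3 * k + 2"
  define B2 where "B2 = 192 * real kk"
  define B1 where "B1 = B2 + 96 * 102"
  obtain t1 where t1: "t1 > 0" "\<And>t. t \<ge> t1 \<Longrightarrow> B (8 * t) \<ge> B t + (9 + B1)"
    using B_growth[of "9 + B1"] by blast
  obtain p where p: "p \<notin> D" using unbounded_compl bounded_empty by (metis ComplD equals0I)
  define T0 where "T0 = max t1 (norm p + 1)"
  have "\<exists>t'>M t. \<forall>w. t' < norm w \<and> norm w < exp 8 * t' \<longrightarrow>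
      (\<exists>z\<in>D. t < norm z \<and> norm z < exp 8 * t \<and> f z = w)" if t: "t \<ge> T0" for t
  proof (rule ccontr)
    assume "\<not> ?thesis"
    then have NC: "\<exists>w. t' < norm w \<and> norm w < exp 8 * t' \<and>
        \<not> (\<exists>z\<in>D. t < norm z \<and> norm z < exp 8 * t \<and> f z = w)" if "t' > M t" for t'
      using that by blast
    have tp: "t > norm p" "t \<ge> t1" "t > 0" using t t1(1) by (auto simp: T0_def)
    \<comment> \<open>Of the 9, a part 8 is the logarithmic width of the annulus below R
      exp(\<tau>), and the remaining 1 makes its inner radius exceed \<open>M t\<close>.\<close>
    define \<tau> where "\<tau> = B (2 * t) + 9"
    define E where "E = {z. v z \<le> \<tau>}"
    have B2t: "B (2 * t) \<ge> 0" using tp by simp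
    then have \<tau>0: "\<tau> > 0" by (simp add: \<tau>_def)
    have closedE: "closed E" unfolding E_def by (rule closed_v_le)
    have notE: "z \<notin> E \<Longrightarrow> z \<in> D" for z using v_pos_iff[of z] \<tau>0 by (force simp: E_def)
    have e8: "exp (8::real) \<ge> 256"
    proof -
      have "(2::real) ^ 8 \<le> exp 1 ^ 8" using exp_ge_add_one_self[of "1::real"] by (intro power_mono) auto
      then show ?thesis by (simp add: exp_of_nat_mult[symmetric])
    qed
    have Mt: "M t \<le> R * exp (B (2 * t))" using B_mono[of t "2 * t"] tp R_pos by (simp add: M_def)
    have big: "t < norm z" if "z \<in> D" "norm (f z) > M t" for z
      using norm_f_le_M[of z t] that closure_subset by (force simp: not_le[symmetric])
    \<comment> \<open>Otherwise \<open>f\<close> covers the annulus with inner radius R exp(\<tau> -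
      8), against \<open>NC\<close>; the preimages satisfy |z| > t by themselves since |f z| > M
      t.\<close>
    have E1: "\<exists>z\<in>frontier V. v z < \<tau>"
      if V: "open V" "connected V" "V \<subseteq> ball 0 (exp 8 * t)" and y: "y \<in> V" "y \<notin> D" for V y
    proof (rule ccontr)
      assume "\<not> ?thesis"
      then have fr: "\<And>z. z \<in> frontier V \<Longrightarrow> \<tau> \<le> v z" by force
      define t' where "t' = R * exp (\<tau> - 8)"
      have t': "t' > M t"
      proof -
        have "R * exp (B (2 * t)) < t'" using R_pos by (simp add: t'_def \<tau>_def)
        then show ?thesis using Mt by simp
      qed
      have e: "exp 8 * t' = R * exp \<tau>" by (simp add: t'_def exp_diff)
      have "t' > R" using R_pos B2t by (simp add: t'_def \<tau>_def)
      obtain w where w: "t' < norm w" "norm w < exp 8 * t'"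
        "\<And>z. z \<in> D \<Longrightarrow> t < norm z \<Longrightarrow> norm z < exp 8 * t \<Longrightarrow> f z \<noteq> w" using NC[OF t'] by blast
      have "\<exists>z\<in>V \<inter> D. f z = w"
        using w(1,2) e \<open>t' > R\<close> bounded_subset[OF bounded_ball V(3)]
        by (intro tract_covers[OF V(1,2) _ y fr \<tau>0]) auto
      then obtain z where z: "z \<in> V" "z \<in> D" "f z = w" by blast
      then have "t < norm z" "norm z < exp 8 * t" using big[of z] w(1) t' V(3) by auto
      then show False using w(3) z by blast
    qed
    \<comment> \<open>If the disc leaves \<open>D\<close> this is \<open>E1\<close>; if it lies in
      \<open>D\<close>, the minimum principle for \<open>v\<close> excludes larger values on the
      whole circle.\<close>
    have E1a: "\<exists>z. norm (z - a) = s \<and> v z \<le> \<tau>"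
      if s: "s > 0" "cball a s \<subseteq> ball 0 (exp 8 * t)" and a: "v a \<le> \<tau>" for a s
    proof (rule ccontr)
      assume "\<not> ?thesis"
      then have gt: "v z > \<tau>" if "z \<in> sphere a s" for z
        using that by (force simp: dist_norm norm_minus_commute)
      show False
      proof (cases "ball a s \<subseteq> D")
        case False
        then obtain y where "y \<in> ball a s" "y \<notin> D" by blast
        then have "\<exists>z\<in>frontier (ball a s). v z < \<tau>"
          using s ball_subset_cball by (intro E1) blast+
        then show False using gt s(1) by force
      next
        case True
        obtain m where m: "m \<in> sphere a s" "\<And>z. z \<in> sphere a s \<Longrightarrow> v m \<le> v z"
          using continuous_attains_inf[of "sphere a s" v] continuous_v s(1) by auto
        have "(-1) * v a + 0 * ln (norm (1::complex)) \<le> - v m"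
        proof (rule v_max_principle[OF open_ball bounded_ball True])
          show "(\<lambda>_. 1) holomorphic_on UNIV" by simp
          show "a \<in> ball a s" using s(1) by simp
          fix y assume "y \<in> frontier (ball a s)"
          then show "(-1) * v y + 0 * ln (norm (1::complex)) \<le> - v m" using m(2) s(1) by simp
        qed simp
        then show False using gt[OF m(1)] a by simp
      qed
    qed
    have E1b: "\<exists>z. norm z = s \<and> v z \<le> \<tau>" if s: "t < s" "s < exp 8 * t" for s
    proof -
      have "\<exists>z\<in>frontier (ball 0 s). v z < \<tau>"
        using s tp p by (intro E1[of _ p]) auto
      then show ?thesis using s tp by (auto intro: less_imp_le)
    qed
    have E2: "\<bar>v y - v z\<bar> \<le> 96"
      if \<delta>: "\<delta> > 0" "ball z \<delta> \<subseteq> - E" "ball z \<delta> \<subseteq> ball 0 (exp 8 * t)" and y: "dist z y \<le> \<delta> / 2" for z y \<delta>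
    proof -
      have bD: "ball z \<delta> \<subseteq> D" using \<delta>(2) notE by blast
      obtain h where h: "h holomorphic_on ball z \<delta>" "\<And>x. x \<in> ball z \<delta> \<Longrightarrow> exp (h x) = f x"
        using holomorphic_logarithm_exists[OF convex_ball open_ball holomorphic_on_subset[OF hol_f bD], of z]
          f_nz bD \<delta>(1) by (metis centre_in_ball subsetD)
      have Reh: "Re (h x) = v x + ln R" if "x \<in> ball z \<delta>" for x
      proof -
        have "exp (Re (h x)) = R * exp (v x)"
          using h(2)[OF that] norm_f_in[of x] bD that by (metis norm_exp_eq_Re subsetD)
        then have "exp (Re (h x)) = exp (v x + ln R)" using R_pos by (simp add: exp_add)
        then show ?thesis by simp
      qed
      \<comment> \<open>A larger derivative would let a logarithm of \<open>f\<close> cover a disc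
        of radius 8 = 96/12. It contains a logarithm of every \<open>w\<close> with |ln|w| - Re b| <
        4, because the imaginary part can be brought within pi < 4 of that of \<open>b\<close>; so a
        full annulus would be covered.\<close>
      have bloch: "norm (deriv h x) * (\<delta> / 2) < 96" if x: "x \<in> cball z (\<delta> / 2)" for x
      proof (rule ccontr)
        assume "\<not> ?thesis"
        then have "8 \<le> (\<delta> / 2) * norm (deriv h x) / 12" by (simp add: not_less mult.commute)
        moreover have sub: "ball x (\<delta> / 2) \<subseteq> ball z \<delta>"
        proof
          fix y assume "y \<in> ball x (\<delta> / 2)"
          then show "y \<in> ball z \<delta>" using x dist_triangle[of z y x] by simp
        qed
        ultimately obtain b where b: "ball b 8 \<subseteq> h ` ball x (\<delta> / 2)"
          using Bloch[OF holomorphic_on_subset[OF h(1) sub], of 8] \<delta>(1) by auto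
        have img: "Re c > \<tau> + ln R" if c: "c \<in> ball b 8" for c
        proof -
          obtain x' where "x' \<in> ball z \<delta>" "c = h x'" using b c sub by blast
          then show ?thesis using Reh[of x'] \<delta>(2) by (auto simp: E_def)
        qed
        have Reb: "Re b - 8 \<ge> \<tau> + ln R"
        proof (rule ccontr)
          assume a: "\<not> ?thesis"
          define \<xi> where "\<xi> = max 0 (Re b - (\<tau> + ln R))"
          have "b - of_real \<xi> \<in> ball b 8" using a by (simp add: \<xi>_def dist_norm)
          from img[OF this] show False by (simp add: \<xi>_def max_def split: if_splits)
        qed
        define t' where "t' = exp (Re b - 4)"
        have t': "t' > M t"
        proof -
          have "M t \<le> exp (ln R + B (2 * t))" using Mt R_pos by (simp add: exp_add)
          also have "\<dots> < t'" using Reb by (simp add: t'_def \<tau>_def)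
          finally show ?thesis .
        qed
        obtain w where w: "t' < norm w" "norm w < exp 8 * t'"
          "\<And>z. z \<in> D \<Longrightarrow> t < norm z \<Longrightarrow> norm z < exp 8 * t \<Longrightarrow> f z \<noteq> w" using NC[OF t'] by blast
        have w0: "w \<noteq> 0" using w(1) by (auto simp: t'_def)
        have lw: "Re b - 4 < ln (norm w)" "ln (norm w) < Re b + 4"
        proof -
          have "exp (Re b - 4) < exp (ln (norm w))" using w(1) w0 by (simp add: t'_def)
          then show "Re b - 4 < ln (norm w)" by (simp only: exp_less_cancel_iff)
          have "norm w < exp (Re b + 4)" using w(2) by (simp add: t'_def exp_add[symmetric] add.commute)
          then have "exp (ln (norm w)) < exp (Re b + 4)" using w0 by simp
          then show "ln (norm w) < Re b + 4" by (simp only: exp_less_cancel_iff)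
        qed
        define c where "c = of_real (Im b) * \<i> + Ln (w / exp (of_real (Im b) * \<i>))"
        have expc: "exp c = w" using w0 by (simp add: c_def exp_add)
        have Rec: "Re c = ln (norm w)" using w0 by (simp add: c_def norm_divide Re_Ln)
        have Imc: "\<bar>Im c - Im b\<bar> \<le> pi"
          using w0 mpi_less_Im_Ln[of "w / exp (of_real (Im b) * \<i>)"] Im_Ln_le_pi[of "w / exp (of_real (Im b) * \<i>)"]
          by (auto simp: c_def abs_le_iff)
        have "norm (c - b) \<le> \<bar>Re (c - b)\<bar> + \<bar>Im (c - b)\<bar>" by (rule cmod_le)
        also have "\<dots> < 4 + 4" using lw Rec Imc pi_less_4 by (intro add_strict_mono) (auto simp: abs_less_iff)
        finally have "c \<in> ball b 8" by (simp add: dist_norm norm_minus_commute)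
        then obtain x' where x': "x' \<in> ball z \<delta>" "c = h x'" using b sub by blast
        then have "f x' = w" "x' \<in> D" using h(2) expc bD by auto
        moreover have "norm x' < exp 8 * t" using x'(1) \<delta>(3) by auto
        ultimately show False using big[of x'] w(1,3) t' by force
      qed
      have sub2: "cball z (\<delta> / 2) \<subseteq> ball z \<delta>" using \<delta>(1) by auto
      have "norm (h y - h z) \<le> (192 / \<delta>) * norm (y - z)"
      proof (rule field_differentiable_bound[where S = "cball z (\<delta> / 2)" and f' = "deriv h"])
        fix x assume x: "x \<in> cball z (\<delta> / 2)"
        then have "x \<in> ball z \<delta>" using sub2 by blast
        then show "(h has_field_derivative deriv h x) (at x within cball z (\<delta> / 2))"
          using h(1) holomorphic_derivI[OF h(1) open_ball] by blast
        show "norm (deriv h x) \<le> 192 / \<delta>" using bloch[OF x] \<delta>(1) by (simp add: field_simps)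
      qed (use y \<delta>(1) in auto)
      also have "\<dots> \<le> (192 / \<delta>) * (\<delta> / 2)"
        using y \<delta>(1) by (intro mult_left_mono) (auto simp: dist_norm norm_minus_commute)
      also have "\<dots> = 96" using \<delta>(1) by simp
      finally have "\<bar>Re (h y - h z)\<bar> \<le> 96" using abs_Re_le_cmod order_trans by blast
      moreover have "y \<in> ball z \<delta>" "z \<in> ball z \<delta>" using y \<delta>(1) by auto
      ultimately show ?thesis using Reh by simp
    qed
    have infd: "ball z (infdist z E) \<subseteq> - E" for z
      using infdist_le[of _ E z] by (force simp: dist_commute)
    obtain z0 where z0: "norm z0 \<le> 16 * t" "v z0 = B (16 * t)" using B_attained[of "16 * t"] tp by auto
    have vz0: "v z0 \<ge> \<tau> + B1" using t1(2)[of "2 * t"] tp z0 by (simp add: \<tau>_def)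
    have B12: "B2 > 0" "B1 > 0" by (auto simp: B2_def B1_def kk_def)
    define s where "s = norm z0"
    have s: "2 * t < s" "s \<le> 16 * t"
    proof -
      show "s \<le> 16 * t" using z0 by (simp add: s_def)
      show "2 * t < s"
      proof (rule ccontr)
        assume "\<not> ?thesis"
        then have "v z0 \<le> B (2 * t)" by (intro v_le_B) (simp add: s_def)
        then show False using vz0 B12 by (simp add: \<tau>_def)
      qed
    qed
    have s0: "s > 0" "s < exp 8 * t"
    proof -
      show "s > 0" using s tp by linarith
      have "256 * t \<le> exp 8 * t" using e8 tp by (intro mult_right_mono) auto
      then show "s < exp 8 * t" using s tp by linarith
    qed
    have inball: "x \<in> ball 0 (exp 8 * t)" if "norm x \<le> 2 * s" for x
    proof -
      have "256 * t \<le> exp 8 * t" using e8 tp by (intro mult_right_mono) auto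
      then have "norm x < exp 8 * t" using that s tp by linarith
      then show ?thesis by simp
    qed
    \<comment> \<open>Walk from \<open>z0\<close> along its circle in steps of angle 1/16. The
      circle meets \<open>E\<close> by \<open>E1b\<close>, so at most 102 steps lead within s/8 of
      \<open>E\<close>, as 32 pi < 103; up to then \<open>E2\<close> applies to each step.\<close>
    obtain z1 where z1: "norm z1 = s" "infdist z1 E < s / 8" "v z1 \<ge> \<tau> + B2"
    proof -
      define Z where "Z = (\<lambda>j::nat. z0 * cis (real j / 16))"
      have nZ: "norm (Z j) = s" for j by (simp add: Z_def norm_mult s_def)
      have cis_lip: "norm (cis \<alpha> - cis \<beta>) \<le> \<bar>\<alpha> - \<beta>\<bar>" for \<alpha> \<beta>
      proof -
        have "cis \<alpha> - cis \<beta> = cis \<beta> * (cis (\<alpha> - \<beta>) - 1)"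
          by (simp add: algebra_simps cis_mult)
        then have "norm (cis \<alpha> - cis \<beta>) = norm (exp (\<i> * of_real (\<alpha> - \<beta>)) - 1)"
          by (simp add: norm_mult cis_conv_exp)
        also have "\<dots> = 2 * \<bar>sin ((\<alpha> - \<beta>) / 2)\<bar>" by (rule dist_exp_i_1)
        also have "\<dots> \<le> 2 * \<bar>(\<alpha> - \<beta>) / 2\<bar>" using abs_sin_x_le_abs_x[of "(\<alpha> - \<beta>) / 2"] by (intro mult_left_mono) simp_all
        finally show ?thesis by simp
      qed
      obtain p0 where p0: "norm p0 = s" "v p0 \<le> \<tau>" using E1b[of s] s s0 tp by auto
      have z00: "z0 \<noteq> 0" using s0 by (auto simp: s_def)
      define \<alpha> where "\<alpha> = Arg2pi (p0 / z0)"
      have \<alpha>: "0 \<le> \<alpha>" "\<alpha> < 2 * pi" "p0 = z0 * cis \<alpha>"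
      proof -
        show "0 \<le> \<alpha>" "\<alpha> < 2 * pi" unfolding \<alpha>_def using Arg2pi[of "p0 / z0"] by auto
        have "norm (p0 / z0) = 1" using p0 z00 by (simp add: norm_divide s_def)
        then have "p0 / z0 = cis \<alpha>"
          using Arg2pi[of "p0 / z0"] by (simp add: \<alpha>_def cis_conv_exp is_Arg_def)
        then show "p0 = z0 * cis \<alpha>" using z00 by (simp add: field_simps)
      qed
      define j1 where "j1 = nat \<lfloor>16 * \<alpha>\<rfloor>"
      have j1: "real j1 \<le> 16 * \<alpha>" "16 * \<alpha> < real j1 + 1" using \<alpha> by (auto simp: j1_def of_nat_nat)
      have j1': "j1 \<le> 102"
      proof -
        have "pi * 5 < 16"
          using pi_approx(2) by (simp add: field_simps)
        then have "real j1 < 102.5" using j1(1) \<alpha>(2) by simp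
        then have "j1 < 103" by linarith
        then show ?thesis by linarith
      qed
      have "dist (Z j1) p0 = s * norm (cis (real j1 / 16) - cis \<alpha>)"
        using \<alpha>(3) by (simp add: Z_def dist_norm s_def norm_mult[symmetric] right_diff_distrib)
      also have "\<dots> \<le> s * \<bar>real j1 / 16 - \<alpha>\<bar>"
        using s0(1) by (intro mult_left_mono cis_lip) simp
      also have "\<dots> \<le> s * (1 / 16)" using j1 s0 by (intro mult_left_mono) (auto simp: abs_le_iff)
      finally have "infdist (Z j1) E \<le> s / 16"
        using infdist_le2[of p0 E "Z j1" "s / 16"] p0 by (simp add: E_def)
      then have ex: "infdist (Z j1) E < s / 8" using s0 by simp
      define j where "j = (LEAST j. infdist (Z j) E < s / 8)"
      have j: "infdist (Z j) E < s / 8" "j \<le> 102"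
        using LeastI[of "\<lambda>j. infdist (Z j) E < s / 8", OF ex] Least_le[of "\<lambda>j. infdist (Z j) E < s / 8", OF ex] j1'
        by (auto simp: j_def)
      have "i \<le> j \<longrightarrow> v (Z i) \<ge> v z0 - 96 * real i" for i
      proof (induction i)
        case 0 then show ?case by (simp add: Z_def)
      next
        case (Suc i)
        show ?case
        proof
          assume "Suc i \<le> j"
          then have i: "i < j" by simp
          then have far: "infdist (Z i) E \<ge> s / 8"
            using not_less_Least[of i "\<lambda>j. infdist (Z j) E < s / 8"] by (simp add: j_def)
          have "\<bar>v (Z (Suc i)) - v (Z i)\<bar> \<le> 96"
          proof (rule E2)
            show "s / 8 > 0" using s0 by simp
            show "ball (Z i) (s / 8) \<subseteq> - E" using infd[of "Z i"] far by (meson subset_ball subset_trans)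
            show "ball (Z i) (s / 8) \<subseteq> ball 0 (exp 8 * t)"
            proof
              fix x assume "x \<in> ball (Z i) (s / 8)"
              then have "norm (x - Z i) < s / 8" by (simp add: dist_norm norm_minus_commute)
              then have "norm x \<le> 2 * s" using nZ[of i] s0 norm_triangle_ineq2[of x "Z i"] by linarith
              then show "x \<in> ball 0 (exp 8 * t)" by (rule inball)
            qed
            have "dist (Z i) (Z (Suc i)) = s * norm (cis (real i / 16) - cis (real (Suc i) / 16))"
              by (simp add: Z_def dist_norm s_def norm_mult[symmetric] right_diff_distrib)
            also have "\<dots> \<le> s * \<bar>real i / 16 - real (Suc i) / 16\<bar>"
              using s0(1) by (intro mult_left_mono cis_lip) simp
            also have "\<dots> = s / 16" by (simp add: field_simps)
            finally show "dist (Z i) (Z (Suc i)) \<le> s / 8 / 2" by simp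
          qed
          then show "v (Z (Suc i)) \<ge> v z0 - 96 * real (Suc i)" using Suc i by auto
        qed
      qed
      then have "v (Z j) \<ge> v z0 - 96 * real j" by blast
      moreover have "96 * real j \<le> 96 * 102" using j(2) by simp
      ultimately have "v (Z j) \<ge> \<tau> + B2" using vz0 by (simp add: B1_def)
      then show ?thesis using that[of "Z j"] nZ j(1) by blast
    qed
    define \<delta>1 where "\<delta>1 = infdist z1 E"
    \<comment> \<open>Stable under the improvement step: going from \<open>z\<close> to
      \<open>z'\<close> moves by at most 5d/4 and lowers the distance to \<open>E\<close> from d to
      at most d/4, and 5/4 + 3/4 <= 3. A maximum of \<open>v\<close> on this compact set replaces an
      infinite iteration.\<close>
    define X where "X = {z. norm (z - z1) + 3 * infdist z E \<le> 3 * \<delta>1 \<and> \<tau> + B2 \<le> v z}"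
    have "closed X" unfolding X_def
      by (intro closed_Collect_conj closed_Collect_le continuous_intros continuous_v)
    moreover have "X \<subseteq> cball z1 (3 * \<delta>1)"
    proof
      fix z assume "z \<in> X"
      then have "norm (z - z1) \<le> 3 * \<delta>1" using infdist_nonneg[of z E] by (simp add: X_def)
      then show "z \<in> cball z1 (3 * \<delta>1)" by (simp add: dist_norm norm_minus_commute)
    qed
    ultimately have "compact X" by (meson bounded_cball bounded_subset compact_eq_bounded_closed)
    moreover have "z1 \<in> X" using z1 by (simp add: X_def \<delta>1_def)
    ultimately obtain z where z: "z \<in> X" "\<And>y. y \<in> X \<Longrightarrow> v y \<le> v z"
      using continuous_attains_sup[of X v] continuous_v by auto
    define x where "x = v z - \<tau>"
    define d where "d = infdist z E"
    have x: "x \<ge> B2" "x > 0" using z(1) B12 by (auto simp: X_def x_def)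
    have zE: "z \<notin> E" using x by (simp add: E_def x_def)
    have "E \<noteq> {}" using p \<tau>0 by (auto simp: E_def intro!: exI[of _ p])
    then obtain a where a: "a \<in> E" "d = dist z a"
      using infdist_attains_inf[OF closedE] unfolding d_def by metis
    have d0: "d > 0" using a zE by auto
    have zX: "norm (z - z1) + 3 * d \<le> 3 * \<delta>1" "\<delta>1 < s / 8" using z(1) z1 by (auto simp: X_def d_def \<delta>1_def)
    have near: "norm y \<le> 2 * s" if "norm (y - z) \<le> 2 * d" for y
    proof -
      have "norm y \<le> norm (y - z) + norm (z - z1) + norm z1"
        using norm_triangle_ineq[of "y - z" "z - z1"] norm_triangle_ineq2[of y z1] by simp
      then show ?thesis using that zX z1 d0 s0 by linarith
    qed
    \<comment> \<open>Otherwise \<open>k\<close> decays about \<open>a\<close> bring v - \<tau>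
      below x/2 at distance d/(4 8^k), whereas halving the way from \<open>z\<close> to
      \<open>a\<close> kk times leads to that distance and loses at most x/2.\<close>
    have "\<exists>z'. dist a z' \<le> d / 4 \<and> v z' > \<tau> + 2 * x"
    proof (rule ccontr)
      assume "\<not> ?thesis"
      then have neg: "v z' \<le> \<tau> + 2 * x" if "dist a z' \<le> d / 4" for z' using that by force
      define Y where "Y = (\<lambda>i::nat. a + (z - a) / 2 ^ i)"
      have Ya: "norm (Y i - a) = d / 2 ^ i" for i
        by (simp add: Y_def norm_divide norm_power a(2) dist_norm)
      have "v (Y i) \<ge> v z - 96 * real i" for i
      proof (induction i)
        case 0 then show ?case by (simp add: Y_def)
      next
        case (Suc i)
        have Yz: "norm (Y i - z) = d - d / 2 ^ i"
        proof -
          have "Y i - z = of_real (1 / 2 ^ i - 1) * (z - a)" by (simp add: Y_def field_simps)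
          then have "norm (Y i - z) = \<bar>1 / 2 ^ i - 1\<bar> * d" by (simp only: norm_mult norm_of_real a(2) dist_norm)
          moreover have "\<bar>1 / 2 ^ i - 1 :: real\<bar> = 1 - 1 / 2 ^ i" by simp
          ultimately show ?thesis by (simp add: algebra_simps)
        qed
        have sub: "ball (Y i) (d / 2 ^ i) \<subseteq> ball z d"
        proof
          fix y assume "y \<in> ball (Y i) (d / 2 ^ i)"
          then have "norm (y - Y i) < d / 2 ^ i" by (simp add: dist_norm norm_minus_commute)
          then have "norm (y - z) < d" using norm_triangle_ineq[of "y - Y i" "Y i - z"] Yz by simp
          then show "y \<in> ball z d" by (simp add: dist_norm norm_minus_commute)
        qed
        have "\<bar>v (Y (Suc i)) - v (Y i)\<bar> \<le> 96"
        proof (rule E2)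
          show "d / 2 ^ i > 0" using d0 by simp
          show "ball (Y i) (d / 2 ^ i) \<subseteq> - E" using sub infd[of z] by (simp add: d_def subset_trans)
          have "ball z d \<subseteq> ball 0 (exp 8 * t)"
          proof
            fix y assume "y \<in> ball z d"
            then have "norm (y - z) \<le> 2 * d" using d0 by (simp add: dist_norm norm_minus_commute)
            then show "y \<in> ball 0 (exp 8 * t)" using inball near by blast
          qed
          then show "ball (Y i) (d / 2 ^ i) \<subseteq> ball 0 (exp 8 * t)" using sub by blast
          have "Y i - Y (Suc i) = (z - a) / 2 ^ Suc i" by (simp add: Y_def field_simps)
          then show "dist (Y i) (Y (Suc i)) \<le> d / 2 ^ i / 2"
            by (simp add: dist_norm norm_divide norm_power norm_mult a(2))
        qed
        then show ?case using Suc by (simp add: algebra_simps abs_le_iff)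
      qed
      from this[of kk] have low: "v (Y kk) - \<tau> \<ge> x / 2"
        using x(1) by (simp add: x_def B2_def)
      have decay: "v z' \<le> \<tau> + q ^ i * (2 * x)" if "norm (z' - a) \<le> d / (4 * 8 ^ i)" for i z'
        using that
      proof (induction i arbitrary: z')
        case 0 then show ?case using neg by (simp add: dist_norm norm_minus_commute)
      next
        case (Suc i)
        define r where "r = d / (4 * 8 ^ Suc i)"
        have r: "r > 0" "8 * r = d / (4 * 8 ^ i)" "2 * r \<le> d"
        proof -
          show "r > 0" using d0 by (simp add: r_def)
          show "8 * r = d / (4 * 8 ^ i)" by (simp add: r_def)
          have "r \<le> d / 4" unfolding r_def using d0 one_le_power[of "8::real" "Suc i"]
            by (intro divide_left_mono) auto
          then show "2 * r \<le> d" using d0 by simp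
        qed
        have "v z' \<le> \<tau> + q * (q ^ i * (2 * x))"
        proof (rule circles_decay[OF r(1)])
          show "0 \<le> q ^ i * (2 * x)" using q_bounds x by simp
          show "norm (z' - a) \<le> r" using Suc.prems by (simp add: r_def)
          fix y assume "norm (y - a) \<le> 8 * r"
          then show "v y \<le> \<tau> + q ^ i * (2 * x)" using Suc.IH r by simp
        next
          fix s' assume s': "r \<le> s'" "s' \<le> 2 * r"
          show "\<exists>z. norm (z - a) = s' \<and> v z \<le> \<tau>"
          proof (rule E1a)
            show "s' > 0" using s' r by simp
            show "v a \<le> \<tau>" using a by (simp add: E_def)
            show "cball a s' \<subseteq> ball 0 (exp 8 * t)"
            proof
              fix y assume "y \<in> cball a s'"
              then have "norm (y - a) \<le> d" using s' r by (simp add: dist_norm norm_minus_commute)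
              moreover have "norm (a - z) = d" using a by (simp add: dist_norm norm_minus_commute)
              ultimately have "norm (y - z) \<le> 2 * d" using norm_triangle_ineq[of "y - a" "a - z"] by simp
              then show "y \<in> ball 0 (exp 8 * t)" using inball near by blast
            qed
          qed
        qed (use \<tau>0 in simp)
        then show ?case by (simp add: mult.assoc)
      qed
      have "(2::real) ^ kk = 4 * 8 ^ k"
      proof -
        have "(2::real) ^ kk = (2 ^ 3) ^ k * 2 ^ 2" by (simp only: kk_def power_add power_mult)
        then show ?thesis by simp
      qed
      then have "v (Y kk) \<le> \<tau> + q ^ k * (2 * x)" using decay[of "Y kk" k] Ya[of kk] by simp
      moreover have "q ^ k * (2 * x) < (1 / 4) * (2 * x)" using k x by (intro mult_strict_right_mono) auto
      ultimately show False using low by linarith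
    qed
    then obtain z' where z': "dist a z' \<le> d / 4" "v z' > \<tau> + 2 * x" by blast
    have "infdist z' E \<le> d / 4" using infdist_le2[of a E z' "d/4"] a z'(1) by (simp add: dist_commute)
    moreover have "norm (z' - z1) \<le> norm (z - z1) + d + d / 4"
    proof -
      have "dist z' z1 \<le> dist z' a + dist a z + dist z z1"
        using dist_triangle[of z' z1 a] dist_triangle[of a z1 z] by linarith
      then show ?thesis using z'(1) a(2) by (simp add: dist_norm[symmetric] dist_commute)
    qed
    ultimately have "norm (z' - z1) + 3 * infdist z' E \<le> 3 * \<delta>1" using zX d0 by linarith
    then have "z' \<in> X" using z'(2) x by (simp add: X_def)
    from z(2)[OF this] show False using z'(2) x by (simp add: x_def)
  qed
  moreover have "T0 > 0" using t1 by (simp add: T0_def)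
  ultimately show ?thesis by blast
qed

text \<open>Points are lifted from the last annulus back through all earlier ones; the start depends
  on \<open>n\<close>, and no limit of starting points is taken. The radii more than double since M
  t >= t^2 for large t.\<close>

lemma escaping_orbits:
  assumes "c > 0"
  shows "\<exists>\<rho>. \<rho> 0 > c \<and> (\<forall>j. \<rho> j > 1 \<and> M (\<rho> j) < \<rho> (Suc j) \<and> 2 * \<rho> j < \<rho> (Suc j)) \<and>
     (\<forall>n. \<exists>z. norm z < exp 8 * \<rho> 0 \<and> (\<forall>j\<le>n. (f ^^ j) z \<in> D \<and> \<rho> j < norm ((f ^^ j) z)))"
proof -
  obtain T0 where T0: "T0 > 0" "\<And>t. t \<ge> T0 \<Longrightarrow> \<exists>t'>M t. \<forall>w. t' < norm w \<and> norm w < exp 8 * t' \<longrightarrow>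
      (\<exists>z\<in>D. t < norm z \<and> norm z < exp 8 * t \<and> f z = w)"
    using covering_annuli by blast
  obtain t1 where t1: "t1 > 1" "\<And>t. t \<ge> t1 \<Longrightarrow> 2 * ln t \<le> ln (M t)" using M_growth[of 2] by blast
  define T where "T = max (max T0 t1) (max 2 (c + 1))"
  have T: "T \<ge> T0" "T \<ge> t1" "T \<ge> 2" "T > c" by (auto simp: T_def)
  have M2: "2 * t \<le> M t" if "t \<ge> T" for t
  proof -
    have t: "t \<ge> 2" "t \<ge> t1" using that T by linarith+
    have "exp (ln (t * t)) \<le> exp (ln (M t))"
      using t1(2)[OF t(2)] t by (simp add: ln_mult_pos)
    then have "t * t \<le> M t" using t M_pos by simp
    moreover have "2 * t \<le> t * t" using t by (intro mult_right_mono) auto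
    ultimately show ?thesis by linarith
  qed
  define P where "P = (\<lambda>t t'. t' > M t \<and> (\<forall>w. t' < norm w \<and> norm w < exp 8 * t' \<longrightarrow>
      (\<exists>z\<in>D. t < norm z \<and> norm z < exp 8 * t \<and> f z = w)))"
  have "\<exists>\<rho>. \<forall>n::nat. (\<rho> n \<ge> T \<and> (n = 0 \<longrightarrow> \<rho> n = T)) \<and> P (\<rho> n) (\<rho> (Suc n))"
  proof (rule dependent_nat_choice)
    show "\<exists>x\<ge>T. (0::nat) = 0 \<longrightarrow> x = T" by auto
    fix x and n :: nat assume x: "T \<le> x \<and> (n = 0 \<longrightarrow> x = T)"
    then obtain t' where t': "P x t'" using T0(2)[of x] T by (auto simp: P_def)
    then have "t' \<ge> T" using M2[of x] x T by (auto simp: P_def)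
    then show "\<exists>y. (T \<le> y \<and> (Suc n = 0 \<longrightarrow> y = T)) \<and> P x y" using t' by auto
  qed
  then obtain \<rho> where \<rho>: "\<And>n::nat. \<rho> n \<ge> T" "\<rho> 0 = T" "\<And>n. P (\<rho> n) (\<rho> (Suc n))" by metis
  have orbit: "\<exists>z. norm z < exp 8 * \<rho> 0 \<and> (f ^^ n) z = w \<and>
      (\<forall>j<n. (f ^^ j) z \<in> D \<and> \<rho> j < norm ((f ^^ j) z))" if "\<rho> n < norm w" "norm w < exp 8 * \<rho> n" for n w
    using that
  proof (induction n arbitrary: w)
    case 0 then show ?case by (intro exI[of _ w]) auto
  next
    case (Suc n)
    have "P (\<rho> n) (\<rho> (Suc n))" by (rule \<rho>)
    then obtain y where y: "y \<in> D" "\<rho> n < norm y" "norm y < exp 8 * \<rho> n" "f y = w"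
      using Suc.prems unfolding P_def by blast
    obtain z where z: "norm z < exp 8 * \<rho> 0" "(f ^^ n) z = y"
       "\<And>j. j < n \<Longrightarrow> (f ^^ j) z \<in> D \<and> \<rho> j < norm ((f ^^ j) z)"
      using Suc.IH[OF y(2,3)] by blast
    have "(f ^^ j) z \<in> D \<and> \<rho> j < norm ((f ^^ j) z)" if "j < Suc n" for j
      using that z y by (cases "j = n") auto
    then show ?case using z y by (intro exI[of _ z]) auto
  qed
  have "\<exists>z. norm z < exp 8 * \<rho> 0 \<and> (\<forall>j\<le>n. (f ^^ j) z \<in> D \<and> \<rho> j < norm ((f ^^ j) z))" for n
  proof -
    have pos: "\<rho> (Suc n) > 0" using \<rho>(1)[of "Suc n"] T by linarith
    have "exp (8::real) > 2" using exp_ge_add_one_self[of "8::real"] by linarith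
    \<comment> \<open>The target 2\<rho>(n+1) lies in the annulus of index n + 1; lifting it
      controls the times up to n.\<close>
    then have "\<rho> (Suc n) < norm (of_real (2 * \<rho> (Suc n)) :: complex)"
         "norm (of_real (2 * \<rho> (Suc n)) :: complex) < exp 8 * \<rho> (Suc n)"
      using pos by (auto simp: norm_mult)
    from orbit[OF this] show ?thesis by (auto simp: less_Suc_eq_le)
  qed
  moreover have "\<rho> j > 1 \<and> M (\<rho> j) < \<rho> (Suc j) \<and> 2 * \<rho> j < \<rho> (Suc j)" for j
    using \<rho>(1)[of j] \<rho>(3)[of j] M2[of "\<rho> j"] T by (auto simp: P_def)
  ultimately show ?thesis using \<rho>(2) T by (intro exI[of _ \<rho>]) auto
qed

end

section \<open>Image of a domain under orbits that stay in the tract\<close>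

text \<open>In the applications \<open>I\<close> is the component of 0 in the complement of
  \<open>K\<close>. With \<open>r 0 = 0\<close> the size condition at time 0 only excludes the
  origin. The bound in \<open>z0_end\<close> is exactly what \<open>exit_bound\<close> gives for
  points that leave the region, so the orbit of \<open>z0\<close> beats all of those.\<close>

locale surrounding_tract = tract +
  fixes I K :: "complex set" and r :: "nat \<Rightarrow> real" and n :: nat and z0 :: complex
  assumes open_I: "open I" and connected_I: "connected I" and bounded_I: "bounded I"
    and frontier_I: "frontier I \<subseteq> K" and not_sub: "\<not> I \<subseteq> D"
    and r0: "r 0 = 0" and r_step: "\<And>k. M (r k) < r (Suc k)"
    and n_pos: "n \<ge> 1" and z0_in: "z0 \<in> I"
    and z0_orbit: "\<And>j. j < n \<Longrightarrow> (f ^^ j) z0 \<in> D \<and> r j < norm ((f ^^ j) z0)"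
    and z0_end: "M (r (n - 1)) < norm ((f ^^ n) z0)"
begin

lemma r_nonneg: "r k \<ge> 0"
proof (cases k)
  case (Suc j)
  then show ?thesis using r_step[of j] M_pos[of "r j"] by simp
qed (simp add: r0)

definition G :: "nat \<Rightarrow> complex set" where
  "G m = {z \<in> I. \<forall>j<m. (f ^^ j) z \<in> D \<and> r j < norm ((f ^^ j) z)}"

lemma G_Suc: "G (Suc m) = {z \<in> G m. (f ^^ m) z \<in> D \<inter> {w. r m < norm w}}"
  by (auto simp: G_def less_Suc_eq)

lemma G_iter_D: "z \<in> G m \<Longrightarrow> j < m \<Longrightarrow> (f ^^ j) z \<in> D"
  by (simp add: G_def)

lemma open_G: "open (G m) \<and> continuous_on (G m) (f ^^ m)"
proof (induction m)
  case 0
  then show ?case using open_I by (simp add: G_def)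
next
  case (Suc m)
  have "open (D \<inter> {w. r m < norm w})" using open_D by (intro open_Int open_Collect_less continuous_intros)
  then have "open (G m \<inter> (f ^^ m) -` (D \<inter> {w. r m < norm w}))"
    using Suc continuous_open_preimage by blast
  moreover have "G m \<inter> (f ^^ m) -` (D \<inter> {w. r m < norm w}) = G (Suc m)" by (auto simp: G_Suc)
  moreover have "continuous_on (G (Suc m)) (\<lambda>z. f ((f ^^ m) z))"
  proof (rule continuous_on_compose2[OF holomorphic_on_imp_continuous_on[OF hol_f]])
    show "continuous_on (G (Suc m)) (f ^^ m)" using Suc by (auto simp: G_Suc intro: continuous_on_subset)
  qed (auto simp: G_Suc)
  ultimately show ?case by (simp add: o_def)
qed

lemma open_iter_image: "open H \<Longrightarrow> H \<subseteq> G m \<Longrightarrow> j \<le> m \<Longrightarrow> open ((f ^^ j) ` H)"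
proof (induction j)
  case (Suc j)
  then have "open ((f ^^ j) ` H)" "(f ^^ j) ` H \<subseteq> D" using G_iter_D by fastforce+
  then have "open (f ` ((f ^^ j) ` H))" by (rule open_image)
  then show ?case by (simp add: image_comp)
qed simp

text \<open>The two claims need each other: \<open>f\<close> is continuous on the closure of
  \<open>D\<close>, so continuity at time j + 1 requires the location at time j, and the location on
  the closure follows from continuity by passing to limits.\<close>

lemma closure_G:
  "(j \<le> m \<longrightarrow> continuous_on (closure (G m)) (f ^^ j)) \<and>
   (j < m \<longrightarrow> (\<forall>z\<in>closure (G m). (f ^^ j) z \<in> closure D \<and> r j \<le> norm ((f ^^ j) z)))"
proof (induction j)
  case 0
  have "closure (G m) \<subseteq> closure D" if "0 < m"
  proof (rule closure_mono)
    show "G m \<subseteq> D" using that G_iter_D[of _ m 0] by auto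
  qed
  then show ?case by (auto simp: r0)
next
  case (Suc j)
  have cont: "continuous_on (closure (G m)) (f ^^ Suc j)" if "Suc j \<le> m"
  proof -
    have "continuous_on (closure (G m)) (\<lambda>z. f ((f ^^ j) z))"
      by (rule continuous_on_compose2[OF cont_f]) (use Suc that in auto)
    then show ?thesis by (simp add: o_def)
  qed
  have "closed (closure D \<inter> {w. r (Suc j) \<le> norm w})"
    by (intro closed_Int closed_Collect_le continuous_intros) auto
  moreover have "(f ^^ Suc j) ` G m \<subseteq> closure D \<inter> {w. r (Suc j) \<le> norm w}" if "Suc j < m"
    using that closure_subset[of D] unfolding G_def by force
  ultimately have "(f ^^ Suc j) ` closure (G m) \<subseteq> closure D \<inter> {w. r (Suc j) \<le> norm w}" if "Suc j < m"
    using that by (intro image_closure_subset cont) (simp_all del: funpow.simps Int_subset_iff)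
  then show ?case using cont by blast
qed

text \<open>An orbit that leaves the region at a time \<open>k < n - 1\<close> would violate the growth condition at
  time \<open>k + 1\<close>.\<close>

lemma exit_bound:
  assumes z: "z \<in> closure (G n)" "z \<notin> G n" "z \<in> I"
  shows "norm ((f ^^ n) z) \<le> M (r (n - 1))"
proof -
  obtain k where k: "k < n" "\<not> ((f ^^ k) z \<in> D \<and> r k < norm ((f ^^ k) z))"
    using z by (auto simp: G_def)
  let ?y = "(f ^^ k) z"
  have y: "?y \<in> closure D" "r k \<le> norm ?y" using closure_G[of k n] z(1) k(1) by auto
  have le: "norm (f ?y) \<le> M (r k)"
  proof (cases "?y \<in> D")
    case True
    then have "norm ?y \<le> r k" using k y by auto
    then show ?thesis using norm_f_le_M y(1) by blast
  next
    case False
    then have "norm (f ?y) = R" using closure_cases[OF y(1)] norm_frontier by blast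
    then show ?thesis using R_le_M[OF r_nonneg] by simp
  qed
  show ?thesis
  proof (cases "Suc k < n")
    case True
    then have "r (Suc k) \<le> norm ((f ^^ Suc k) z)" using closure_G[of "Suc k" n] z(1) by blast
    then show ?thesis using le r_step[of k] by simp
  next
    case False
    then have "n = Suc k" using k by simp
    then show ?thesis using le by simp
  qed
qed

lemma compact_closure_G: "compact (closure (G n))"
proof -
  have "bounded (G n)" by (rule bounded_subset[OF bounded_I]) (auto simp: G_def)
  then show ?thesis by (simp add: compact_closure)
qed

lemma continuous_iter: "continuous_on (closure (G n)) (f ^^ n)"
  using closure_G[of n n] by simp

lemma closure_G_cases:
  assumes "z \<in> closure (G n)" "z \<notin> G n"
  shows "z \<in> K \<or> norm ((f ^^ n) z) \<le> M (r (n - 1))"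
proof (cases "z \<in> I")
  case False
  have "closure (G n) \<subseteq> closure I" by (intro closure_mono) (auto simp: G_def)
  then have "z \<in> frontier I" using False assms(1) open_I by (auto simp: frontier_def interior_open)
  then show ?thesis using frontier_I by blast
qed (use exit_bound assms in blast)

lemma z0_in_G: "z0 \<in> G n"
  using z0_in z0_orbit by (simp add: G_def)

text \<open>A maximum of |f^n| over the closure cannot lie in \<open>G n\<close>, whose image is
  open, nor, by its size, at an exit point; it is therefore on \<open>K\<close>.\<close>

lemma iterate_large_on_K: "\<exists>y\<in>K. norm ((f ^^ n) z0) \<le> norm ((f ^^ n) y)"
proof -
  have z0c: "z0 \<in> closure (G n)" using z0_in_G closure_subset by (rule rev_subsetD)
  have "continuous_on (closure (G n)) (\<lambda>z. norm ((f ^^ n) z))"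
    by (intro continuous_intros continuous_iter)
  then obtain y where y: "y \<in> closure (G n)" "\<And>x. x \<in> closure (G n) \<Longrightarrow> norm ((f ^^ n) x) \<le> norm ((f ^^ n) y)"
    using continuous_attains_sup[OF compact_closure_G, of "\<lambda>z. norm ((f ^^ n) z)"] z0c by (metis empty_iff)
  have le: "norm ((f ^^ n) z0) \<le> norm ((f ^^ n) y)" using y(2) z0c by blast
  have "y \<notin> G n"
  proof
    assume yG: "y \<in> G n"
    let ?w = "(f ^^ n) y"
    have "open ((f ^^ n) ` G n)" using open_iter_image[of "G n" n n] open_G by simp
    then obtain e where e: "e > 0" "ball ?w e \<subseteq> (f ^^ n) ` G n" using yG open_contains_ball by blast
    have w0: "norm ?w > 0" using le z0_end M_pos[of "r (n - 1)"] by linarith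
    define w' where "w' = ?w + of_real (e / 2 / norm ?w) * ?w"
    have "norm (w' - ?w) = e / 2" using w0 e by (simp add: w'_def norm_mult norm_divide)
    then have "w' \<in> ball ?w e" using e by (simp add: dist_norm norm_minus_commute)
    then obtain x where x: "x \<in> G n" "w' = (f ^^ n) x" using e by blast
    have "w' = of_real (1 + e / 2 / norm ?w) * ?w" by (simp add: w'_def algebra_simps)
    then have "norm w' = \<bar>1 + e / 2 / norm ?w\<bar> * norm ?w" by (simp only: norm_mult norm_of_real)
    moreover have "1 + e / 2 / norm ?w > 0" using e w0 by (simp add: add_pos_pos)
    ultimately have "norm w' = norm ?w + e / 2" using w0 by (simp add: field_simps)
    then show False using y(2)[of x] x e subsetD[OF closure_subset x(1)] by simp
  qed
  then have "y \<in> K" using closure_G_cases[OF y(1)] le z0_end by auto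
  then show ?thesis using le by blast
qed

text \<open>The annulus between \<mu> and \<open>S\<close> misses the frontier of \<open>Y\<close>,
  so it lies in \<open>Y\<close> or avoids it. In the first case \<open>Y\<close> and a disc
  together form a bounded open set with no frontier off f^n(K). In the second, |f^n| jumps over the
  annulus, the points of \<open>G n\<close> with large image are open and closed in
  \<open>I\<close>, and \<open>I\<close> would lie in \<open>D\<close>.\<close>

lemma image_surrounds_zero:
  assumes S: "\<And>y. y \<in> K \<Longrightarrow> S \<le> norm ((f ^^ n) y)" "M (r (n - 1)) < S"
  shows "bounded (connected_component_set (- (f ^^ n) ` K) 0)"
proof -
  define \<mu> where "\<mu> = M (r (n - 1))"
  have \<mu>: "\<mu> > 0" "\<mu> < S" using M_pos S by (auto simp: \<mu>_def)
  define Y where "Y = (f ^^ n) ` G n"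
  define A where "A = {w::complex. \<mu> < norm (w - 0) \<and> norm (w - 0) < S}"
  have oY: "open Y" unfolding Y_def using open_iter_image[of "G n" n n] open_G by simp
  have compY: "compact ((f ^^ n) ` closure (G n))"
    by (rule compact_continuous_image[OF continuous_iter compact_closure_G])
  have clY: "closure Y \<subseteq> (f ^^ n) ` closure (G n)"
    unfolding Y_def using compY compact_imp_closed closure_subset by (intro closure_minimal) auto
  have frY: "w \<in> (f ^^ n) ` K \<or> norm w \<le> \<mu>" if w: "w \<in> closure Y" "w \<notin> Y" for w
  proof -
    obtain z where "z \<in> closure (G n)" "w = (f ^^ n) z" "z \<notin> G n" using clY w by (auto simp: Y_def)
    then show ?thesis using closure_G_cases[of z] by (auto simp: \<mu>_def)
  qed
  have "A \<inter> frontier Y = {}"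
  proof -
    have "w \<notin> A" if "w \<in> frontier Y" for w
    proof -
      have "w \<in> closure Y" "w \<notin> Y" using that oY by (auto simp: frontier_def interior_open)
      from frY[OF this] show ?thesis using S(1) by (force simp: A_def)
    qed
    then show ?thesis by blast
  qed
  moreover have "connected A" unfolding A_def by (rule connected_annulus) simp
  moreover have "A \<inter> Y \<noteq> {}"
  proof
    assume AY: "A \<inter> Y = {}"
    define H where "H = G n \<inter> (f ^^ n) -` {w. \<mu> < norm w}"
    have "open {w::complex. \<mu> < norm w}" by (intro open_Collect_less continuous_intros)
    then have oH: "open H" unfolding H_def using open_G continuous_open_preimage by blast
    have "z0 \<in> H" using z0_in_G z0_end by (simp add: H_def \<mu>_def)
    have HS: "S \<le> norm ((f ^^ n) z)" if "z \<in> H" for z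
    proof -
      have "(f ^^ n) z \<in> Y" using that by (simp add: H_def Y_def)
      then have "(f ^^ n) z \<notin> A" using AY by blast
      then show ?thesis using that by (simp add: H_def A_def)
    qed
    have "H \<subseteq> G n" "H \<subseteq> I" by (auto simp: H_def G_def)
    have "I - H = {}"
    proof (rule ccontr)
      assume "I - H \<noteq> {}"
      moreover have "I \<inter> H \<noteq> {}" using \<open>z0 \<in> H\<close> \<open>H \<subseteq> I\<close> by blast
      ultimately have "I \<inter> frontier H \<noteq> {}" using connected_Int_frontier[OF connected_I] by blast
      then obtain z where z: "z \<in> I" "z \<in> closure H" "z \<notin> H" using oH by (auto simp: frontier_def interior_open)
      have clH: "closure H \<subseteq> closure (G n)" using \<open>H \<subseteq> G n\<close> by (rule closure_mono)
      have "(f ^^ n) ` closure H \<subseteq> {w. S \<le> norm w}"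
      proof (rule image_closure_subset)
        show "continuous_on (closure H) (f ^^ n)" using continuous_iter clH continuous_on_subset by blast
        show "closed {w::complex. S \<le> norm w}" by (intro closed_Collect_le continuous_intros)
      qed (use HS in auto)
      then have "S \<le> norm ((f ^^ n) z)" using z by blast
      then have "z \<in> G n" using exit_bound[of z] z clH \<mu> by (force simp: \<mu>_def)
      then show False using z(3) \<open>S \<le> _\<close> \<mu> by (simp add: H_def)
    qed
    moreover have "H \<subseteq> D" using n_pos by (auto simp: H_def G_def dest: spec[of _ 0])
    ultimately show False using not_sub by blast
  qed
  ultimately have "A - Y = {}" using connected_Int_frontier[of A Y] by blast
  define s where "s = (\<mu> + S) / 2"
  have s: "\<mu> < s" "s < S" using \<mu> by (auto simp: s_def)
  define Y' where "Y' = Y \<union> ball 0 s"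
  define Q where "Q = connected_component_set (- (f ^^ n) ` K) 0"
  have "bounded Y'"
    unfolding Y'_def Y_def using compact_imp_bounded[OF compY] closure_subset
    by (meson bounded_Un bounded_ball bounded_subset image_mono)
  have "open Y'" unfolding Y'_def using oY by (intro open_Un open_ball)
  have "0 \<notin> (f ^^ n) ` K" using S \<mu> by force
  then have "0 \<in> Q" by (simp add: Q_def)
  have "0 \<in> Y'" using s \<mu> by (simp add: Y'_def)
  have QK: "Q \<subseteq> - (f ^^ n) ` K" unfolding Q_def by (rule connected_component_subset)
  have "Q \<inter> frontier Y' = {}"
  proof -
    have False if w: "w \<in> Q" "w \<in> frontier Y'" for w
    proof -
      have w': "w \<in> closure Y'" "w \<notin> Y'" using w \<open>open Y'\<close> by (auto simp: frontier_def interior_open)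
      have "w \<notin> A" using w'(2) \<open>A - Y = {}\<close> by (auto simp: Y'_def)
      have "norm w \<ge> s" using w'(2) by (simp add: Y'_def)
      then have "norm w \<ge> S" using \<open>w \<notin> A\<close> s by (auto simp: A_def)
      then have "w \<notin> closure (ball 0 s)" using s \<mu> by simp
      then have "w \<in> closure Y" "w \<notin> Y" using w' by (auto simp: Y'_def closure_Un)
      from frY[OF this] show False using w(1) QK \<open>norm w \<ge> S\<close> \<mu> by auto
    qed
    then show ?thesis by blast
  qed
  then have "Q - Y' = {}"
    using connected_Int_frontier[of Q Y'] \<open>0 \<in> Q\<close> \<open>0 \<in> Y'\<close> connected_connected_component
    unfolding Q_def by blast
  then show ?thesis using \<open>bounded Y'\<close> bounded_subset unfolding Q_def by blast
qed

end

text \<open>The case n = 1. The condition \<open>M 0 < M s\<close> makes the maximum point of the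
  disc lie in \<open>D\<close> and differ from 0; for \<open>r\<close>, any sequence from 0 that
  outgrows \<open>M\<close> will do.\<close>

lemma (in tract) modulus_large_on_boundary:
  assumes I: "open I" "connected I" "bounded I" "frontier I \<subseteq> K" "\<not> I \<subseteq> D"
    and s: "cball 0 s \<subseteq> I" "s \<ge> 0" "M 0 < M s"
  shows "\<exists>y\<in>K. M s \<le> norm (f y)"
proof -
  define r where "r = rec_nat (0::real) (\<lambda>_ x. M x + 1)"
  have r: "r 0 = 0" "\<And>k. r (Suc k) = M (r k) + 1" by (auto simp: r_def)
  obtain z where z: "norm z \<le> s" "v z = B s" using B_attained[OF s(2)] by blast
  have "B 0 < B s" using s(3) R_pos by (simp add: M_def)
  moreover have "B 0 \<ge> 0" by simp
  ultimately have pos: "v z > 0" using z by linarith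
  then have zD: "z \<in> D" by (simp add: v_pos_iff)
  have fz: "norm (f z) = M s" using norm_f_in[OF zD] z by (simp add: M_def)
  have "z \<noteq> 0" using s(3) fz norm_f_le_M[of z 0] zD closure_subset[of D] by (force simp: subset_iff)
  interpret surrounding_tract f D R I K r 1 z
    using I s z zD fz r \<open>z \<noteq> 0\<close> by unfold_locales auto
  show ?thesis using iterate_large_on_K fz by simp
qed

section \<open>Escaping normal sequences\<close>

text \<open>Locally uniform convergence to infinity of the whole sequence: the second alternative of
  \<open>normal_seq_on\<close> without passing to a subsequence.\<close>

definition escapes :: "(nat \<Rightarrow> complex \<Rightarrow> complex) \<Rightarrow> complex set \<Rightarrow> bool" where
  "escapes F U \<longleftrightarrow> (\<forall>K B. compact K \<and> K \<subseteq> U \<longrightarrow>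
      eventually (\<lambda>n. \<forall>z\<in>K. B \<le> norm (F n z)) sequentially)"

lemma escapesD:
  "escapes F U \<Longrightarrow> compact K \<Longrightarrow> K \<subseteq> U \<Longrightarrow> eventually (\<lambda>n. \<forall>z\<in>K. B \<le> norm (F n z)) sequentially"
  by (simp add: escapes_def)

lemma normal_seq_onE:
  fixes m :: "nat \<Rightarrow> nat"
  assumes "normal_seq_on F V"
  obtains (finite) r g where "strict_mono (r :: nat \<Rightarrow> nat)"
      "\<And>K. compact K \<Longrightarrow> K \<subseteq> V \<Longrightarrow> uniform_limit K (\<lambda>k. F (m (r k))) g sequentially"
    | (infinite) r where "strict_mono (r :: nat \<Rightarrow> nat)"
      "\<And>K B. compact K \<Longrightarrow> K \<subseteq> V \<Longrightarrow> eventually (\<lambda>k. \<forall>z\<in>K. B \<le> norm (F (m (r k)) z)) sequentially"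
proof -
  obtain r :: "nat \<Rightarrow> nat" where r: "strict_mono r" and
    "(\<exists>g. \<forall>K. compact K \<and> K \<subseteq> V \<longrightarrow> uniform_limit K (\<lambda>k. F (m (r k))) g sequentially)
         \<or> (\<forall>K. compact K \<and> K \<subseteq> V \<longrightarrow>
              (\<forall>B. eventually (\<lambda>k. \<forall>z\<in>K. B \<le> norm (F (m (r k)) z)) sequentially))"
    using assms[unfolded normal_seq_on_def, rule_format, of m] by (elim exE conjE)
  from this(2) show ?thesis
  proof
    assume "\<exists>g. \<forall>K. compact K \<and> K \<subseteq> V \<longrightarrow> uniform_limit K (\<lambda>k. F (m (r k))) g sequentially"
    then obtain g where "\<And>K. compact K \<Longrightarrow> K \<subseteq> V \<Longrightarrow> uniform_limit K (\<lambda>k. F (m (r k))) g sequentially"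
      by auto
    then show ?thesis by (rule that(1)[OF r])
  next
    assume "\<forall>K. compact K \<and> K \<subseteq> V \<longrightarrow>
              (\<forall>B. eventually (\<lambda>k. \<forall>z\<in>K. B \<le> norm (F (m (r k)) z)) sequentially)"
    then show ?thesis by (intro that(2)[OF r]) auto
  qed
qed

lemma normal_seq_onI:
  assumes "\<And>m :: nat \<Rightarrow> nat. \<exists>r. strict_mono r \<and>
        ((\<exists>g. \<forall>K. compact K \<longrightarrow> K \<subseteq> V \<longrightarrow> uniform_limit K (\<lambda>k. F (m (r k))) g sequentially)
         \<or> (\<forall>K B. compact K \<longrightarrow> K \<subseteq> V \<longrightarrow>
              eventually (\<lambda>k. \<forall>z\<in>K. B \<le> norm (F (m (r k)) z)) sequentially))"
  shows "normal_seq_on F V"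
  unfolding normal_seq_on_def
proof
  fix m :: "nat \<Rightarrow> nat"
  show "\<exists>r. strict_mono r \<and>
        ((\<exists>g. \<forall>K. compact K \<and> K \<subseteq> V \<longrightarrow> uniform_limit K (\<lambda>k. F (m (r k))) g sequentially)
         \<or> (\<forall>K. compact K \<and> K \<subseteq> V \<longrightarrow>
              (\<forall>B. eventually (\<lambda>k. \<forall>z\<in>K. B \<le> norm (F (m (r k)) z)) sequentially)))"
    using assms[of m] by (simp add: imp_conjL)
qed

lemma eventually_on_compact:
  assumes "compact K"
    and "\<And>z. z \<in> K \<Longrightarrow> \<exists>e>0. eventually (\<lambda>k. \<forall>w\<in>ball z e. P k w) F"
  shows "eventually (\<lambda>k. \<forall>w\<in>K. P k w) F"
proof -
  obtain e where e: "\<And>z. z \<in> K \<Longrightarrow> e z > 0"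
    "\<And>z. z \<in> K \<Longrightarrow> eventually (\<lambda>k. \<forall>w\<in>ball z (e z). P k w) F"
    using assms(2) by metis
  have "K \<subseteq> (\<Union>z\<in>K. ball z (e z))" using e(1) by force
  then obtain T where T: "T \<subseteq> K" "finite T" "K \<subseteq> (\<Union>z\<in>T. ball z (e z))"
    using compactE_image[OF assms(1), of K "\<lambda>z. ball z (e z)"] by auto
  have "eventually (\<lambda>k. \<forall>z\<in>T. \<forall>w\<in>ball z (e z). P k w) F"
    using T e(2) by (intro eventually_ball_finite) auto
  then show ?thesis
    by (rule eventually_mono) (use T(3) in blast)
qed

text \<open>Take a subsequence that stays small somewhere on \<open>K\<close>. Its maximum points on
  \<open>K0\<close> accumulate at some \<open>l\<close>, where a finite limit is impossible, so a
  further subsequence tends to infinity near \<open>l\<close>. Normality leaves two alternatives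
  near each point, hence the set \<open>Q\<close> where this happens is open and closed in
  \<open>U\<close>.\<close>

lemma normal_escapes:
  assumes U: "open U" "connected U"
    and N: "\<And>z. z \<in> U \<Longrightarrow> \<exists>V. open V \<and> z \<in> V \<and> normal_seq_on F V"
    and cont: "\<And>n. continuous_on U (F n)"
    and K0: "compact K0" "K0 \<subseteq> U"
    and big: "\<And>B. eventually (\<lambda>n. \<exists>z\<in>K0. B \<le> norm (F n z)) sequentially"
  shows "escapes F U"
  unfolding escapes_def
proof (intro allI impI, rule ccontr)
  fix K B assume K: "compact K \<and> K \<subseteq> U"
    and "\<not> eventually (\<lambda>n. \<forall>z\<in>K. B \<le> norm (F n z)) sequentially"
  then obtain m :: "nat \<Rightarrow> nat" where m: "strict_mono m" "\<And>k. \<not> (\<forall>z\<in>K. B \<le> norm (F (m k) z))"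
    using not_eventually_sequentiallyD by blast
  have "K0 \<noteq> {}" using eventually_happens[OF big[of 0]] by auto
  have "\<exists>y\<in>K0. \<forall>z\<in>K0. norm (F n z) \<le> norm (F n y)" for n
    by (rule continuous_attains_sup[OF K0(1) \<open>K0 \<noteq> {}\<close>])
       (intro continuous_intros continuous_on_subset[OF cont K0(2)])
  then obtain y where y: "\<And>n. y n \<in> K0" "\<And>n z. z \<in> K0 \<Longrightarrow> norm (F n z) \<le> norm (F n (y n))" by metis
  have ybig: "eventually (\<lambda>n. C \<le> norm (F n (y n))) sequentially" for C
    using big[of C] by (rule eventually_mono) (use y(2) order_trans in blast)
  have "seq_compact K0" using K0(1) by (simp add: compact_eq_seq_compact_metric)
  then obtain l s where l: "l \<in> K0" "strict_mono s" "((\<lambda>k. y (m k)) \<circ> s) \<longlonglongrightarrow> l"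
    using seq_compactE[of K0 "\<lambda>k. y (m k)"] y(1) by blast
  obtain V where V: "open V" "l \<in> V" "normal_seq_on F V" using N l(1) K0(2) by blast
  have "open (V \<inter> U)" "l \<in> V \<inter> U" using V U(1) l(1) K0(2) by auto
  then obtain e where e: "e > 0" "cball l e \<subseteq> V" "cball l e \<subseteq> U"
    by (meson open_contains_cball le_inf_iff)
  have "\<exists>r::nat \<Rightarrow> nat. strict_mono r \<and> (\<forall>K B. compact K \<longrightarrow> K \<subseteq> V \<longrightarrow>
      eventually (\<lambda>k. \<forall>z\<in>K. B \<le> norm (F (m (s (r k))) z)) sequentially)"
    using V(3)
  proof (cases rule: normal_seq_onE[where m = "\<lambda>k. m (s k)"])
    case (finite r g)
    have "uniform_limit (cball l e) (\<lambda>k. F (m (s (r k)))) g sequentially" using finite e by simp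
    from uniform_limitD[OF this zero_less_one]
    have ev1: "eventually (\<lambda>k. \<forall>x\<in>cball l e. dist (F (m (s (r k))) x) (g x) < 1) sequentially" .
    \<comment> \<open>The limit \<open>g\<close> is not known to be bounded; one member of the
      sequence, continuous on the closed disc, bounds the later ones instead.\<close>
    then obtain k0 where k0: "\<forall>x\<in>cball l e. dist (F (m (s (r k0))) x) (g x) < 1"
      by (auto simp: eventually_sequentially)
    have "compact (F (m (s (r k0))) ` cball l e)"
      using e(3) by (intro compact_continuous_image continuous_on_subset[OF cont]) auto
    then have "bounded (F (m (s (r k0))) ` cball l e)" by (rule compact_imp_bounded)
    then obtain C where C: "\<And>x. x \<in> cball l e \<Longrightarrow> norm (F (m (s (r k0))) x) \<le> C"
      unfolding bounded_iff by (meson imageI)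
    have sub: "strict_mono (\<lambda>k. m (s (r k)))" using m(1) l(2) finite(1) by (simp add: strict_mono_def)
    have "(\<lambda>k. y (m (s (r k)))) \<longlonglongrightarrow> l"
      using LIMSEQ_subseq_LIMSEQ[OF l(3) finite(1)] by (simp add: o_def)
    then have "eventually (\<lambda>k. dist (y (m (s (r k)))) l < e) sequentially" using e(1) tendstoD by blast
    moreover have "eventually (\<lambda>k. C + 2 \<le> norm (F (m (s (r k))) (y (m (s (r k)))))) sequentially"
      by (rule eventually_subseq[OF sub ybig])
    ultimately have "eventually (\<lambda>k::nat. False) sequentially"
      using ev1
    proof eventually_elim
      case (elim k)
      let ?x = "y (m (s (r k)))"
      have x: "?x \<in> cball l e" using elim(1) by (simp add: dist_commute)
      have "dist (F (m (s (r k))) ?x) (F (m (s (r k0))) ?x) < 2"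
        using elim(3) k0 x dist_triangle2[of "F (m (s (r k))) ?x" "F (m (s (r k0))) ?x" "g ?x"] by force
      then have "norm (F (m (s (r k))) ?x) < 2 + norm (F (m (s (r k0))) ?x)"
        using norm_triangle_ineq2[of "F (m (s (r k))) ?x" "F (m (s (r k0))) ?x"] by (simp add: dist_norm)
      then show False using C[OF x] elim(2) by linarith
    qed
    then show ?thesis by simp
  qed blast
  then obtain r :: "nat \<Rightarrow> nat" where r: "strict_mono r"
    "\<And>K B. compact K \<Longrightarrow> K \<subseteq> V \<Longrightarrow> eventually (\<lambda>k. \<forall>z\<in>K. B \<le> norm (F (m (s (r k))) z)) sequentially"
    by blast
  define n where "n = (\<lambda>k. m (s (r k)))"
  define Q where "Q = {z \<in> U. \<exists>V. open V \<and> z \<in> V \<and> (\<forall>K B. compact K \<longrightarrow> K \<subseteq> V \<longrightarrow>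
      eventually (\<lambda>k. \<forall>z\<in>K. B \<le> norm (F (n k) z)) sequentially)}"
  have QI: "z \<in> Q" if "z \<in> U" "z \<in> V" "open V"
     "\<And>K B. compact K \<Longrightarrow> K \<subseteq> V \<Longrightarrow> eventually (\<lambda>k. \<forall>z\<in>K. B \<le> norm (F (n k) z)) sequentially" for z V
    using that unfolding Q_def by blast
  have "l \<in> Q" using QI[of l V] V r(2) l(1) K0(2) by (auto simp: n_def)
  have openQ: "open Q"
    unfolding open_contains_ball
  proof
    fix z assume "z \<in> Q"
    then obtain V where V: "z \<in> U" "open V" "z \<in> V" "\<And>K B. compact K \<Longrightarrow> K \<subseteq> V \<Longrightarrow>
      eventually (\<lambda>k. \<forall>z\<in>K. B \<le> norm (F (n k) z)) sequentially" by (auto simp: Q_def)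
    have "V \<inter> U \<subseteq> Q" using QI V by blast
    moreover have "open (V \<inter> U)" "z \<in> V \<inter> U" using V U(1) by auto
    ultimately show "\<exists>e>0. ball z e \<subseteq> Q" by (meson open_contains_ball subset_trans)
  qed
  have "U - Q = {}"
  proof (rule ccontr)
    assume "U - Q \<noteq> {}"
    moreover have "U \<inter> Q \<noteq> {}" using \<open>l \<in> Q\<close> by (auto simp: Q_def)
    ultimately obtain z where z: "z \<in> U" "z \<in> frontier Q"
      using connected_Int_frontier[OF U(2)] by blast
    then have zQ: "z \<in> closure Q" "z \<notin> Q" using openQ by (auto simp: frontier_def interior_open)
    obtain V where V: "open V" "z \<in> V" "normal_seq_on F V" using N z(1) by blast
    have "V \<inter> closure Q \<noteq> {}" using V zQ by blast
    then obtain p where p: "p \<in> V" "p \<in> Q" using open_Int_closure_eq_empty[OF V(1)] by blast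
    have pbig: "eventually (\<lambda>k. C \<le> norm (F (n k) p)) sequentially" for C
    proof -
      obtain V' where "p \<in> V'" "\<And>K B. compact K \<Longrightarrow> K \<subseteq> V' \<Longrightarrow>
        eventually (\<lambda>k. \<forall>z\<in>K. B \<le> norm (F (n k) z)) sequentially"
        using p(2) by (auto simp: Q_def)
      from this(2)[of "{p}" C] this(1) show ?thesis by simp
    qed
    have "z \<in> Q"
    proof (rule QI[OF z(1) V(2,1)], rule ccontr)
      fix K1 B1 assume K1: "compact K1" "K1 \<subseteq> V"
        "\<not> eventually (\<lambda>k. \<forall>z\<in>K1. B1 \<le> norm (F (n k) z)) sequentially"
      then obtain t :: "nat \<Rightarrow> nat" where t: "strict_mono t" "\<And>k. \<not> (\<forall>z\<in>K1. B1 \<le> norm (F (n (t k)) z))"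
        using not_eventually_sequentiallyD by blast
      from V(3) show False
      proof (cases rule: normal_seq_onE[where m = "\<lambda>k. n (t k)"])
        case (finite r' g)
        have "uniform_limit {p} (\<lambda>k. F (n (t (r' k)))) g sequentially" using finite(2)[of "{p}"] p(1) by simp
        from uniform_limitD[OF this zero_less_one]
        have "eventually (\<lambda>k. dist (F (n (t (r' k))) p) (g p) < 1) sequentially" by simp
        moreover have "eventually (\<lambda>k. norm (g p) + 1 \<le> norm (F (n (t (r' k))) p)) sequentially"
        proof -
          have "strict_mono (\<lambda>k. t (r' k))" using t(1) finite(1) by (simp add: strict_mono_def)
          then show ?thesis by (rule eventually_subseq[OF _ pbig])
        qed
        ultimately have "eventually (\<lambda>k::nat. False) sequentially"
        proof eventually_elim
          case (elim k)
          then show False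
            using norm_triangle_ineq2[of "F (n (t (r' k))) p" "g p"] by (simp add: dist_norm)
        qed
        then show False by simp
      next
        case (infinite r')
        from infinite(2)[OF K1(1,2), of B1] show False
          using t(2) by (auto simp: eventually_sequentially)
      qed
    qed
    then show False using zQ by simp
  qed
  then have "K \<subseteq> Q" using K by blast
  have "eventually (\<lambda>k. \<forall>w\<in>K. B \<le> norm (F (n k) w)) sequentially"
  proof (rule eventually_on_compact)
    show "compact K" using K by simp
    fix z assume "z \<in> K"
    then obtain V where V: "open V" "z \<in> V" "\<And>K B. compact K \<Longrightarrow> K \<subseteq> V \<Longrightarrow>
      eventually (\<lambda>k. \<forall>z\<in>K. B \<le> norm (F (n k) z)) sequentially" using \<open>K \<subseteq> Q\<close> by (auto simp: Q_def)
    obtain e where e: "e > 0" "cball z e \<subseteq> V" using V(1,2) by (meson open_contains_cball)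
    have "eventually (\<lambda>k. \<forall>w\<in>cball z e. B \<le> norm (F (n k) w)) sequentially" using V(3) e by simp
    then have "eventually (\<lambda>k. \<forall>w\<in>ball z e. B \<le> norm (F (n k) w)) sequentially"
      by (rule eventually_mono) auto
    then show "\<exists>e>0. eventually (\<lambda>k. \<forall>w\<in>ball z e. B \<le> norm (F (n k) w)) sequentially" using e by blast
  qed
  then show False using m(2) by (auto simp: eventually_sequentially n_def)
qed

text \<open>Harnack chains, organised as an open and closed set \<open>A\<close>. Each new disc
  multiplies the constant by 9: from a point to the centre, and from there to a known point.
  Positivity of the logarithms is carried along so that constants may be enlarged.\<close>

lemma escapes_harnack:
  assumes U: "open U" "connected U" and hol: "\<And>n. F n holomorphic_on U"
    and esc: "escapes F U" and K: "compact K" "K \<subseteq> U"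
  shows "\<exists>C>0. eventually (\<lambda>n. \<forall>z\<in>K. \<forall>w\<in>K. ln (norm (F n z)) \<le> C * ln (norm (F n w))) sequentially"
proof (cases "K = {}")
  case True
  then show ?thesis by (intro exI[of _ 1]) auto
next
  case False
  then obtain z0 where z0: "z0 \<in> U" using K by blast
  define h where "h = (\<lambda>n z. ln (norm (F n z)))"
  define P where "P = (\<lambda>C n z w. 0 < h n w \<and> h n w \<le> C * h n z \<and> h n z \<le> C * h n w)"
  have loc: "\<exists>e>0. ball z e \<subseteq> U \<and> eventually (\<lambda>n. \<forall>w\<in>ball z e. P 3 n z w) sequentially"
    if zU: "z \<in> U" for z
  proof -
    obtain e where e: "e > 0" "cball z e \<subseteq> U" using U(1) zU by (meson open_contains_cball)
    have sub: "ball z e \<subseteq> U" using e by (meson ball_subset_cball subset_trans)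
    have "eventually (\<lambda>n. \<forall>w\<in>cball z e. 2 \<le> norm (F n w)) sequentially"
      using escapesD[OF esc compact_cball e(2)] .
    then have "eventually (\<lambda>n. \<forall>w\<in>ball z (e/2). P 3 n z w) sequentially"
    proof eventually_elim
      case (elim n)
      show ?case
      proof
        fix w assume w: "w \<in> ball z (e / 2)"
        have gt: "norm (F n x) > 1" if "x \<in> ball z e" for x
        proof -
          have "x \<in> cball z e" using that by simp
          then have "2 \<le> norm (F n x)" using elim by blast
          then show ?thesis by simp
        qed
        have holn: "F n holomorphic_on ball z e" using hol sub holomorphic_on_subset by blast
        have d: "dist z w \<le> e / 2" using w by simp
        have "h n w \<le> 3 * h n z" "h n z \<le> 3 * h n w"
          unfolding h_def using harnack_log_modulus[OF holn gt d e(1)] by simp_all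
        moreover have "w \<in> ball z e" using w e by simp
        then have "0 < h n w" unfolding h_def using gt ln_gt_zero by blast
        ultimately show "P 3 n z w" by (simp add: P_def)
      qed
    qed
    moreover have "ball z (e / 2) \<subseteq> U" using sub e subset_ball[of "e / 2" e z] by simp
    ultimately show ?thesis using e(1) by (intro exI[of _ "e / 2"]) auto
  qed
  define A where "A = {z \<in> U. \<exists>e>0. \<exists>C>0. eventually (\<lambda>n. \<forall>w\<in>ball z e. P C n z0 w) sequentially}"
  have "z0 \<in> A"
  proof -
    obtain e where e: "e > 0" "eventually (\<lambda>n. \<forall>w\<in>ball z0 e. P 3 n z0 w) sequentially"
      using loc[OF z0] by blast
    from e(2) have "\<exists>C>0. eventually (\<lambda>n. \<forall>w\<in>ball z0 e. P C n z0 w) sequentially"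
      by (intro exI[of _ 3]) simp
    then show ?thesis using z0 e(1) unfolding A_def by blast
  qed
  have ballA: "ball z e \<subseteq> A" if "e > 0" "C > 0" "ball z e \<subseteq> U" "eventually (\<lambda>n. \<forall>w\<in>ball z e. P C n z0 w) sequentially"
    for z e C
  proof
    fix x assume x: "x \<in> ball z e"
    then obtain d where d: "d > 0" "ball x d \<subseteq> ball z e" using open_contains_ball open_ball by blast
    have "eventually (\<lambda>n. \<forall>w\<in>ball x d. P C n z0 w) sequentially"
      using that(4) by (rule eventually_mono) (use d in blast)
    then show "x \<in> A" using x that d unfolding A_def by blast
  qed
  have "open A"
    unfolding open_contains_ball
  proof
    fix z assume "z \<in> A"
    then obtain e C where zU: "z \<in> U" and eC: "e > 0" "C > 0" "eventually (\<lambda>n. \<forall>w\<in>ball z e. P C n z0 w) sequentially"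
      unfolding A_def by blast
    obtain d where d: "d > 0" "ball z d \<subseteq> U" using U(1) zU open_contains_ball by blast
    have "eventually (\<lambda>n. \<forall>w\<in>ball z (min d e). P C n z0 w) sequentially"
      using eC(3) by (rule eventually_mono) auto
    moreover have "ball z (min d e) \<subseteq> U" using d by auto
    ultimately have "ball z (min d e) \<subseteq> A" using ballA[of "min d e" C z] eC d by auto
    then show "\<exists>e>0. ball z e \<subseteq> A" using eC d by (intro exI[of _ "min d e"]) auto
  qed
  have "U - A = {}"
  proof (rule ccontr)
    assume "U - A \<noteq> {}"
    moreover have "U \<inter> A \<noteq> {}" using \<open>z0 \<in> A\<close> z0 by blast
    ultimately obtain z where z: "z \<in> U" "z \<in> frontier A" using connected_Int_frontier[OF U(2)] by blast
    then have zA: "z \<in> closure A" "z \<notin> A" using \<open>open A\<close> by (auto simp: frontier_def interior_open)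
    obtain e where e: "e > 0" "ball z e \<subseteq> U"
      "eventually (\<lambda>n. \<forall>w\<in>ball z e. P 3 n z w) sequentially"
      using loc[OF z(1)] by blast
    have "ball z e \<inter> closure A \<noteq> {}" using zA e by force
    then obtain a where a: "a \<in> ball z e" "a \<in> A" using open_Int_closure_eq_empty[OF open_ball] by blast
    then obtain C d where C: "C > 0" "d > 0" "eventually (\<lambda>n. \<forall>w\<in>ball a d. P C n z0 w) sequentially"
      unfolding A_def by blast
    have "eventually (\<lambda>n. \<forall>w\<in>ball z e. P (9 * C) n z0 w) sequentially"
      using e(3) C(3)
    proof eventually_elim
      case (elim n)
      have ra: "P C n z0 a" using elim(2) C(2) by simp
      have za: "h n a \<le> 3 * h n z" "h n z \<le> 3 * h n a" using elim(1) a(1) by (auto simp: P_def)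
      show ?case
      proof
        fix w assume "w \<in> ball z e"
        then have w: "0 < h n w" "h n w \<le> 3 * h n z" "h n z \<le> 3 * h n w" using elim(1) by (auto simp: P_def)
        have "h n w \<le> 9 * h n a" "h n a \<le> 9 * h n w" using w za by auto
        moreover have "9 * h n a \<le> 9 * (C * h n z0)" "h n z0 \<le> C * h n a" using ra by (auto simp: P_def)
        moreover have "C * h n a \<le> C * (9 * h n w)" using \<open>h n a \<le> 9 * h n w\<close> C(1) by (intro mult_left_mono) auto
        ultimately show "P (9 * C) n z0 w" using w(1) by (simp add: P_def)
      qed
    qed
    then have "ball z e \<subseteq> A" using ballA[of e "9 * C" z] e C(1) by simp
    then show False using zA(2) e(1) by (metis centre_in_ball subsetD)
  qed
  then have KA: "K \<subseteq> A" using K by blast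
  then have "\<forall>z\<in>K. \<exists>e C. e > 0 \<and> C > 0 \<and> eventually (\<lambda>n. \<forall>w\<in>ball z e. P C n z0 w) sequentially"
    unfolding A_def by blast
  then obtain e C where eC: "\<And>z. z \<in> K \<Longrightarrow> e z > 0" "\<And>z. z \<in> K \<Longrightarrow> C z > (0::real)"
    "\<And>z. z \<in> K \<Longrightarrow> eventually (\<lambda>n. \<forall>w\<in>ball z (e z). P (C z) n z0 w) sequentially"
    by metis
  have "K \<subseteq> (\<Union>z\<in>K. ball z (e z))" using eC(1) by force
  then obtain T where T: "T \<subseteq> K" "finite T" "K \<subseteq> (\<Union>z\<in>T. ball z (e z))"
    using compactE_image[OF K(1), of K "\<lambda>z. ball z (e z)"] by auto
  define C' where "C' = sum C T + 1"
  have C': "C z \<le> C'" if "z \<in> T" for z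
    using member_le_sum[OF that _ T(2), of C] eC(2) T(1) by (force simp: C'_def)
  have "sum C T \<ge> 0" using eC(2) T(1) by (meson less_imp_le subsetD sum_nonneg)
  then have "C' > 0" by (simp add: C'_def)
  have "eventually (\<lambda>n. \<forall>z\<in>T. \<forall>w\<in>ball z (e z). P (C z) n z0 w) sequentially"
    using T eC(3) by (intro eventually_ball_finite) auto
  moreover have "eventually (\<lambda>n. 0 < h n z0) sequentially"
    using loc[OF z0] unfolding P_def by (auto elim!: eventually_mono)
  ultimately have "eventually (\<lambda>n. \<forall>z\<in>K. \<forall>w\<in>K. h n z \<le> (C' * C') * h n w) sequentially"
  proof eventually_elim
    case (elim n)
    have rel: "h n w \<le> C' * h n z0 \<and> h n z0 \<le> C' * h n w" if wK: "w \<in> K" for w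
    proof -
      obtain z where z: "z \<in> T" "w \<in> ball z (e z)" using T(3) wK by blast
      then have r: "P (C z) n z0 w" using elim(1) by blast
      have "C z * h n z0 \<le> C' * h n z0" "C z * h n w \<le> C' * h n w"
        using C'[OF z(1)] r elim(2) by (auto simp: P_def intro!: mult_right_mono)
      then show ?thesis using r unfolding P_def by (meson order_trans)
    qed
    show ?case
    proof (intro ballI)
      fix z w assume "z \<in> K" "w \<in> K"
      then have "h n z \<le> C' * h n z0" "C' * h n z0 \<le> C' * (C' * h n w)"
        using rel \<open>C' > 0\<close> by (auto intro!: mult_left_mono)
      then show "h n z \<le> (C' * C') * h n w" by (simp add: mult.assoc)
    qed
  qed
  then show ?thesis unfolding h_def using \<open>C' > 0\<close> by (intro exI[of _ "C' * C'"]) auto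
qed

section \<open>Fatou components surrounding a large disc\<close>

lemma frontier_component_complement:
  fixes K :: "complex set"
  assumes "closed K"
  shows "frontier (connected_component_set (- K) x) \<subseteq> K"
proof -
  have "frontier (connected_component_set (- K) x) \<subseteq> frontier (- K)"
    by (rule frontier_of_connected_component_subset)
  also have "\<dots> \<subseteq> K" using frontier_subset_closed[OF assms] by (simp add: frontier_complement)
  finally show ?thesis .
qed

lemma open_component_complement:
  fixes K :: "complex set"
  assumes "closed K"
  shows "open (connected_component_set (- K) x)"
  using assms by (intro open_connected_component) auto

lemma subset_component_complement:
  assumes "connected X" "X \<inter> K = {}" "X \<inter> connected_component_set (- K) x \<noteq> {}"
  shows "X \<subseteq> connected_component_set (- K) x"
proof -
  obtain y where y: "y \<in> X" "y \<in> connected_component_set (- K) x" using assms(3) by blast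
  have "X \<subseteq> connected_component_set (- K) y"
    using assms y by (intro connected_component_maximal) auto
  then show ?thesis using connected_component_eq[OF y(2)] by simp
qed

text \<open>If \<open>K\<close> met the open disc it would lie in it, since the sphere misses
  \<open>K\<close>; then the sphere would be joined to infinity, against its lying inside
  \<open>K\<close>.\<close>

lemma cball_in_inside:
  fixes K :: "complex set"
  assumes K: "connected K" "compact K" and r: "r > 0" and sub: "sphere 0 r \<subseteq> inside K"
  shows "cball 0 r \<subseteq> connected_component_set (- K) 0" "bounded (connected_component_set (- K) 0)"
proof -
  have sph: "sphere 0 r \<inter> K = {}" using sub inside_no_overlap by blast
  have x: "of_real r \<in> sphere (0::complex) r" using r by simp
  have "ball 0 r \<inter> K = {}"
  proof (rule ccontr)
    assume ne: "ball 0 r \<inter> K \<noteq> {}"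
    have "K - ball 0 r = {}"
      using connected_Int_frontier[OF K(1), of "ball 0 r"] ne sph r by (auto simp: Int_commute)
    then have "- ball 0 r \<subseteq> - K" by blast
    moreover have "connected (- ball (0::complex) r)"
      by (rule connected_complement_bounded_convex) auto
    ultimately have "- ball 0 r \<subseteq> connected_component_set (- K) (of_real r)"
      using r by (intro connected_component_maximal) auto
    moreover have "bounded (connected_component_set (- K) (of_real r))"
      using subsetD[OF sub x] by (simp add: inside_def)
    ultimately have "bounded (- ball (0::complex) r)" by (rule bounded_subset[rotated])
    then have "bounded (- ball 0 r \<union> ball (0::complex) r)" by (intro bounded_Un[THEN iffD2] conjI) auto
    then show False using not_bounded_UNIV by (simp add: Un_commute)
  qed
  then have "cball 0 r \<inter> K = {}" using sph by (force simp: disjoint_iff less_le)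
  then show c: "cball 0 r \<subseteq> connected_component_set (- K) 0"
    using r by (intro connected_component_maximal) auto
  then have "of_real r \<in> connected_component_set (- K) 0" using r by force
  then have "connected_component_set (- K) 0 = connected_component_set (- K) (of_real r)"
    by (rule connected_component_eq[symmetric])
  then show "bounded (connected_component_set (- K) 0)" using subsetD[OF sub x] by (simp add: inside_def)
qed

section \<open>Iteration on the Fatou set\<close>

locale meromorphic_tract = tract +
  assumes nicely: "f nicely_meromorphic_on UNIV"
begin

lemma nonconstant_on_open:
  assumes "open V" "V \<noteq> {}"
  shows "\<not> f constant_on V"
proof
  assume "f constant_on V"
  then have "f constant_on UNIV"
    using constant_on_extend_nicely_meromorphic_on[OF nicely, of V] assms by auto
  then show False using f_nonconst by (meson constant_on_subset subset_UNIV)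
qed

lemma fatouE:
  assumes "z \<in> fatou f"
  obtains V where "open V" "z \<in> V" "\<forall>n. \<forall>w\<in>V. (f ^^ n) w \<notin> poles f" "normal_seq_on (\<lambda>n. f ^^ n) V"
    "V \<subseteq> fatou f"
proof -
  obtain V where V: "open V" "z \<in> V" "\<forall>n. \<forall>w\<in>V. (f ^^ n) w \<notin> poles f" "normal_seq_on (\<lambda>n. f ^^ n) V"
    using assms unfolding fatou_def by blast
  moreover have "V \<subseteq> fatou f" using V unfolding fatou_def by blast
  ultimately show ?thesis by (rule that)
qed

lemma open_fatou: "open (fatou f)"
proof (subst open_subopen, intro ballI)
  fix z assume z: "z \<in> fatou f"
  obtain V where "open V" "z \<in> V" "\<forall>n. \<forall>w\<in>V. (f ^^ n) w \<notin> poles f"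
    "normal_seq_on (\<lambda>n. f ^^ n) V" "V \<subseteq> fatou f" by (rule fatouE[OF z])
  then show "\<exists>T. open T \<and> z \<in> T \<and> T \<subseteq> fatou f" by (intro exI[of _ V]) simp
qed

lemma holomorphic_on_fatou: "f holomorphic_on fatou f"
proof -
  have "f analytic_on {z}" if zF: "z \<in> fatou f" for z
  proof -
    have "(f ^^ 0) z \<notin> poles f" using zF unfolding fatou_def by blast
    then have "\<not> is_pole f z" by (simp add: poles_def)
    then show ?thesis using nicely_meromorphic_on_imp_analytic_at[OF nicely] by simp
  qed
  then have "f analytic_on fatou f" by (subst analytic_on_analytic_at) blast
  then show ?thesis by (rule analytic_imp_holomorphic)
qed

text \<open>Compact subsets of the open image \<open>W\<close> are pulled back into a closed disc in
  \<open>V\<close>, and the index is shifted by one; this transports normality from \<open>V\<close>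
  to \<open>W\<close>.\<close>

lemma fatou_image:
  assumes "z \<in> fatou f"
  shows "f z \<in> fatou f"
proof -
  obtain V where V: "open V" "z \<in> V" "\<forall>n. \<forall>w\<in>V. (f ^^ n) w \<notin> poles f"
    "normal_seq_on (\<lambda>n. f ^^ n) V" "V \<subseteq> fatou f" by (rule fatouE[OF assms])
  obtain e where e: "e > 0" "cball z e \<subseteq> V" using V(1,2) by (meson open_contains_cball)
  define W where "W = f ` ball z e"
  have hol: "f holomorphic_on cball z e" using holomorphic_on_fatou V(5) e(2) holomorphic_on_subset by blast
  have contf: "continuous_on (cball z e) f" by (rule holomorphic_on_imp_continuous_on[OF hol])
  have "open W"
    unfolding W_def
  proof (rule open_mapping_thm[of _ "ball z e"])
    show "f holomorphic_on ball z e" using hol ball_subset_cball holomorphic_on_subset by blast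
    show "\<not> f constant_on ball z e" using e by (intro nonconstant_on_open) auto
  qed auto
  moreover have "f z \<in> W" using e by (simp add: W_def)
  moreover have "(f ^^ n) w \<notin> poles f" if wW: "w \<in> W" for n w
  proof -
    obtain y where y: "y \<in> ball z e" "w = f y" using wW by (auto simp: W_def)
    have "(f ^^ Suc n) y \<notin> poles f" using V(3) e(2) y(1) by (meson ball_subset_cball subsetD)
    then show ?thesis using y by (simp add: funpow_swap1)
  qed
  moreover have "normal_seq_on (\<lambda>n. f ^^ n) W"
  proof (rule normal_seq_onI)
    fix m :: "nat \<Rightarrow> nat"
    define L where "L = (\<lambda>K. cball z e \<inter> f -` K)"
    have L: "compact (L K)" "L K \<subseteq> V" "\<And>w. w \<in> K \<Longrightarrow> \<exists>y\<in>L K. w = f y" if KW: "compact K" "K \<subseteq> W" for K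
    proof -
      have "closed (L K)" unfolding L_def
        using contf closed_cball compact_imp_closed[OF KW(1)] by (rule continuous_closed_preimage)
      moreover have "L K = cball z e \<inter> L K" by (auto simp: L_def)
      ultimately show "compact (L K)" using compact_Int_closed[OF compact_cball] by metis
      show "L K \<subseteq> V" using e by (auto simp: L_def)
      fix w assume w: "w \<in> K"
      then obtain y where "y \<in> ball z e" "w = f y" using KW(2) by (auto simp: W_def)
      then show "\<exists>y\<in>L K. w = f y" using w by (auto simp: L_def)
    qed
    have sw: "(f ^^ n) (f y) = (f ^^ Suc n) y" for n y by (simp add: funpow_swap1)
    from V(4) show "\<exists>r. strict_mono r \<and>
        ((\<exists>g. \<forall>K. compact K \<longrightarrow> K \<subseteq> W \<longrightarrow> uniform_limit K (\<lambda>k. f ^^ m (r k)) g sequentially)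
         \<or> (\<forall>K B. compact K \<longrightarrow> K \<subseteq> W \<longrightarrow>
              eventually (\<lambda>k. \<forall>z\<in>K. B \<le> norm ((f ^^ m (r k)) z)) sequentially))"
    proof (cases rule: normal_seq_onE[where m = "\<lambda>k. Suc (m k)"])
      case (finite r g)
      define g' where "g' = (\<lambda>w. lim (\<lambda>k. (f ^^ m (r k)) w))"
      have g': "g' (f y) = g y" if "y \<in> V" for y
      proof -
        have "uniform_limit {y} (\<lambda>k. f ^^ Suc (m (r k))) g sequentially" using finite(2)[of "{y}"] that by simp
        then have "(\<lambda>k. (f ^^ Suc (m (r k))) y) \<longlonglongrightarrow> g y" by (rule tendsto_uniform_limitI) simp
        then have "(\<lambda>k. (f ^^ m (r k)) (f y)) \<longlonglongrightarrow> g y" by (simp only: sw)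
        then show ?thesis unfolding g'_def by (rule limI)
      qed
      have "uniform_limit K (\<lambda>k. f ^^ m (r k)) g' sequentially" if K: "compact K" "K \<subseteq> W" for K
      proof (rule uniform_limitI)
        fix \<epsilon> :: real assume "\<epsilon> > 0"
        from uniform_limitD[OF finite(2)[OF L(1,2)[OF K]] this]
        show "eventually (\<lambda>k. \<forall>w\<in>K. dist ((f ^^ m (r k)) w) (g' w) < \<epsilon>) sequentially"
        proof eventually_elim
          case (elim k)
          show ?case
          proof
            fix w assume "w \<in> K"
            then obtain y where y: "y \<in> L K" "w = f y" using L(3)[OF K] by blast
            then have "y \<in> V" using L(2)[OF K] by blast
            then show "dist ((f ^^ m (r k)) w) (g' w) < \<epsilon>" using elim y g' sw by metis
          qed
        qed
      qed
      then show ?thesis using finite(1) by (intro exI[of _ r] conjI disjI1 exI[of _ g'] allI impI)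
    next
      case (infinite r)
      have "eventually (\<lambda>k. \<forall>w\<in>K. B \<le> norm ((f ^^ m (r k)) w)) sequentially" if K: "compact K" "K \<subseteq> W" for K B
        using infinite(2)[OF L(1,2)[OF K], of B]
      proof eventually_elim
        case (elim k)
        then show ?case using L(3)[OF K] sw by metis
      qed
      then show ?thesis using infinite(1) by (intro exI[of _ r] conjI disjI2 allI impI)
    qed
  qed
  ultimately show ?thesis unfolding fatou_def by blast
qed

lemma iter_fatou: "z \<in> fatou f \<Longrightarrow> (f ^^ n) z \<in> fatou f"
  by (induction n) (auto intro: fatou_image)

lemma holomorphic_iter: "(f ^^ n) holomorphic_on fatou f"
proof (induction n)
  case (Suc n)
  have "(f \<circ> f ^^ n) holomorphic_on fatou f"
    using Suc holomorphic_on_fatou iter_fatou by (intro holomorphic_on_compose_gen) auto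
  then show ?case by (simp only: funpow.simps)
qed (simp add: id_def)

lemma component_escapes:
  assumes W: "open W" "connected W" "W \<subseteq> fatou f" and K: "compact K" "K \<subseteq> W"
    and big: "\<And>B. eventually (\<lambda>n. \<exists>z\<in>K. B \<le> norm ((f ^^ n) z)) sequentially"
  shows "escapes (\<lambda>n. f ^^ n) W"
proof (rule normal_escapes[OF W(1,2) _ _ K big])
  fix z assume z: "z \<in> W"
  then have "z \<in> fatou f" using W(3) by blast
  then show "\<exists>V. open V \<and> z \<in> V \<and> normal_seq_on (\<lambda>n. f ^^ n) V" unfolding fatou_def by blast
next
  show "continuous_on W (f ^^ n)" for n
    by (rule continuous_on_subset[OF holomorphic_on_imp_continuous_on[OF holomorphic_iter] W(3)])
qed

lemma component_harnack:
  assumes W: "open W" "connected W" "W \<subseteq> fatou f" and esc: "escapes (\<lambda>n. f ^^ n) W"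
    and K: "compact K" "K \<subseteq> W"
  shows "\<exists>C>0. eventually (\<lambda>n. \<forall>z\<in>K. \<forall>w\<in>K. ln (norm ((f ^^ n) z)) \<le> C * ln (norm ((f ^^ n) w))) sequentially"
  by (rule escapes_harnack[OF W(1,2) holomorphic_on_subset[OF holomorphic_iter W(3)] esc K])

end

text \<open>Data of the proof for a component \<open>U\<close> containing a continuum \<open>K\<close> around a large disc: from the
  time \<open>N\<close> on the images of \<open>K\<close> separate a disc of radius \<open>\<rho> (n - 1)\<close> about \<open>0\<close> from infinity.\<close>

locale surrounding_orbit = meromorphic_tract +
  fixes U K :: "complex set" and \<rho> :: "nat \<Rightarrow> real" and N :: nat
  assumes comp: "fatou_component f U" and compact_K: "compact K" and connected_K: "connected K"
    and K_ne: "K \<noteq> {}" and K_U: "K \<subseteq> U"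
    and \<rho>_big: "\<And>n. real n \<le> \<rho> n" and N_pos: "N \<ge> 2"
    and far: "\<And>n y. n \<ge> N \<Longrightarrow> y \<in> K \<Longrightarrow> \<rho> (n - 1) \<le> norm ((f ^^ n) y)"
    and bounded_inside: "\<And>n. n \<ge> N \<Longrightarrow> bounded (connected_component_set (- (f ^^ n) ` K) 0)"
begin

definition a :: complex where "a = (SOME z. z \<in> U)"

abbreviation V :: "nat \<Rightarrow> complex set" where "V n \<equiv> iter_component f U n"

definition \<Gamma> :: "nat \<Rightarrow> complex set" where "\<Gamma> n = (f ^^ n) ` K"

definition J :: "nat \<Rightarrow> complex set" where "J n = connected_component_set (- \<Gamma> n) 0"

lemma U_props: "connected U" "U \<subseteq> fatou f" "open U"
  using comp connected_component_subset[of "fatou f"] open_connected_component[OF open_fatou]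
  by (auto simp: fatou_component_def)

lemma a_in: "a \<in> U"
proof -
  obtain x where "x \<in> U" using K_U K_ne by blast
  then show ?thesis unfolding a_def by (rule someI)
qed

lemma V_eq: "V n = connected_component_set (fatou f) ((f ^^ n) a)"
  by (simp add: iter_component_def a_def)

lemma V_props: "connected (V n)" "V n \<subseteq> fatou f" "open (V n)"
  unfolding V_eq using connected_component_subset open_connected_component[OF open_fatou] by auto

lemma a_in_V: "(f ^^ n) a \<in> V n"
  unfolding V_eq using a_in U_props(2) iter_fatou by auto

lemma subset_V:
  assumes "connected X" "X \<subseteq> fatou f" "X \<inter> V n \<noteq> {}"
  shows "X \<subseteq> V n"
  using subset_component_complement[of X "- fatou f" "(f ^^ n) a"] assms by (auto simp: V_eq)

lemma V_eqI:
  assumes "V m \<inter> V n \<noteq> {}"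
  shows "V m = V n"
proof
  show "V m \<subseteq> V n" using assms by (rule subset_V[OF V_props(1,2)])
  show "V n \<subseteq> V m" using assms by (intro subset_V[OF V_props(1,2)]) (simp add: Int_commute)
qed

lemma iter_add: "(f ^^ i) ((f ^^ j) z) = (f ^^ (i + j)) z"
  by (simp add: funpow_add)

lemma continuous_iter_fatou: "X \<subseteq> fatou f \<Longrightarrow> continuous_on X (f ^^ n)"
  by (rule continuous_on_subset[OF holomorphic_on_imp_continuous_on[OF holomorphic_iter]])

lemma iter_V: "(f ^^ j) ` V n \<subseteq> V (j + n)"
proof (rule subset_V)
  show "connected ((f ^^ j) ` V n)"
    using V_props continuous_iter_fatou by (intro connected_continuous_image) auto
  show "(f ^^ j) ` V n \<subseteq> fatou f" using V_props(2) iter_fatou by blast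
  show "(f ^^ j) ` V n \<inter> V (j + n) \<noteq> {}"
    using imageI[OF a_in_V[of n], of "f ^^ j"] a_in_V[of "j + n"] by (auto simp: iter_add)
qed

lemma \<Gamma>_V: "\<Gamma> n \<subseteq> V n"
proof -
  have "U \<subseteq> V 0" using U_props a_in a_in_V[of 0] by (intro subset_V) auto
  then have "(f ^^ n) ` U \<subseteq> V n" using iter_V[of n 0] by auto
  then show ?thesis using K_U by (auto simp: \<Gamma>_def)
qed

lemma \<Gamma>_props: "compact (\<Gamma> n)" "connected (\<Gamma> n)" "\<Gamma> n \<noteq> {}" "closed (\<Gamma> n)"
proof -
  have c: "continuous_on K (f ^^ n)" using K_U U_props(2) by (intro continuous_iter_fatou) auto
  show "compact (\<Gamma> n)" unfolding \<Gamma>_def by (rule compact_continuous_image[OF c compact_K])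
  then show "closed (\<Gamma> n)" by (rule compact_imp_closed)
  show "connected (\<Gamma> n)" unfolding \<Gamma>_def by (rule connected_continuous_image[OF c connected_K])
  show "\<Gamma> n \<noteq> {}" using K_ne by (simp add: \<Gamma>_def)
qed

lemma iter_\<Gamma>: "(f ^^ j) ` \<Gamma> n = \<Gamma> (j + n)"
  by (simp add: \<Gamma>_def image_comp funpow_add)

lemma \<Gamma>_far: "n \<ge> N \<Longrightarrow> w \<in> \<Gamma> n \<Longrightarrow> \<rho> (n - 1) \<le> norm w"
  using far by (auto simp: \<Gamma>_def)

lemma \<Gamma>_far': "n \<ge> N \<Longrightarrow> w \<in> \<Gamma> n \<Longrightarrow> real n - 1 \<le> norm w"
  using \<Gamma>_far[of n w] \<rho>_big[of "n - 1"] N_pos by (simp add: of_nat_diff)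

lemma ball_J:
  assumes "\<And>w. w \<in> \<Gamma> n \<Longrightarrow> s \<le> norm w"
  shows "ball 0 s \<subseteq> J n"
proof (cases "s > 0")
  case True
  have "ball 0 s \<inter> \<Gamma> n = {}" using assms by force
  then show ?thesis unfolding J_def using True by (intro connected_component_maximal) auto
next
  case False
  then have "ball (0::complex) s = {}" by simp
  then show ?thesis by blast
qed

lemma J_props:
  assumes "n \<ge> N"
  shows "open (J n)" "connected (J n)" "bounded (J n)" "frontier (J n) \<subseteq> \<Gamma> n"
  using bounded_inside[OF assms] open_component_complement[OF \<Gamma>_props(4)]
    frontier_component_complement[OF \<Gamma>_props(4)]
  by (auto simp: J_def \<Gamma>_def[symmetric])

lemma in_J: "n \<ge> N \<Longrightarrow> norm w < real n - 1 \<Longrightarrow> w \<in> J n"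
  using ball_J[of n "real n - 1"] \<Gamma>_far' by auto

text \<open>If \<open>V m = V n\<close> with \<open>m < n\<close>, Harnack's inequality makes \<open>ln |f\<^sup>j|\<close> on \<open>\<Gamma> n\<close> and on \<open>\<Gamma> m\<close>
  comparable, uniformly in \<open>j\<close>; but passing from \<open>\<Gamma> j\<close> to \<open>\<Gamma> (j + 1)\<close> multiplies the logarithm
  of the modulus by any given factor eventually.\<close>

lemma V_distinct_less:
  assumes "m < n"
  shows "V m \<noteq> V n"
proof
  assume eq: "V m = V n"
  \<comment> \<open>The shift by \<open>N\<close> moves both indices into the range where
    \<open>far\<close> holds.\<close>
  define m' where "m' = N + m"
  define n' where "n' = N + n"
  have "V m' = V n'"
  proof (rule V_eqI)
    have "(f ^^ n) a \<in> V m" using a_in_V eq by simp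
    then have "(f ^^ N) ((f ^^ n) a) \<in> V m'" using iter_V[of N m] by (auto simp: m'_def)
    then have "(f ^^ n') a \<in> V m'" by (simp add: iter_add n'_def)
    then show "V m' \<inter> V n' \<noteq> {}" using a_in_V[of n'] by blast
  qed
  define p where "p = n' - m'"
  have p: "p \<ge> 1" "n' = p + m'" using assms by (auto simp: p_def m'_def n'_def)
  define W where "W = V m'"
  define K2 where "K2 = \<Gamma> m' \<union> \<Gamma> n'"
  have K2: "compact K2" "K2 \<subseteq> W"
    using \<Gamma>_props(1) \<Gamma>_V[of m'] \<Gamma>_V[of n'] \<open>V m' = V n'\<close> by (auto simp: K2_def W_def)
  have W: "open W" "connected W" "W \<subseteq> fatou f" using V_props by (auto simp: W_def)
  have esc: "escapes (\<lambda>n. f ^^ n) W"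
  proof (rule component_escapes[OF W \<Gamma>_props(1)])
    show "\<Gamma> m' \<subseteq> W" using \<Gamma>_V by (simp add: W_def)
    fix B :: real
    obtain j0 :: nat where j0: "B + 1 \<le> real j0" using real_arch_simple by blast
    have "\<exists>z\<in>\<Gamma> m'. B \<le> norm ((f ^^ j) z)" if "j \<ge> j0" for j
    proof -
      obtain z where z: "z \<in> \<Gamma> m'" using \<Gamma>_props(3) by blast
      then have "(f ^^ j) z \<in> \<Gamma> (j + m')" using iter_\<Gamma>[of j m'] by blast
      then have "real (j + m') - 1 \<le> norm ((f ^^ j) z)" by (intro \<Gamma>_far') (auto simp: m'_def)
      then show ?thesis using z that j0 by (intro bexI[of _ z]) auto
    qed
    then show "eventually (\<lambda>j. \<exists>z\<in>\<Gamma> m'. B \<le> norm ((f ^^ j) z)) sequentially"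
      by (auto simp: eventually_sequentially)
  qed
  obtain C where C: "C > 0" "eventually (\<lambda>j. \<forall>z\<in>K2. \<forall>w\<in>K2. ln (norm ((f ^^ j) z)) \<le> C * ln (norm ((f ^^ j) w))) sequentially"
    using component_harnack[OF W esc K2] by blast
  then obtain j1 where j1: "\<And>j z w. j \<ge> j1 \<Longrightarrow> z \<in> K2 \<Longrightarrow> w \<in> K2 \<Longrightarrow>
      ln (norm ((f ^^ j) z)) \<le> C * ln (norm ((f ^^ j) w))"
    by (auto simp: eventually_sequentially)
  have "\<exists>y\<in>\<Gamma> i. \<forall>w\<in>\<Gamma> i. norm y \<le> norm w" for i
    using continuous_attains_inf[OF \<Gamma>_props(1,3), of i norm] continuous_on_norm_id by blast
  then obtain y where y: "\<And>i. y i \<in> \<Gamma> i" "\<And>i w. w \<in> \<Gamma> i \<Longrightarrow> norm (y i) \<le> norm w" by metis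
  define L where "L = (\<lambda>i. ln (norm (y i)))"
  have harn: "ln (norm x) \<le> C * L (j + m')"
    if j: "j \<ge> j1" and x: "x \<in> \<Gamma> (j + m') \<or> x \<in> \<Gamma> (j + n')" for j x
  proof -
    obtain z where z: "z \<in> K2" "x = (f ^^ j) z"
      using x iter_\<Gamma>[of j m'] iter_\<Gamma>[of j n'] unfolding K2_def by blast
    obtain w where w: "w \<in> K2" "y (j + m') = (f ^^ j) w"
      using y(1)[of "j + m'"] iter_\<Gamma>[of j m'] unfolding K2_def by blast
    show ?thesis using j1[OF j z(1) w(1)] z(2) w(2) by (simp add: L_def)
  qed
  obtain q0 where q0: "q0 \<notin> D" using unbounded_compl bounded_empty by (metis ComplD equals0I)
  \<comment> \<open>The 2 compensates the square root in \<open>s\<close>, the \<open>C\<close> pays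
    for Harnack from \<open>f x\<close> to the minimum on the next image, and C + 1 is a growth
    factor that the constant \<open>C\<close> cannot match.\<close>
  define \<kappa> where "\<kappa> = 2 * C * (C + 1)"
  obtain s0 where s0: "s0 > 1" "\<And>s. s \<ge> s0 \<Longrightarrow> \<kappa> * ln s \<le> ln (M s)" using M_growth by blast
  obtain s1 where s1: "s1 > 1" "\<And>s. s \<ge> s1 \<Longrightarrow> 1 * ln s \<le> ln (M s)" using M_growth by blast
  obtain i0 :: nat where i0: "(max (max s0 s1) (M 0 + 1))\<^sup>2 + norm q0 + 4 + real (j1 + n') \<le> real i0"
    using real_arch_simple by blast
  have grow: "L (Suc i) \<ge> (C + 1) * L i" "L i > 0" if i: "i \<ge> i0" for i
  proof -
    define S where "S = max (max s0 s1) (M 0 + 1)"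
    have S: "S \<ge> s0" "S \<ge> s1" "S > M 0" "S > 1" using s0(1) by (auto simp: S_def)
    have iS: "S\<^sup>2 + norm q0 + 4 + real (j1 + n') \<le> real i" using i0 i unfolding S_def by linarith
    have iN: "i \<ge> N" "i \<ge> j1 + m'"
    proof -
      have "real (j1 + n') \<le> real i" using iS zero_le_power2[of S] norm_ge_zero[of q0] by linarith
      then show "i \<ge> N" "i \<ge> j1 + m'" using assms by (auto simp: n'_def m'_def)
    qed
    have ny: "real i - 1 \<le> norm (y i)" using \<Gamma>_far'[OF iN(1) y(1)] .
    then have nyS: "S\<^sup>2 < norm (y i)" "norm q0 < real i - 1" "norm (y i) > 1"
      using iS norm_ge_zero[of q0] zero_le_power2[of S] by linarith+
    show L0: "L i > 0" unfolding L_def using nyS(3) by (rule ln_gt_zero)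
    \<comment> \<open>The closed disc of radius \<open>s\<close> must fit into \<open>J i\<close>
      while \<open>ln s\<close> stays comparable to \<open>L i\<close>.\<close>
    define s where "s = sqrt (norm (y i))"
    have s: "s > S" "s * s = norm (y i)" "s > 0"
    proof -
      show "s > S" unfolding s_def by (rule real_less_rsqrt[OF nyS(1)])
      then show "s > 0" using S by simp
      show "s * s = norm (y i)" by (simp add: s_def)
    qed
    have sl: "ln s = L i / 2" using s by (simp add: L_def s(2)[symmetric] ln_mult_pos)
    have "s < norm (y i)" using s S mult_strict_right_mono[of 1 s s] by simp
    then have "cball 0 s \<subseteq> ball 0 (norm (y i))" by auto
    also have "\<dots> \<subseteq> J i" using y(2) by (rule ball_J)
    finally have cb: "cball 0 s \<subseteq> J i" .
    have "q0 \<in> J i" using in_J[OF iN(1) nyS(2)] .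
    then have nD: "\<not> J i \<subseteq> D" using q0 by blast
    have "s \<le> M s"
    proof -
      have "ln s \<le> ln (M s)" using s1(2)[of s] s S by simp
      then show ?thesis using ln_le_cancel_iff[OF s(3) M_pos[of s]] by blast
    qed
    then have M0: "M 0 < M s" using S s by linarith
    obtain x where x: "x \<in> \<Gamma> i" "M s \<le> norm (f x)"
      using modulus_large_on_boundary[OF J_props[OF iN(1)] nD cb _ M0] s by auto
    have "f x \<in> \<Gamma> (Suc i)" using x(1) iter_\<Gamma>[of 1 i] by auto
    moreover define j where "j = Suc i - m'"
    have j: "j \<ge> j1" "Suc i = j + m'" using iN(2) by (auto simp: j_def)
    ultimately have "ln (norm (f x)) \<le> C * L (Suc i)" using harn[OF j(1), of "f x"] j(2) by simp
    moreover have "ln (M s) \<le> ln (norm (f x))" using x(2) M_pos[of s] by (intro ln_mono) auto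
    moreover have "\<kappa> * ln s \<le> ln (M s)" using s S by (intro s0) auto
    ultimately have "\<kappa> * (L i / 2) \<le> C * L (Suc i)" using sl by simp
    then have "C * ((C + 1) * L i) \<le> C * L (Suc i)" by (simp add: \<kappa>_def algebra_simps)
    then show "L (Suc i) \<ge> (C + 1) * L i" using C(1) by simp
  qed
  have mono: "L (k + i) \<ge> L i" if "i \<ge> i0" for i k
  proof (induction k)
    case (Suc k)
    have g: "L (k + i) > 0" "(C + 1) * L (k + i) \<le> L (Suc (k + i))" using grow[of "k + i"] that by auto
    have "0 \<le> C * L (k + i)" using g(1) C(1) by simp
    then have "L (k + i) \<le> L (Suc (k + i))" using g(2) by (simp only: distrib_right)
    then show ?case using Suc by simp
  qed simp
  define i where "i = i0 + j1 + m'"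
  obtain p' where p': "p = Suc p'" using p(1) by (cases p) auto
  have ii: "i \<ge> i0" "i = (i0 + j1) + m'" by (auto simp: i_def)
  \<comment> \<open>The indices i and i + p belong to the images of \<Gamma> m' and \<Gamma> n' at
    the same time i0 + j1, so growth by C + 1 meets the Harnack bound \<open>C\<close>.\<close>
  have "(C + 1) * L i \<le> L (Suc i)" using grow(1) ii by simp
  also have "\<dots> \<le> L (p' + Suc i)" using mono[of "Suc i" p'] ii by simp
  also have "p' + Suc i = (i0 + j1) + n'" using p p' by (simp add: i_def)
  also have "L ((i0 + j1) + n') \<le> C * L ((i0 + j1) + m')"
    using harn[of "i0 + j1" "y ((i0 + j1) + n')"] y(1) by (simp add: L_def)
  finally have "(C + 1) * L i \<le> C * L i" using ii by simp
  then show False using grow(2)[OF ii(1)] by (simp add: distrib_right)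
qed

lemma V_distinct: "m \<noteq> n \<Longrightarrow> V m \<noteq> V n"
  using V_distinct_less by (metis linorder_neqE_nat)

lemma V_disjoint_\<Gamma>:
  assumes "m \<noteq> n"
  shows "V m \<inter> \<Gamma> n = {}"
  using V_distinct[OF assms] \<Gamma>_V[of n] V_eqI[of m n] by blast

lemma V_in_J:
  assumes "m \<noteq> n" "V m \<inter> J n \<noteq> {}"
  shows "V m \<subseteq> J n"
  using subset_component_complement[OF V_props(1) V_disjoint_\<Gamma>[OF assms(1)]] assms(2)
  unfolding J_def by blast

text \<open>The bounded sets \<open>J l\<close> exhaust the plane, and \<open>V n\<close> cannot
  cross \<Gamma> l for l \<noteq> n.\<close>

lemma bounded_V: "bounded (V n)"
proof -
  obtain w where w: "w \<in> V n" using a_in_V by blast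
  obtain l :: nat where l: "norm w + real n + real N + 2 \<le> real l" using real_arch_simple by blast
  then have "l \<ge> N" "l \<noteq> n" using norm_ge_zero[of w] by linarith+
  then have "w \<in> J l" using l by (intro in_J) linarith+
  then have "V n \<subseteq> J l" using w \<open>l \<noteq> n\<close> by (intro V_in_J) auto
  then show ?thesis using J_props(3)[OF \<open>l \<ge> N\<close>] bounded_subset by blast
qed

text \<open>If it met a fixed disc, \<open>V n\<close> would be trapped in one bounded
  \<open>J l\<close>, yet it contains the distant \<Gamma> n.\<close>

lemma V_to_infinity: "eventually (\<lambda>n. \<forall>z\<in>V n. T < norm z) sequentially"
proof -
  obtain l :: nat where l: "\<bar>T\<bar> + real N + 2 \<le> real l" using real_arch_simple by blast
  then have lN: "l \<ge> N" using abs_ge_zero[of T] by linarith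
  obtain b where b: "\<And>z. z \<in> J l \<Longrightarrow> norm z \<le> b" using J_props(3)[OF lN] unfolding bounded_iff by blast
  obtain n0 :: nat where n0: "b + real l + 3 \<le> real n0" "real l + 3 \<le> real n0"
    using real_arch_simple[of "max (b + real l + 3) (real l + 3)"] by auto
  have "T < norm z" if n: "n \<ge> n0" and z: "z \<in> V n" for n z
  proof (rule ccontr)
    assume "\<not> T < norm z"
    then have "norm z \<le> \<bar>T\<bar>" by simp
    then have "z \<in> J l" using l lN by (intro in_J) linarith+
    moreover have nl: "n \<noteq> l" using n n0(2) by linarith
    ultimately have "V n \<subseteq> J l" using z by (intro V_in_J) auto
    moreover obtain w where w: "w \<in> \<Gamma> n" using \<Gamma>_props(3) by blast
    ultimately have "norm w \<le> b" using \<Gamma>_V b by blast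
    moreover have "n \<ge> N" using n n0(2) lN by linarith
    then have "real n - 1 \<le> norm w" using \<Gamma>_far' w by blast
    ultimately show False using n n0(1) by linarith
  qed
  then show ?thesis by (auto simp: eventually_sequentially)
qed

theorem baker: "baker_wandering_domain f U"
  unfolding baker_wandering_domain_def
proof (intro conjI allI impI)
  obtain n0 where n0: "\<And>n z. n \<ge> n0 \<Longrightarrow> z \<in> V n \<Longrightarrow> 0 < norm z"
    using V_to_infinity[of 0] by (auto simp: eventually_sequentially)
  \<comment> \<open>Since \<Gamma> n is part of \<open>V n\<close>, the complementary component of 0
    is contained in the bounded \<open>J n\<close>; a bounded complementary component also excludes
    simple connectivity.\<close>
  have surr: "connected_component_set (- V n) 0 \<in> components (- V n)"
     "bounded (connected_component_set (- V n) 0)" "0 \<in> connected_component_set (- V n) 0"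
    if n: "n \<ge> max n0 N" for n
  proof -
    have "0 \<notin> V n" using n0[of n 0] n by auto
    then show "connected_component_set (- V n) 0 \<in> components (- V n)"
      "0 \<in> connected_component_set (- V n) 0" by (auto simp: components_def)
    have "connected_component_set (- V n) 0 \<subseteq> J n"
      unfolding J_def using \<Gamma>_V by (intro connected_component_mono) auto
    then show "bounded (connected_component_set (- V n) 0)"
      using J_props(3) n bounded_subset by auto
  qed
  have "surrounds_point (V n) 0" "\<not> simply_connected (V n)" if "n \<ge> max n0 N" for n
  proof -
    show "surrounds_point (V n) 0" unfolding surrounds_point_def using surr[OF that] by blast
    show "\<not> simply_connected (V n)"
      using surr[OF that] simply_connected_eq_unbounded_complement_components[OF V_props(3)] by blast
  qed
  then show "\<exists>N. \<forall>n\<ge>N. bounded (V n) \<and> \<not> simply_connected (V n) \<and> surrounds_point (V n) 0"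
    using bounded_V by blast
qed (use comp V_distinct V_to_infinity in auto)

end

section \<open>Choice of the radius and conclusion\<close>

context meromorphic_tract
begin

lemma surrounding_component_baker:
  "\<exists>r0>0. \<forall>U K. fatou_component f U \<and> compact K \<and> connected K \<and> K \<noteq> {} \<and> K \<subseteq> U \<and>
      sphere 0 r0 \<subseteq> inside K \<longrightarrow> baker_wandering_domain f U"
proof -
  obtain p where p: "p \<notin> D" using unbounded_compl bounded_empty by (metis ComplD equals0I)
  obtain \<rho> where \<rho>: "\<rho> 0 > M 0"
      "\<And>j. \<rho> j > 1 \<and> M (\<rho> j) < \<rho> (Suc j) \<and> 2 * \<rho> j < \<rho> (Suc j)"
    and orbit: "\<And>n. \<exists>z. norm z < exp 8 * \<rho> 0 \<and> (\<forall>j\<le>n. (f ^^ j) z \<in> D \<and> \<rho> j < norm ((f ^^ j) z))"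
    using escaping_orbits[OF M_pos[of 0]] by blast
  \<comment> \<open>The shift by one index gives M(r(n-1)) < \<rho>(n-1), and \<rho>(n-1) is the
    lower bound that will hold on all of \<open>K\<close>. The orbits meet the weakened conditions
    since r k <= \<rho> k.\<close>
  define r where "r = (\<lambda>j. case j of 0 \<Rightarrow> 0 | Suc i \<Rightarrow> \<rho> i)"
  have r: "r 0 = 0" "\<And>k. r (Suc k) = \<rho> k" by (auto simp: r_def)
  have r_step: "M (r k) < r (Suc k)" for k using \<rho> r by (cases k) auto
  have r_le: "r k \<le> \<rho> k" for k
  proof (cases k)
    case 0 then show ?thesis using r \<rho>(2)[of 0] by simp
  next
    case (Suc j) then show ?thesis using r \<rho>(2)[of j] by simp
  qed
  have \<rho>_big: "real n \<le> \<rho> n" for n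
  proof (induction n)
    case 0 then show ?case using \<rho>(2)[of 0] by simp
  next
    case (Suc n) then show ?case using \<rho>(2)[of n] by simp
  qed
  \<comment> \<open>The disc must contain the starting points of the orbits of all lengths, and a
    point outside \<open>D\<close> so that \<open>I\<close> is not a subset of
    \<open>D\<close>.\<close>
  define r0 where "r0 = max (exp 8 * \<rho> 0) (norm p) + 1"
  have "norm p + 1 \<le> r0" "exp 8 * \<rho> 0 + 1 \<le> r0" by (auto simp: r0_def)
  then have r0: "r0 > 0" "r0 > norm p" "r0 > exp 8 * \<rho> 0"
    using norm_ge_zero[of p] by linarith+
  have "baker_wandering_domain f U"
    if U: "fatou_component f U" and K: "compact K" "connected K" "K \<noteq> {}" "K \<subseteq> U"
      and sph: "sphere 0 r0 \<subseteq> inside K" for U K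
  proof -
    define I where "I = connected_component_set (- K) 0"
    have closedK: "closed K" using K(1) by (rule compact_imp_closed)
    have I: "open I" "connected I" "bounded I" "frontier I \<subseteq> K" "cball 0 r0 \<subseteq> I"
      using open_component_complement[OF closedK] frontier_component_complement[OF closedK]
        cball_in_inside[OF K(2,1) r0(1) sph] by (auto simp: I_def)
    have "p \<in> I" using I(5) r0 by auto
    then have ID: "\<not> I \<subseteq> D" using p by blast
    obtain zz where zz: "\<And>n. norm (zz n) < exp 8 * \<rho> 0"
        "\<And>n j. j \<le> n \<Longrightarrow> (f ^^ j) (zz n) \<in> D \<and> \<rho> j < norm ((f ^^ j) (zz n))"
      using orbit by metis
    have st: "surrounding_tract f D R I K r n (zz n)" if n: "n \<ge> 1" for n
    proof unfold_locales
      show "zz n \<in> I"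
      proof -
        have "zz n \<in> cball 0 r0" using zz(1)[of n] r0 by auto
        then show ?thesis using I(5) by blast
      qed
      show "(f ^^ j) (zz n) \<in> D \<and> r j < norm ((f ^^ j) (zz n))" if "j < n" for j
        using zz(2)[of j n] r_le[of j] that by auto
      obtain k where "n = Suc k" using n by (cases n) auto
      then show "M (r (n - 1)) < norm ((f ^^ n) (zz n))"
        using r_step[of k] r_le[of "Suc k"] zz(2)[of n n] by auto
    qed (use I ID r r_step n in auto)
    have Uo: "open U" "connected U" "U \<subseteq> fatou f"
      using U connected_component_subset[of "fatou f"] open_connected_component[OF open_fatou]
      by (auto simp: fatou_component_def)
    have large: "\<exists>y\<in>K. \<rho> n < norm ((f ^^ n) y)" if "n \<ge> 1" for n
      using surrounding_tract.iterate_large_on_K[OF st[OF that]] zz(2)[of n n] order_less_le_trans by blast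
    have esc: "escapes (\<lambda>n. f ^^ n) U"
    proof (rule component_escapes[OF Uo K(1,4)])
      fix B :: real
      obtain n0 :: nat where n0: "B \<le> real n0" using real_arch_simple by blast
      have "\<exists>z\<in>K. B \<le> norm ((f ^^ n) z)" if "n \<ge> Suc n0" for n
        using large[of n] \<rho>_big[of n] n0 that by force
      then show "eventually (\<lambda>n. \<exists>z\<in>K. B \<le> norm ((f ^^ n) z)) sequentially"
        by (auto simp: eventually_sequentially)
    qed
    obtain C where C: "C > 0" "eventually (\<lambda>n. \<forall>z\<in>K. \<forall>w\<in>K.
        ln (norm ((f ^^ n) z)) \<le> C * ln (norm ((f ^^ n) w))) sequentially"
      using component_harnack[OF Uo esc K(1,4)] by blast
    obtain s0 where s0: "s0 > 1" "\<And>s. s \<ge> s0 \<Longrightarrow> C * ln s \<le> ln (M s)" using M_growth by blast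
    obtain n0 :: nat where n0: "s0 + 2 \<le> real n0" using real_arch_simple by blast
    \<comment> \<open>Harnack costs one index: C ln \<rho>(n-1) <= ln M(\<rho>(n-1)) < ln \<rho>(n),
      and \<rho>(n) is exceeded somewhere on \<open>K\<close>.\<close>
    have "eventually (\<lambda>n. \<forall>y\<in>K. \<rho> (n - 1) \<le> norm ((f ^^ n) y)) sequentially"
      using C(2) escapesD[OF esc K(1,4), of 2] eventually_ge_at_top[of n0]
    proof eventually_elim
      case (elim n)
      obtain k where k: "n = Suc k" using elim(3) n0 s0(1) by (cases n) auto
      obtain y' where y': "y' \<in> K" "\<rho> n < norm ((f ^^ n) y')" using large[of n] k by auto
      have "\<rho> k \<ge> s0" using \<rho>_big[of k] k elim(3) n0 by simp
      then have "C * ln (\<rho> k) \<le> ln (M (\<rho> k))" by (rule s0)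
      also have "\<dots> \<le> ln (norm ((f ^^ n) y'))"
        using \<rho>(2)[of k] M_pos[of "\<rho> k"] y' k by (intro ln_mono) auto
      finally have 1: "C * ln (\<rho> k) \<le> ln (norm ((f ^^ n) y'))" .
      show ?case
      proof
        fix y assume y: "y \<in> K"
        then have "ln (norm ((f ^^ n) y')) \<le> C * ln (norm ((f ^^ n) y))" using elim(1) y' by blast
        with 1 have "C * ln (\<rho> k) \<le> C * ln (norm ((f ^^ n) y))" by linarith
        then have "ln (\<rho> k) \<le> ln (norm ((f ^^ n) y))" using C(1) by simp
        moreover have "2 \<le> norm ((f ^^ n) y)" using elim(2) y by blast
        moreover have "\<rho> k > 0" using \<rho>(2)[of k] by linarith
        ultimately have "\<rho> k \<le> norm ((f ^^ n) y)" by (subst (asm) ln_le_cancel_iff) auto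
        then show "\<rho> (n - 1) \<le> norm ((f ^^ n) y)" using k by simp
      qed
    qed
    then obtain n1 where n1: "\<And>n y. n \<ge> n1 \<Longrightarrow> y \<in> K \<Longrightarrow> \<rho> (n - 1) \<le> norm ((f ^^ n) y)"
      by (auto simp: eventually_sequentially)
    interpret surrounding_orbit f D R U K \<rho> "max n1 2"
    proof unfold_locales
      fix n assume n: "n \<ge> max n1 2"
      then obtain k where k: "n = Suc (Suc k)" by (metis Suc_le_D max.bounded_iff numeral_2_eq_2 Suc_le_mono)
      have "M (r (n - 1)) < \<rho> (n - 1)" using r_step[of "Suc k"] r k by simp
      then show "bounded (connected_component_set (- (f ^^ n) ` K) 0)"
        using n n1 by (intro surrounding_tract.image_surrounds_zero[OF st, of n "\<rho> (n - 1)"]) auto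
    qed (use U K \<rho>_big n1 in auto)
    show ?thesis by (rule baker)
  qed
  then show ?thesis using r0(1) by blast
qed

end

theorem theorem5p2:
  fixes f :: "complex \<Rightarrow> complex" and D :: "complex set"
  assumes "transcendental_meromorphic f"
    and "direct_tract f D"
  shows "\<exists>r0>0. \<forall>U. fatou_component f U \<longrightarrow>
           (\<exists>\<gamma>. simple_path \<gamma> \<and> pathfinish \<gamma> = pathstart \<gamma> \<and> path_image \<gamma> \<subseteq> U \<and>
                 sphere 0 r0 \<subseteq> inside (path_image \<gamma>)) \<longrightarrow>
           baker_wandering_domain f U"
proof -
  obtain R where R: "R > 0" "\<forall>z\<in>frontier D. norm (f z) = R" "\<forall>z\<in>D. norm (f z) > R"
    using assms(2) unfolding direct_tract_def by blast
  interpret meromorphic_tract f D R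
    by unfold_locales
       (use assms R in \<open>auto simp: direct_tract_def transcendental_meromorphic_def\<close>)
  obtain r0 where r0: "r0 > 0" "\<And>U K. fatou_component f U \<Longrightarrow> compact K \<Longrightarrow> connected K \<Longrightarrow> K \<noteq> {} \<Longrightarrow> K \<subseteq> U \<Longrightarrow>
      sphere 0 r0 \<subseteq> inside K \<Longrightarrow> baker_wandering_domain f U"
    using surrounding_component_baker by blast
  have "baker_wandering_domain f U"
    if "fatou_component f U" "simple_path \<gamma>" "path_image \<gamma> \<subseteq> U" "sphere 0 r0 \<subseteq> inside (path_image \<gamma>)" for U \<gamma>
    using that r0(2)[OF that(1) compact_simple_path_image connected_simple_path_image] by auto
  then show ?thesis using r0(1) by blast
qed

end
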